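(* Let $T>0$, $\beta\in(0,1)$, let $H\colon[0,T]\times\mathbb{R}^d\times\mathbb{R}^d\to\mathbb{R}$, and let $\mathcal{L}$ be a Lévy operator with triplet $(A,0,\mu)$ and heat kernel $p_t$. Assume: (1) $p_t\in C_b^\infty(\mathbb{R}^d)$ and there exist $\alpha\in(1,2]$ and $c_0>0$ such that $\int_{\mathbb{R}^d}|Dp_t(y)|\,dy\le c_0t^{-1/\alpha}$ for all $t\in(0,T]$; moreover $\alpha+\beta\in(1,2)\cup(2,3)$; (2) $A=0$ and there is $c>0$ such that for all $r\in(0,1)$: $$r^{-\beta}\int_{B_r}|y|^{\alpha+\beta}\,d\mu(y)+r^{\alpha-1}\int_{B_1\setminus B_r}|y|\,d\mu(y)\le c\quad\text{if }\alpha+\beta\in(1,2),$$ $$r^{\alpha-2}\int_{B_r}|y|^2\,d\mu(y)+r^{1-\beta}\int_{B_1\setminus B_r}|y|^{\alpha+\beta-1}\,d\mu(y)\le c\quad\text{if }\alpha+\beta\in(2,3);$$ (3) $H$ is continuous, there is $H_0>0$ with $|H(t,x,0)|\le H_0$ for all $t\in(0,T)$, $x\in\mathbb{R}^d$, and for each $R>0$ there is $L_R>0$ such that $|H(t,x,p)-H(t,x,q)|\le L_R|p-q|$ for all $t\in(0,T)$, $x\in\mathbb{R}^d$, $p,q\in B(0,R)$; (4) for each $R>0$ there is $M_R>0$ such that $|H(t,x,p)-H(t,x',p)|\le M_R|x-x'|^\beta$ for all $t\in[0,T]$, $p\in B(0,R)$ and $x,x'\in\mathbb{R}^d$ with $|x-x'|<1$;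 (5) for each $R>0$ there is $K_R>0$ such that $|H(t_2,x,p)-H(t_1,x,p)|\le K_R|t_2-t_1|^{\beta/\alpha}$ for all $t_1,t_2\in[0,T]$ with $|t_2-t_1|<1$, $x\in\mathbb{R}^d$, $p\in B(0,R)$; (6) $u_0\in C_b^{\alpha+\beta}(\mathbb{R}^d)$. Let $u\in C_b((0,T];C_b^1(\mathbb{R}^d))$ be a mild solution of $\partial_tu-\mathcal{L}u-H(t,x,Du)=0$ in $(0,T]\times\mathbb{R}^d$, $u(0,\cdot)=u_0$. Then $$\|u\|_{C_b^{\frac{\alpha+\beta}{\alpha},\alpha+\beta}([0,T]\times\mathbb{R}^d)}\le C\Big(\sup_{t\in[0,T]}\|u(t,\cdot)\|_{C_b^{\alpha+\beta}}+1\Big),$$ where $C$ depends only on $d,\alpha,\beta,T,\|Du\|_\infty$, $H$ and $\mathcal{L}$.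
   Context: Lévy operator: $A$ is a nonnegative definite real symmetric $d\times d$ matrix, $\mu\ge 0$ is a Borel measure on $\mathbb{R}^d\setminus\{0\}$ with $\int(1\wedge|z|^2)\,d\mu(z)<\infty$, and $$\mathcal{L}\varphi(x)=\operatorname{div}(AD\varphi(x))+\int_{\mathbb{R}^d}\big[\varphi(x+z)-\varphi(x)-\mathbf{1}_{|z|<1}D\varphi(x)\cdot z\big]\,d\mu(z).$$ Heat kernel: $p_t$, $t>0$, are the probability measures with $\int e^{-i\xi\cdot x}p_t(dx)=e^{-t\psi(\xi)}$, where $\psi(\xi)=\xi\cdot A\xi+\int(1-e^{i\xi\cdot z}+i\xi\cdot z\mathbf{1}_{|z|<1})\,d\mu(z)$; they are assumed absolutely continuous with density again denoted $p_t$. Semigroup: $P_t\varphi=p_t*\varphi$. $B_r=B(0,r)$. Hölder spaces: $C_b^n$ has norm $\sum_{j\le n}\max_{|\kappa|=j}\|\partial^\kappa\varphi\|_\infty$; for $\gamma=n+\beta'$ with $\beta'\in(0,1)$, $\|\varphi\|_{C_b^\gamma}=\|\varphi\|_{C_b^n}+\max_{|\kappa|=n}[\partial^\kappa\varphi]_{\beta'}$ with $[\cdot]_{\beta'}$ the usual global Hölder seminorm; analogously on $[0,T]$. Space-time norm: $$\|u\|_{C_b^{\frac{\alpha+\beta}{\alpha},\alpha+\beta}([0,T]\times\mathbb{R}^d)}=\sup_{t\in[0,T]}\|u(t,\cdot)\|_{C_b^{\alpha+\beta}(\mathbb{R}^d)}+\sup_{x}\|u(\cdot,x)\|_{C_b^{\frac{\alpha+\beta}{\alpha}}([0,T])}+\sup_{t\in[0,T]}[\partial_tu(t,\cdot)]_\beta+\sum_{k=1}^{\lfloor\alpha+\beta\rfloor}\sup_x[D^ku(\cdot,x)]_{\frac{\alpha+\beta-k}{\alpha}}.$$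 $D^k$ is the tensor of spatial derivatives of order $k$; $\|Du\|_\infty$ is the supremum over $(0,T]\times\mathbb{R}^d$; $C_b((0,T];X)$ denotes bounded continuous functions from $(0,T]$ to $X$. Mild solution: $u\in C((0,T];C_b^1(\mathbb{R}^d))$ such that for all $t\in(0,T]$, $x\in\mathbb{R}^d$, $$u(t,x)=P_t[u_0](x)+\int_0^tP_{t-s}\big[H(s,\cdot,Du(s,\cdot))\big](x)\,ds;$$ one sets $u(0,\cdot)=u_0$. *)

theory Defs
  imports "HOL-Probability.Probability"
begin

section \<open>Bounded and Hoelder spaces\<close>

text \<open>Derivatives are taken within a set \<open>S\<close>, so that the same definitions serve functions on
  the whole space and on the time interval \<open>{0..T}\<close>, where they are one-sided at the endpoints.\<close>

definition part_deriv :: "'a::euclidean_space set \<Rightarrow> 'a \<Rightarrow> ('a \<Rightarrow> real) \<Rightarrow> 'a \<Rightarrow> real" where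
  "part_deriv S b f x = frechet_derivative f (at x within S) b"

definition part_derivs :: "'a::euclidean_space set \<Rightarrow> 'a list \<Rightarrow> ('a \<Rightarrow> real) \<Rightarrow> 'a \<Rightarrow> real" where
  "part_derivs S bs f = foldr (part_deriv S) bs f"

text \<open>A partial derivative of order \<open>j\<close> is indexed by the list of the \<open>j\<close> coordinate directions
  in which one differentiates. On \<open>C\<^sup>j\<close> functions the order is immaterial, so a maximum over these
  lists is the maximum over the multi-indices of length \<open>j\<close>.\<close>

definition dirs :: "nat \<Rightarrow> 'a::euclidean_space list set" where
  "dirs j = {bs. set bs \<subseteq> Basis \<and> length bs = j}"

primrec Ck_on :: "nat \<Rightarrow> 'a::euclidean_space set \<Rightarrow> ('a \<Rightarrow> real) \<Rightarrow> bool" where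
  "Ck_on 0 S f \<longleftrightarrow> continuous_on S f"
| "Ck_on (Suc n) S f \<longleftrightarrow>
     f differentiable_on S \<and> (\<forall>b\<in>Basis. Ck_on n S (part_deriv S b f))"

definition sup_norm :: "'a set \<Rightarrow> ('a \<Rightarrow> 'b::real_normed_vector) \<Rightarrow> ennreal" where
  "sup_norm S f = (SUP x\<in>S. ennreal (norm (f x)))"

definition holder_seminorm ::
    "real \<Rightarrow> 'a::metric_space set \<Rightarrow> ('a \<Rightarrow> 'b::real_normed_vector) \<Rightarrow> ennreal" where
  "holder_seminorm \<gamma> S f =
     (SUP (x, y)\<in>{(x, y). x \<in> S \<and> y \<in> S \<and> x \<noteq> y}.
        ennreal (norm (f x - f y) / dist x y powr \<gamma>))"

text \<open>Norms take values in \<open>[0,\<infinity>]\<close> and are infinite exactly outside the space in question.\<close>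

definition Cb_norm :: "nat \<Rightarrow> 'a::euclidean_space set \<Rightarrow> ('a \<Rightarrow> real) \<Rightarrow> ennreal" where
  "Cb_norm n S f =
     (if Ck_on n S f then \<Sum>j\<le>n. SUP bs\<in>dirs j. sup_norm S (part_derivs S bs f) else \<infinity>)"

text \<open>Only meaningful for non-integer \<open>\<gamma> > 0\<close>.\<close>

definition Cb_holder_norm :: "real \<Rightarrow> 'a::euclidean_space set \<Rightarrow> ('a \<Rightarrow> real) \<Rightarrow> ennreal" where
  "Cb_holder_norm \<gamma> S f =
     (let n = nat \<lfloor>\<gamma>\<rfloor> in
        Cb_norm n S f +
        (SUP bs\<in>dirs n. holder_seminorm (\<gamma> - real n) S (part_derivs S bs f)))"

section \<open>The space-time Hoelder norm\<close>

definition grad :: "(real^'d \<Rightarrow> real) \<Rightarrow> real^'d \<Rightarrow> real^'d" where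
  "grad f x = (\<chi> i. part_deriv UNIV (axis i 1) f x)"

definition time_deriv :: "real \<Rightarrow> (real \<Rightarrow> 'a \<Rightarrow> real) \<Rightarrow> real \<Rightarrow> 'a \<Rightarrow> real" where
  "time_deriv T u t x = part_deriv {0..T} 1 (\<lambda>s. u s x) t"

text \<open>The seminorm in time of the tensor \<open>D\<^sup>k u(\<cdot>,x)\<close>, with the Euclidean norm of tensors.\<close>

definition tensor_time_seminorm ::
    "real \<Rightarrow> real \<Rightarrow> nat \<Rightarrow> (real \<Rightarrow> real^'d \<Rightarrow> real) \<Rightarrow> real^'d \<Rightarrow> ennreal" where
  "tensor_time_seminorm \<gamma> T k u x =
     (SUP (s, t)\<in>{(s, t). s \<in> {0..T} \<and> t \<in> {0..T} \<and> s \<noteq> t}.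
        ennreal (L2_set (\<lambda>bs. part_derivs UNIV bs (u s) x - part_derivs UNIV bs (u t) x) (dirs k)
                 / dist s t powr \<gamma>))"

definition spacetime_norm ::
    "real \<Rightarrow> real \<Rightarrow> real \<Rightarrow> (real \<Rightarrow> real^'d \<Rightarrow> real) \<Rightarrow> ennreal" where
  "spacetime_norm \<alpha> \<beta> T u =
     (SUP t\<in>{0..T}. Cb_holder_norm (\<alpha> + \<beta>) UNIV (u t)) +
     (SUP x. Cb_holder_norm ((\<alpha> + \<beta>) / \<alpha>) {0..T} (\<lambda>t. u t x)) +
     (SUP t\<in>{0..T}. holder_seminorm \<beta> UNIV (time_deriv T u t)) +
     (\<Sum>k = 1..nat \<lfloor>\<alpha> + \<beta>\<rfloor>.
        SUP x. tensor_time_seminorm ((\<alpha> + \<beta> - real k) / \<alpha>) T k u x)"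

section \<open>Levy operators and heat kernels\<close>

text \<open>A measure on \<open>\<real>\<^sup>d - {0}\<close> is represented by its extension by zero to \<open>\<real>\<^sup>d\<close>.\<close>

definition levy_measure :: "(real^'d) measure \<Rightarrow> bool" where
  "levy_measure \<mu> \<longleftrightarrow>
     sets \<mu> = sets borel \<and> emeasure \<mu> {0} = 0 \<and>
     (\<integral>\<^sup>+z. ennreal (min 1 ((norm z)\<^sup>2)) \<partial>\<mu>) < \<infinity>"

text \<open>The drift is zero throughout, so a triplet \<open>(A,0,\<mu>)\<close> is given by \<open>A\<close> and \<open>\<mu>\<close>.\<close>

definition levy_triplet :: "real^'d^'d \<Rightarrow> (real^'d) measure \<Rightarrow> bool" where
  "levy_triplet A \<mu> \<longleftrightarrow>
     transpose A = A \<and> (\<forall>\<xi>. 0 \<le> \<xi> \<bullet> (A *v \<xi>)) \<and> levy_measure \<mu>"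

text \<open>The operator with triplet \<open>(A,0,\<mu>)\<close> maps \<open>x \<mapsto> exp (\<i> \<xi>\<cdot>x)\<close> to \<open>- \<psi>(\<xi>)\<close> times itself,
  where \<open>\<psi>\<close> is the following symbol.\<close>

definition levy_symbol :: "real^'d^'d \<Rightarrow> (real^'d) measure \<Rightarrow> real^'d \<Rightarrow> complex" where
  "levy_symbol A \<mu> \<xi> =
     of_real (\<xi> \<bullet> (A *v \<xi>)) +
     (LINT z|\<mu>. 1 - exp (\<i> * of_real (\<xi> \<bullet> z))
                + \<i> * of_real (\<xi> \<bullet> z) * indicator (ball 0 1) z)"

definition heat_kernel ::
    "real^'d^'d \<Rightarrow> (real^'d) measure \<Rightarrow> (real \<Rightarrow> real^'d \<Rightarrow> real) \<Rightarrow> bool" where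
  "heat_kernel A \<mu> p \<longleftrightarrow>
     (\<forall>t>0. p t \<in> borel_measurable borel \<and> (\<forall>x. 0 \<le> p t x) \<and>
        prob_space (density lborel (\<lambda>x. ennreal (p t x))) \<and>
        (\<forall>\<xi>. (LINT x|density lborel (\<lambda>x. ennreal (p t x)). exp (- \<i> * of_real (\<xi> \<bullet> x)))
               = exp (- of_real t * levy_symbol A \<mu> \<xi>)))"

section \<open>Mild solutions\<close>

definition semigroup ::
    "(real \<Rightarrow> real^'d \<Rightarrow> real) \<Rightarrow> real \<Rightarrow> (real^'d \<Rightarrow> real) \<Rightarrow> real^'d \<Rightarrow> real" where
  "semigroup p t \<phi> x = (LINT y|lborel. p t (x - y) * \<phi> y)"

text \<open>\<open>u \<in> C((0,T]; C\<^sub>b\<^sup>1)\<close>\<close>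

definition cont_Cb1 :: "real \<Rightarrow> (real \<Rightarrow> real^'d \<Rightarrow> real) \<Rightarrow> bool" where
  "cont_Cb1 T u \<longleftrightarrow>
     (\<forall>t\<in>{0<..T}. Cb_norm 1 UNIV (u t) < \<infinity> \<and>
        ((\<lambda>s. Cb_norm 1 UNIV (\<lambda>x. u s x - u t x)) \<longlongrightarrow> 0) (at t within {0<..T}))"

text \<open>\<open>u \<in> C\<^sub>b((0,T]; C\<^sub>b\<^sup>1)\<close>\<close>

definition bounded_cont_Cb1 :: "real \<Rightarrow> (real \<Rightarrow> real^'d \<Rightarrow> real) \<Rightarrow> bool" where
  "bounded_cont_Cb1 T u \<longleftrightarrow>
     cont_Cb1 T u \<and> (SUP t\<in>{0<..T}. Cb_norm 1 UNIV (u t)) < \<infinity>"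

definition mild_solution ::
    "(real \<Rightarrow> real^'d \<Rightarrow> real) \<Rightarrow> (real \<Rightarrow> real^'d \<Rightarrow> real^'d \<Rightarrow> real) \<Rightarrow> real
     \<Rightarrow> (real^'d \<Rightarrow> real) \<Rightarrow> (real \<Rightarrow> real^'d \<Rightarrow> real) \<Rightarrow> bool" where
  "mild_solution p H T u\<^sub>0 u \<longleftrightarrow>
     cont_Cb1 T u \<and> u 0 = u\<^sub>0 \<and>
     (\<forall>t\<in>{0<..T}. \<forall>x.
        u t x = semigroup p t u\<^sub>0 x +
          (LINT s:{0<..<t}|lborel. semigroup p (t - s) (\<lambda>y. H s y (grad (u s) y)) x))"

definition grad_sup_norm :: "real \<Rightarrow> (real \<Rightarrow> real^'d \<Rightarrow> real) \<Rightarrow> ennreal" where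
  "grad_sup_norm T u = (SUP t\<in>{0<..T}. sup_norm UNIV (grad (u t)))"

end

theory Submission
  imports Defs
begin

text \<open>Write \<open>\<gamma> = \<alpha> + \<beta>\<close> and \<open>f(t,x) = H(t,x,Du(t,x))\<close>. If the supremum on the right-hand side is
  infinite there is nothing to show, so every time slice \<open>u(t)\<close> is bounded in \<open>C\<^sup>\<gamma>\<close>. The point is that
  a mild solution with this property is a classical one, \<open>\<partial>\<^sub>tu = Lu + f\<close>, and that all parts of the
  space-time norm can be read off from this equation.

  On \<open>C\<^sup>\<gamma>\<close> the operator \<open>L\<close> takes values in \<open>C\<^sup>\<beta>\<close> (\<open>levy_op_holder\<close>): the growth condition on the
  jump measure is exactly what integrates the first-order remainders of a \<open>C\<^sup>\<gamma>\<close> function over the small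
  jumps. Since the heat semigroup preserves \<open>C\<^sup>\<beta>\<close>, restarting the mild formula at time \<open>t\<close> gives
  \<open>u(t+h) - u(t) = \<integral>\<^sub>0\<^sup>h P\<^sub>s Lu(t) ds + \<integral>\<^sub>t\<^sup>t\<^sup>+\<^sup>h P\<^sub>t\<^sub>+\<^sub>h\<^sub>-\<^sub>s f(s) ds\<close> (\<open>increment_formula\<close>), and so
  \<open>u\<close> is Lipschitz in time with values in \<open>C\<^sup>\<beta>\<close>. Interpolation between this and the bound in \<open>C\<^sup>\<gamma>\<close>
  (\<open>interpolation\<close>) shows that \<open>D\<^sup>ku\<close> is Hoelder in time with exponent \<open>(\<gamma> - k)/\<alpha>\<close> and that \<open>Lu\<close> is
  so with exponent \<open>\<beta>/\<alpha>\<close> (\<open>slice_regularity\<close>). Hence \<open>Lu + f\<close> is continuous in time, and dividing the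
  formula by \<open>h\<close> identifies it as the time derivative (\<open>time_derivative\<close>).

  The formula rests on the semigroup property (\<open>P_add\<close>) and on Dynkin's formula
  \<open>P\<^sub>h\<phi> - \<phi> = \<integral>\<^sub>0\<^sup>h P\<^sub>s L\<phi> ds\<close> (\<open>generator_formula\<close>), while the heat kernel is given only through
  its Fourier transform. Both identities are evident for plane waves, which \<open>P\<^sub>t\<close> and \<open>L\<close> multiply by
  \<open>exp (- t \<psi>)\<close> and \<open>- \<psi>\<close>, and hence for superpositions of plane waves. By Fourier inversion for Gaussians
  every \<open>C\<^sup>\<gamma>\<close> function is a limit of such superpositions in the sense of bounded pointwise convergence
  of functions and gradients with uniform remainders (\<open>jet_approximation_by_waves\<close>), and both
  identities are stable under these limits. The same representation of the Gaussian bump yields the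
  continuity of the semigroup at time zero (\<open>spread_tendsto_0\<close>).\<close>

section \<open>Gaussian measures and Fourier inversion\<close>

text \<open>Dominating an integrand by a product of integrable functions of one variable each is the way in
  which the integrability hypothesis of Fubini's theorem is met everywhere below.\<close>

lemma Fubini_product_bound:
  fixes F :: "'a \<Rightarrow> 'b \<Rightarrow> 'c::{banach,second_countable_topology}"
  assumes "sigma_finite_measure M" "sigma_finite_measure N"
    and meas[measurable]: "(\<lambda>(x, y). F x y) \<in> borel_measurable (M \<Otimes>\<^sub>M N)"
    and g: "integrable M g" and h: "integrable N h"
    and bound: "\<And>x y. x \<in> space M \<Longrightarrow> y \<in> space N \<Longrightarrow> norm (F x y) \<le> g x * h y"
  shows "(LINT x|M. LINT y|N. F x y) = (LINT y|N. LINT x|M. F x y)"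
    and "integrable M (\<lambda>x. LINT y|N. F x y)"
proof -
  interpret M: sigma_finite_measure M by fact
  interpret N: sigma_finite_measure N by fact
  interpret MN: pair_sigma_finite M N ..
  have [measurable]: "g \<in> borel_measurable M" "h \<in> borel_measurable N"
    using g h by auto
  have gh: "integrable (M \<Otimes>\<^sub>M N) (\<lambda>(x, y). g x * h y)"
  proof (rule MN.Fubini_integrable)
    show "integrable M (\<lambda>x. LINT y|N. norm (case (x, y) of (x, y) \<Rightarrow> g x * h y))"
      using g by (simp add: abs_mult)
    show "AE x in M. integrable N (\<lambda>y. case (x, y) of (x, y) \<Rightarrow> g x * h y)"
      using h by simp
  qed measurable
  have int: "integrable (M \<Otimes>\<^sub>M N) (\<lambda>(x, y). F x y)"
    by (rule Bochner_Integration.integrable_bound[OF gh])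
      (auto intro!: AE_I2 simp: space_pair_measure intro: order_trans[OF bound abs_ge_self])
  show "(LINT x|M. LINT y|N. F x y) = (LINT y|N. LINT x|M. F x y)"
    using MN.Fubini_integral[OF int] by simp
  show "integrable M (\<lambda>x. LINT y|N. F x y)"
    using MN.integrable_fst[OF int] by simp
qed

lemma lborel_prod_coordinates:
  fixes f :: "'a::euclidean_space \<Rightarrow> real \<Rightarrow> 'b::{real_normed_field,banach,second_countable_topology}"
  assumes f: "\<And>b. b \<in> Basis \<Longrightarrow> integrable lborel (f b)"
  shows "integrable lborel (\<lambda>x. \<Prod>b\<in>Basis. f b (x \<bullet> b))" (is ?A)
    and "(LINT x|lborel. (\<Prod>b\<in>Basis. f b (x \<bullet> b))) = (\<Prod>b\<in>Basis. integral\<^sup>L lborel (f b))" (is ?B)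
proof -
  interpret product_sigma_finite "\<lambda>_::'a. lborel :: real measure" ..
  have [measurable]: "\<And>b. b \<in> Basis \<Longrightarrow> f b \<in> borel_measurable borel"
    using f by (auto dest: borel_measurable_integrable)
  have eq: "(\<Prod>b\<in>Basis. f b ((\<Sum>c\<in>Basis. y c *\<^sub>R c) \<bullet> b)) = (\<Prod>b\<in>Basis. f b (y b))" for y
    by (intro prod.cong) auto
  show ?A
    unfolding lborel_eq[where 'a='a]
    by (subst integrable_distr_eq) (auto simp: eq intro!: product_integrable_prod f)
  show ?B
    unfolding lborel_eq[where 'a='a]
    by (subst integral_distr) (auto simp: eq intro!: product_integral_prod f)
qed

definition gauss_density :: "'a::euclidean_space \<Rightarrow> real" where
  "gauss_density x = (\<Prod>b\<in>Basis. std_normal_density (x \<bullet> b))"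

definition gauss :: "'a::euclidean_space measure" where
  "gauss = density lborel (\<lambda>x. ennreal (gauss_density x))"

lemma gauss_density_pos: "gauss_density x > 0"
  unfolding gauss_density_def by (intro prod_pos) (simp add: normal_density_pos)

lemma gauss_density_measurable[measurable]: "gauss_density \<in> borel_measurable borel"
  unfolding gauss_density_def[abs_def] by measurable

lemma gauss_density_eq:
  "gauss_density x = gauss_density (0::'a) * exp (- (norm x)\<^sup>2 / 2)" for x :: "'a::euclidean_space"
proof -
  have "gauss_density x = (\<Prod>b\<in>(Basis::'a set). std_normal_density 0 * exp (- (x \<bullet> b)\<^sup>2 / 2))"
    unfolding gauss_density_def by (intro prod.cong) (auto simp: normal_density_def)
  also have "\<dots> = gauss_density (0::'a) * exp (\<Sum>b\<in>(Basis::'a set). - (x \<bullet> b)\<^sup>2 / 2)"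
    by (simp add: prod.distrib gauss_density_def exp_sum)
  also have "(\<Sum>b\<in>(Basis::'a set). - (x \<bullet> b)\<^sup>2 / 2) = - (norm x)\<^sup>2 / 2"
    by (subst norm_eq_sqrt_inner, subst euclidean_inner)
      (simp add: sum_nonneg power2_eq_square sum_negf sum_divide_distrib)
  finally show ?thesis .
qed

lemma gauss_density_integrable: "integrable lborel (gauss_density :: 'a::euclidean_space \<Rightarrow> real)"
  unfolding gauss_density_def[abs_def]
  by (rule lborel_prod_coordinates) (simp add: integrable_normal_density)

lemma gauss_density_integral: "(LINT x|lborel. gauss_density (x :: 'a::euclidean_space)) = 1"
  unfolding gauss_density_def
  by (subst lborel_prod_coordinates) (auto simp add: integrable_normal_density integral_normal_density)

lemma sets_gauss[simp, measurable_cong]: "sets gauss = sets borel"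
  and space_gauss[simp]: "space gauss = UNIV"
  by (auto simp: gauss_def)

lemma prob_space_gauss: "prob_space (gauss :: 'a::euclidean_space measure)"
proof
  have "emeasure (gauss :: 'a measure) UNIV = ennreal (LINT x|lborel. gauss_density (x :: 'a))"
    unfolding gauss_def
    by (subst emeasure_density)
      (auto simp: nn_integral_eq_integral[OF gauss_density_integrable] less_imp_le[OF gauss_density_pos])
  then show "emeasure (gauss :: 'a measure) (space gauss) = 1"
    by (simp add: gauss_density_integral)
qed

lemma exp_norm_square_integrable:
  assumes "c > 0"
  shows "integrable lborel (\<lambda>x::'a::euclidean_space. exp (- c * (norm x)\<^sup>2))"
proof -
  define \<sigma> where "\<sigma> = sqrt (1 / (2 * c))"
  have \<sigma>: "\<sigma> > 0" "\<sigma>\<^sup>2 = 1 / (2 * c)" using assms by (auto simp: \<sigma>_def)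
  have "integrable lborel (\<lambda>x. exp (- c * x\<^sup>2))"
  proof -
    have "exp (- c * x\<^sup>2) = sqrt (2 * pi * \<sigma>\<^sup>2) * normal_density 0 \<sigma> x" for x
      unfolding normal_density_def \<sigma>(2) using assms by (simp add: field_simps)
    then show ?thesis using \<sigma> by simp
  qed
  then have "integrable lborel (\<lambda>x::'a. \<Prod>b\<in>Basis. exp (- c * (x \<bullet> b)\<^sup>2))"
    by (intro lborel_prod_coordinates)
  moreover have "(\<Prod>b\<in>Basis. exp (- c * (x \<bullet> b)\<^sup>2)) = exp (- c * (norm x)\<^sup>2)" for x :: 'a
    by (subst exp_sum[symmetric], simp, subst norm_eq_sqrt_inner, subst euclidean_inner)
      (simp add: sum_nonneg power2_eq_square sum_distrib_left sum_negf)
  ultimately show ?thesis by simp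
qed

lemma gauss_norm_square_integrable: "integrable gauss (\<lambda>x::'a::euclidean_space. (norm x)\<^sup>2)"
proof -
  have "integrable lborel (\<lambda>x::'a. gauss_density x * (norm x)\<^sup>2)"
  proof (rule Bochner_Integration.integrable_bound)
    show "integrable lborel (\<lambda>x::'a. 4 * gauss_density (0::'a) * exp (- (1/4) * (norm x)\<^sup>2))"
      using exp_norm_square_integrable[of "1/4", where 'a='a] by simp
    have "norm (gauss_density x * (norm x)\<^sup>2) \<le> norm (4 * gauss_density (0::'a) * exp (- (1/4) * (norm x)\<^sup>2))" for x :: 'a
    proof -
      define s where "s = (norm x)\<^sup>2 / 4"
      have s: "s \<ge> 0" "(norm x)\<^sup>2 = 4 * s" by (auto simp: s_def)
      have "s \<le> exp s" using exp_ge_add_one_self[of s] by linarith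
      then have "s * exp (- (2 * s)) \<le> exp s * exp (- (2 * s))"
        by (intro mult_right_mono) auto
      also have "\<dots> = exp (- s)" by (simp add: exp_add[symmetric])
      finally have "4 * s * exp (- (2 * s)) \<le> 4 * exp (- s)" by simp
      from mult_left_mono[OF this less_imp_le[OF gauss_density_pos[of "0::'a"]]]
      show ?thesis
        unfolding gauss_density_eq[of x] s using gauss_density_pos[of "0::'a"] s(1)
        by (simp add: abs_mult algebra_simps)
    qed
    then show "AE x in lborel. norm (gauss_density x * (norm x)\<^sup>2)
        \<le> norm (4 * gauss_density (0::'a) * exp (- (1/4) * (norm (x::'a))\<^sup>2))" by simp
  qed simp
  then show ?thesis
    unfolding gauss_def by (subst integrable_density) (auto simp: less_imp_le[OF gauss_density_pos])
qed

text \<open>Up to a constant this is the Gaussian density again. The inversion formula below rests on this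
  self-duality.\<close>

lemma gauss_char:
  "(LINT \<xi>|gauss. cis (\<xi> \<bullet> x)) = of_real (exp (- (norm x)\<^sup>2 / 2))" for x :: "'a::euclidean_space"
proof -
  have one: "(LINT s|lborel. std_normal_density s *\<^sub>R cis (s * t)) = of_real (exp (- t\<^sup>2 / 2))"
    and int1: "integrable lborel (\<lambda>s. std_normal_density s *\<^sub>R cis (s * t))" for t
  proof -
    have "char std_normal_distribution t = (LINT s|lborel. std_normal_density s *\<^sub>R cis (s * t))"
      unfolding char_def
      by (subst integral_density) (auto simp: cis_conv_exp mult_ac intro!: Bochner_Integration.integral_cong)
    then show "(LINT s|lborel. std_normal_density s *\<^sub>R cis (s * t)) = of_real (exp (- t\<^sup>2 / 2))"
      by (simp add: char_std_normal_distribution)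
    show "integrable lborel (\<lambda>s. std_normal_density s *\<^sub>R cis (s * t))"
      by (rule Bochner_Integration.integrable_bound[OF integrable_normal_density[of 1 0]])
        (auto simp: cis_conv_exp)
  qed
  have "(LINT \<xi>|gauss. cis (\<xi> \<bullet> x)) = (LINT \<xi>|lborel. gauss_density \<xi> *\<^sub>R cis (\<xi> \<bullet> x))"
    unfolding gauss_def
    by (subst integral_density) (auto simp: less_imp_le[OF gauss_density_pos] cis_conv_exp)
  also have "\<dots> = (LINT \<xi>|lborel. (\<Prod>b\<in>Basis. std_normal_density (\<xi> \<bullet> b) *\<^sub>R cis ((\<xi> \<bullet> b) * (x \<bullet> b))))"
  proof (intro Bochner_Integration.integral_cong refl)
    fix \<xi> :: 'a
    have "cis (\<xi> \<bullet> x) = (\<Prod>b\<in>Basis. cis ((\<xi> \<bullet> b) * (x \<bullet> b)))"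
      unfolding cis_conv_exp
      by (subst exp_sum[symmetric], simp, subst euclidean_inner) (simp add: sum_distrib_left)
    then show "gauss_density \<xi> *\<^sub>R cis (\<xi> \<bullet> x) = (\<Prod>b\<in>Basis. std_normal_density (\<xi> \<bullet> b) *\<^sub>R cis ((\<xi> \<bullet> b) * (x \<bullet> b)))"
      by (simp add: gauss_density_def scaleR_conv_of_real prod.distrib)
  qed
  also have "\<dots> = (\<Prod>b\<in>Basis. of_real (exp (- (x \<bullet> b)\<^sup>2 / 2)))"
    by (subst lborel_prod_coordinates) (auto simp: one int1)
  also have "\<dots> = of_real (exp (- (norm x)\<^sup>2 / 2))"
    unfolding of_real_prod[symmetric]
    by (subst exp_sum[symmetric], simp, subst norm_eq_sqrt_inner, subst (2) euclidean_inner)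
      (simp add: sum_nonneg power2_eq_square sum_divide_distrib sum_negf)
  finally show ?thesis .
qed

text \<open>A finite measure \<open>G\<close> on frequencies together with an amplitude \<open>a\<close> gives the function
  \<open>x \<mapsto> \<integral> Re (a \<xi> e\<^sup>i\<^sup>\<xi>\<^sup>x) dG\<close>; the gradient below is what one gets by differentiating the plane waves.\<close>

definition waves :: "'a::euclidean_space measure \<Rightarrow> ('a \<Rightarrow> complex) \<Rightarrow> 'a \<Rightarrow> real" where
  "waves G a x = (LINT \<xi>|G. Re (a \<xi> * cis (\<xi> \<bullet> x)))"

definition waves_grad :: "'a::euclidean_space measure \<Rightarrow> ('a \<Rightarrow> complex) \<Rightarrow> 'a \<Rightarrow> 'a" where
  "waves_grad G a x = (LINT \<xi>|G. (- Im (a \<xi> * cis (\<xi> \<bullet> x))) *\<^sub>R \<xi>)"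

text \<open>The second moment makes the gradient integrable, and also the amplitude \<open>\<psi> a\<close> for a symbol \<open>\<psi>\<close>
  of at most quadratic growth.\<close>

definition wave_class :: "'a::euclidean_space measure \<Rightarrow> ('a \<Rightarrow> complex) \<Rightarrow> bool" where
  "wave_class G a \<longleftrightarrow> finite_measure G \<and> sets G = sets borel \<and> a \<in> borel_measurable borel \<and>
     integrable G (\<lambda>\<xi>. norm (a \<xi>) * (1 + (norm \<xi>)\<^sup>2))"

lemma cis_measurable[measurable]: "(cis :: real \<Rightarrow> complex) \<in> borel_measurable borel"
  by (intro borel_measurable_continuous_onI continuous_intros)

lemma lborel_integral_affine:
  fixes g :: "'a::euclidean_space \<Rightarrow> real"
  assumes [measurable]: "g \<in> borel_measurable borel" and c: "c \<noteq> 0"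
  shows "(LINT y|lborel. g y) = \<bar>c\<bar> ^ DIM('a) * (LINT w|lborel. g (t + c *\<^sub>R w))"
proof -
  have "(LINT y|lborel. g y) = (LINT y|density (distr lborel borel (\<lambda>x. t + c *\<^sub>R x)) (\<lambda>_. ennreal (\<bar>c\<bar> ^ DIM('a))). g y)"
    using lborel_affine[OF c, of t] by (intro arg_cong2[where f="integral\<^sup>L"] refl) (simp add: ennreal_power)
  also have "\<dots> = \<bar>c\<bar> ^ DIM('a) * (LINT w|lborel. g (t + c *\<^sub>R w))"
    by (subst integral_density) (auto simp: integral_distr)
  finally show ?thesis .
qed

text \<open>Fourier inversion: the average of an integrable function against a rescaled Gaussian is a
  superposition of plane waves, because the Gaussian density is a multiple of the characteristic
  function of a Gaussian.\<close>

lemma gauss_average_eq_waves: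
  fixes f :: "'a::euclidean_space \<Rightarrow> real"
  assumes f: "integrable lborel f" and n: "n > 0"
  shows "\<exists>G a. wave_class G a \<and> (\<forall>x. (LINT y|gauss. f (x + y /\<^sub>R n)) = waves G a x)"
proof -
  have [measurable]: "f \<in> borel_measurable borel" using f by auto
  interpret G: prob_space "gauss :: 'a measure" by (rule prob_space_gauss)
  define k where "k = gauss_density (0::'a) * n ^ DIM('a)"
  have k0: "k > 0" using n gauss_density_pos[of "0::'a"] by (simp add: k_def)
  define a where "a \<zeta> = of_real k * (LINT w|lborel. of_real (f w) * cis (- ((n *\<^sub>R \<zeta>) \<bullet> w)))" for \<zeta> :: 'a
  have a_meas[measurable]: "a \<in> borel_measurable borel"
    unfolding a_def[abs_def] by measurable
  have a_bound: "norm (a \<zeta>) \<le> k * (LINT w|lborel. \<bar>f w\<bar>)" for \<zeta>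
  proof -
    have "norm (LINT w|lborel. of_real (f w) * cis (- ((n *\<^sub>R \<zeta>) \<bullet> w)))
        \<le> (LINT w|lborel. norm (of_real (f w) * cis (- ((n *\<^sub>R \<zeta>) \<bullet> w))))"
      by (rule integral_norm_bound)
    then show ?thesis unfolding a_def using k0 by (simp add: norm_mult)
  qed
  have "(LINT y|gauss. f (x + y /\<^sub>R n)) = (LINT \<zeta>|gauss. Re (a \<zeta> * cis ((n *\<^sub>R \<zeta>) \<bullet> x)))" for x
  proof -
    have "(LINT y|gauss. f (x + y /\<^sub>R n)) = (LINT y|lborel. gauss_density y * f (x + y /\<^sub>R n))"
      unfolding gauss_def
      by (subst integral_density) (auto simp: less_imp_le[OF gauss_density_pos])
    also have "\<dots> = n ^ DIM('a) * (LINT w|lborel. gauss_density (n *\<^sub>R (w - x)) * f w)"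
      using n by (subst lborel_integral_affine[where c=n and t="- n *\<^sub>R x"])
        (auto simp: scaleR_right_diff_distrib)
    also have "\<dots> = (LINT w|lborel. LINT \<zeta>|gauss. k * f w * cos ((n *\<^sub>R \<zeta>) \<bullet> (x - w)))"
    proof -
      have "gauss_density (n *\<^sub>R (w - x)) = gauss_density (0::'a) * (LINT \<zeta>|gauss. cos ((n *\<^sub>R \<zeta>) \<bullet> (x - w)))" for w
      proof -
        have ig: "integrable gauss (\<lambda>\<zeta>. cis (\<zeta> \<bullet> (n *\<^sub>R (x - w))))"
          by (rule G.integrable_const_bound[of _ 1]) auto
        have "(LINT \<zeta>|gauss. cos ((n *\<^sub>R \<zeta>) \<bullet> (x - w))) = (LINT \<zeta>|gauss. Re (cis (\<zeta> \<bullet> (n *\<^sub>R (x - w)))))"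
          by simp
        also have "\<dots> = Re (LINT \<zeta>|gauss. cis (\<zeta> \<bullet> (n *\<^sub>R (x - w))))"
          by (rule integral_Re[OF ig])
        also have "\<dots> = exp (- (norm (n *\<^sub>R (x - w)))\<^sup>2 / 2)"
          unfolding gauss_char by simp
        also have "norm (n *\<^sub>R (x - w)) = norm (n *\<^sub>R (w - x))"
          by (simp add: norm_minus_commute)
        finally show ?thesis using gauss_density_eq[of "n *\<^sub>R (w - x)"] by simp
      qed
      then have "n ^ DIM('a) * (gauss_density (n *\<^sub>R (w - x)) * f w)
          = (LINT \<zeta>|gauss. k * f w * cos ((n *\<^sub>R \<zeta>) \<bullet> (x - w)))" for w
        by (simp add: k_def)
      then show ?thesis
        by (subst integral_mult_right_zero[symmetric]) (simp only:)
    qed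
    also have "\<dots> = (LINT \<zeta>|gauss. LINT w|lborel. k * f w * cos ((n *\<^sub>R \<zeta>) \<bullet> (x - w)))"
    proof (rule Fubini_product_bound(1)[where g="\<lambda>w. k * \<bar>f w\<bar>" and h="\<lambda>_. 1"])
      show "sigma_finite_measure (lborel :: 'a measure)" ..
      show "sigma_finite_measure (gauss :: 'a measure)" ..
      show "integrable lborel (\<lambda>w. k * \<bar>f w\<bar>)" using f by simp
      show "norm (k * f w * cos ((n *\<^sub>R \<zeta>) \<bullet> (x - w))) \<le> k * \<bar>f w\<bar> * 1" for w \<zeta>
        using k0 abs_cos_le_one[of "(n *\<^sub>R \<zeta>) \<bullet> (x - w)"] by (auto simp: abs_mult intro!: mult_left_le)
    qed auto
    also have "\<dots> = (LINT \<zeta>|gauss. Re (a \<zeta> * cis ((n *\<^sub>R \<zeta>) \<bullet> x)))"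
    proof (intro Bochner_Integration.integral_cong refl)
      fix \<zeta> :: 'a
      have ia: "integrable lborel (\<lambda>w. of_real (f w) * cis (- ((n *\<^sub>R \<zeta>) \<bullet> w)) :: complex)"
        by (rule Bochner_Integration.integrable_bound[OF f]) (auto simp: norm_mult)
      have "a \<zeta> * cis ((n *\<^sub>R \<zeta>) \<bullet> x) = (LINT w|lborel. (of_real (f w) * cis (- ((n *\<^sub>R \<zeta>) \<bullet> w))) * (of_real k * cis ((n *\<^sub>R \<zeta>) \<bullet> x)))"
        unfolding a_def by (subst integral_mult_left_zero) (simp only: mult_ac)
      also have "Re \<dots> = (LINT w|lborel. Re ((of_real (f w) * cis (- ((n *\<^sub>R \<zeta>) \<bullet> w))) * (of_real k * cis ((n *\<^sub>R \<zeta>) \<bullet> x))))"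
        using ia by (intro integral_Re[symmetric]) auto
      also have "\<dots> = (LINT w|lborel. k * f w * cos ((n *\<^sub>R \<zeta>) \<bullet> (x - w)))"
        by (intro Bochner_Integration.integral_cong refl)
          (simp add: cis_mult inner_diff_right algebra_simps cos_diff)
      finally show "(LINT w|lborel. k * f w * cos ((n *\<^sub>R \<zeta>) \<bullet> (x - w))) = Re (a \<zeta> * cis ((n *\<^sub>R \<zeta>) \<bullet> x))" ..
    qed
    finally show ?thesis .
  qed
  note eq = this
  \<comment> \<open>The waves above have frequencies \<open>n \<zeta>\<close>, so the law of \<open>n \<zeta>\<close> is the measure on frequencies.\<close>
  define G where "G = distr gauss borel (\<lambda>\<zeta>::'a. n *\<^sub>R \<zeta>)"
  define b where "b \<xi> = a (\<xi> /\<^sub>R n)" for \<xi>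
  interpret G': prob_space G
    unfolding G_def by (rule G.prob_space_distr) simp
  have [measurable]: "b \<in> borel_measurable borel" unfolding b_def[abs_def] by measurable
  define K where "K = k * (LINT w|lborel. \<bar>f w\<bar>)"
  have b: "norm (b \<xi>) \<le> K" for \<xi> unfolding b_def K_def by (rule a_bound)
  have "K \<ge> 0" using b[of 0] norm_ge_zero[of "b 0"] by linarith
  have int: "integrable G (\<lambda>\<xi>. K * (1 + (norm \<xi>)\<^sup>2))"
    unfolding G_def using gauss_norm_square_integrable[where 'a='a]
    by (subst integrable_distr_eq) (auto simp: power_mult_distrib)
  have "integrable G (\<lambda>\<xi>. norm (b \<xi>) * (1 + (norm \<xi>)\<^sup>2))"
  proof (rule Bochner_Integration.integrable_bound[OF int])
    show "AE \<xi> in G. norm (norm (b \<xi>) * (1 + (norm \<xi>)\<^sup>2)) \<le> norm (K * (1 + (norm \<xi>)\<^sup>2))"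
      using b \<open>K \<ge> 0\<close> by (auto simp: abs_mult intro!: mult_mono)
  qed (simp add: G_def)
  then have "wave_class G b"
    unfolding wave_class_def using G'.finite_measure_axioms by (simp add: G_def)
  moreover have "(LINT y|gauss. f (x + y /\<^sub>R n)) = waves G b x" for x
    unfolding eq waves_def G_def b_def using n by (subst integral_distr) auto
  ultimately show ?thesis by blast
qed

section \<open>Functions with a first-order Taylor expansion\<close>

lemma powr_le_powr_of_le_one:
  fixes s :: real
  assumes "0 \<le> s" "s \<le> 1" "a \<le> b"
  shows "s powr b \<le> s powr a"
  using assms by (cases "s = 0") (auto intro: powr_mono')

lemma holder_imp_continuous_on:
  fixes f :: "'a::real_normed_vector \<Rightarrow> 'b::real_normed_vector"
  assumes b: "0 < b" and f: "\<And>x y. x \<in> S \<Longrightarrow> y \<in> S \<Longrightarrow> norm (f x - f y) \<le> C * norm (x - y) powr b"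
  shows "continuous_on S f"
proof (rule continuous_on_sequentiallyI)
  fix u a assume u: "\<forall>n. u n \<in> S" "a \<in> S" "u \<longlonglongrightarrow> a"
  have "(\<lambda>n. norm (u n - a)) \<longlonglongrightarrow> 0" using u by (simp add: LIM_zero_iff tendsto_norm_zero_iff)
  from tendsto_powr'[OF this tendsto_const, of b] b
  have "(\<lambda>n. C * norm (u n - a) powr b) \<longlonglongrightarrow> C * 0"
    by (intro tendsto_mult tendsto_const) auto
  then have lim: "(\<lambda>n. C * norm (u n - a) powr b) \<longlonglongrightarrow> 0" by simp
  have "(\<lambda>n. f (u n) - f a) \<longlonglongrightarrow> 0"
    by (rule Lim_null_comparison[OF _ lim]) (use f u in auto)
  then show "(\<lambda>n. f (u n)) \<longlonglongrightarrow> f a" by (simp add: LIM_zero_iff)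
qed

lemma continuous_on_lebesgue_integral:
  fixes f :: "'a::{first_countable_topology,t2_space} \<Rightarrow> 'b \<Rightarrow> 'c::{banach,second_countable_topology}"
  assumes meas: "\<And>x. x \<in> S \<Longrightarrow> f x \<in> borel_measurable M"
    and cont: "\<And>\<omega>. \<omega> \<in> space M \<Longrightarrow> continuous_on S (\<lambda>x. f x \<omega>)"
    and h: "integrable M h" and bound: "\<And>x \<omega>. x \<in> S \<Longrightarrow> \<omega> \<in> space M \<Longrightarrow> norm (f x \<omega>) \<le> h \<omega>"
  shows "continuous_on S (\<lambda>x. integral\<^sup>L M (f x))"
proof (rule continuous_on_sequentiallyI)
  fix u a assume u: "\<forall>n. u n \<in> S" "a \<in> S" "u \<longlonglongrightarrow> a"
  show "(\<lambda>n. integral\<^sup>L M (f (u n))) \<longlonglongrightarrow> integral\<^sup>L M (f a)"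
  proof (rule integral_dominated_convergence[OF _ _ h])
    show "AE \<omega> in M. (\<lambda>n. f (u n) \<omega>) \<longlonglongrightarrow> f a \<omega>"
      using u cont unfolding continuous_on_sequentially by (auto simp: comp_def)
    show "AE \<omega> in M. norm (f (u n) \<omega>) \<le> h \<omega>" for n
      using bound u by auto
  qed (use meas u in auto)
qed

text \<open>A jet is a bounded function with a field that serves as its gradient, in the sense of a
  first-order expansion with remainder of order \<open>g\<close>. This is all that a Levy operator needs, it is
  stable under products and averages of translates, and for \<open>g > 1\<close> it determines the field.\<close>

definition jet :: "real \<Rightarrow> real \<Rightarrow> ('a::euclidean_space \<Rightarrow> real) \<Rightarrow> ('a \<Rightarrow> 'a) \<Rightarrow> bool" where
  "jet g B \<phi> V \<longleftrightarrow> continuous_on UNIV \<phi> \<and> continuous_on UNIV V \<and>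
     (\<forall>x. \<bar>\<phi> x\<bar> \<le> B) \<and> (\<forall>x. norm (V x) \<le> B) \<and>
     (\<forall>x z. norm z < 1 \<longrightarrow> \<bar>\<phi> (x + z) - \<phi> x - V x \<bullet> z\<bar> \<le> B * norm z powr g)"

lemma jetD:
  assumes "jet g B \<phi> V"
  shows "continuous_on UNIV \<phi>" "continuous_on UNIV V" "\<bar>\<phi> x\<bar> \<le> B" "norm (V x) \<le> B"
    "norm z < 1 \<Longrightarrow> \<bar>\<phi> (x + z) - \<phi> x - V x \<bullet> z\<bar> \<le> B * norm z powr g" "B \<ge> 0"
    "\<phi> \<in> borel_measurable borel" "V \<in> borel_measurable borel"
proof -
  show "B \<ge> 0" using assms norm_ge_zero[of "V 0"] unfolding jet_def by (meson order_trans)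
qed (use assms in \<open>auto simp: jet_def intro: borel_measurable_continuous_onI\<close>)

lemma jet_mono:
  assumes "jet g B \<phi> V" "B \<le> B'" "g' \<le> g"
  shows "jet g' B' \<phi> V"
  unfolding jet_def
proof (intro conjI allI impI)
  note j = jetD[OF assms(1)]
  fix x z :: 'a assume "norm z < 1"
  have "\<bar>\<phi> (x + z) - \<phi> x - V x \<bullet> z\<bar> \<le> B * norm z powr g" using j \<open>norm z < 1\<close> by auto
  also have "\<dots> \<le> B' * norm z powr g'"
    using j(6) assms \<open>norm z < 1\<close> by (intro mult_mono powr_le_powr_of_le_one) auto
  finally show "\<bar>\<phi> (x + z) - \<phi> x - V x \<bullet> z\<bar> \<le> B' * norm z powr g'" .
qed (use jetD[OF assms(1)] assms(2) in \<open>auto intro: order_trans\<close>)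

text \<open>Evaluate both expansions at \<open>z = s d\<close>, where \<open>d\<close> is the difference of the fields at \<open>x\<close>: this bounds
  \<open>|d|\<close> by a multiple of \<open>|s d|\<^sup>g\<^sup>-\<^sup>1\<close>, which vanishes as \<open>s \<rightarrow> 0\<close>.\<close>

lemma jet_field_unique:
  assumes j: "jet g B \<phi> V" "jet g B' \<phi> W" and g: "g > 1"
  shows "V = W"
proof
  fix x
  define d where "d = V x - W x"
  have *: "norm d \<le> (B + B') * norm z powr (g - 1)" if z: "norm z < 1" "z = s *\<^sub>R d" "s > 0" for z s
  proof (cases "d = 0")
    case False
    have "\<bar>d \<bullet> z\<bar> \<le> \<bar>\<phi> (x + z) - \<phi> x - V x \<bullet> z\<bar> + \<bar>\<phi> (x + z) - \<phi> x - W x \<bullet> z\<bar>"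
      unfolding d_def by (simp add: inner_diff_left)
    also have "\<dots> \<le> (B + B') * norm z powr g"
      using jetD(5)[OF j(1) z(1), of x] jetD(5)[OF j(2) z(1), of x] by (simp add: algebra_simps)
    also have "\<bar>d \<bullet> z\<bar> = norm d * norm z"
      using z by (simp add: power2_norm_eq_inner[symmetric] power2_eq_square)
    also have "norm z powr g = norm z powr (g - 1) * norm z"
      using z False by (simp add: powr_mult_base[symmetric] powr_diff)
    finally show ?thesis using z False by (simp add: mult.assoc[symmetric])
  qed (use z jetD(6)[OF j(1)] jetD(6)[OF j(2)] in simp)
  have "(\<lambda>n. (B + B') * norm (inverse (real (Suc n)) *\<^sub>R d) powr (g - 1)) \<longlonglongrightarrow> (B + B') * norm (0 *\<^sub>R d) powr (g - 1)"
    by (intro tendsto_intros LIMSEQ_inverse_real_of_nat) (use g in \<open>auto intro!: always_eventually\<close>)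
  then have lim: "(\<lambda>n. (B + B') * norm (inverse (real (Suc n)) *\<^sub>R d) powr (g - 1)) \<longlonglongrightarrow> 0"
    by simp
  have "(\<lambda>n. norm (inverse (real (Suc n)) *\<^sub>R d)) \<longlonglongrightarrow> norm (0 *\<^sub>R d)"
    by (intro tendsto_intros LIMSEQ_inverse_real_of_nat)
  then have "\<forall>\<^sub>F n in sequentially. norm (inverse (real (Suc n)) *\<^sub>R d) < 1"
    by (rule order_tendstoD) simp
  then have "\<forall>\<^sub>F n in sequentially. norm d \<le> (B + B') * norm (inverse (real (Suc n)) *\<^sub>R d) powr (g - 1)"
    by eventually_elim (rule *, auto)
  then have "norm d \<le> 0"
    by (intro tendsto_lowerbound[OF lim]) auto
  then show "V x = W x" by (simp add: d_def)
qed

text \<open>The remainder of a product consists of the two remainders and of a product of increments. The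
  latter is of second order, whence the bound \<open>g \<le> 2\<close>.\<close>

lemma jet_product:
  assumes j: "jet g B \<phi> V" "jet g C \<eta> W" and g: "g \<le> 2"
  shows "jet g (5 * B * C) (\<lambda>x. \<phi> x * \<eta> x) (\<lambda>x. \<eta> x *\<^sub>R V x + \<phi> x *\<^sub>R W x)"
  unfolding jet_def
proof (intro conjI allI impI)
  note j1 = jetD[OF j(1)] and j2 = jetD[OF j(2)]
  have BC: "0 \<le> B * C" using j1(6) j2(6) by simp
  show "continuous_on UNIV (\<lambda>x. \<phi> x * \<eta> x)" "continuous_on UNIV (\<lambda>x. \<eta> x *\<^sub>R V x + \<phi> x *\<^sub>R W x)"
    by (intro continuous_intros j1 j2)+
  show "\<bar>\<phi> x * \<eta> x\<bar> \<le> 5 * B * C" for x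
  proof -
    have "\<bar>\<phi> x * \<eta> x\<bar> \<le> B * C"
      unfolding abs_mult using j1(3,6) j2(3) by (intro mult_mono) auto
    with BC show ?thesis by linarith
  qed
  show "norm (\<eta> x *\<^sub>R V x + \<phi> x *\<^sub>R W x) \<le> 5 * B * C" for x
  proof -
    have "norm (\<eta> x *\<^sub>R V x) \<le> C * B" "norm (\<phi> x *\<^sub>R W x) \<le> B * C"
      using j1(3,4,6) j2(3,4,6) by (auto intro!: mult_mono)
    then have "norm (\<eta> x *\<^sub>R V x + \<phi> x *\<^sub>R W x) \<le> C * B + B * C"
      by (intro norm_triangle_le) linarith
    moreover have "5 * B * C = 5 * (B * C)" "C * B = B * C" by auto
    ultimately show ?thesis using BC by linarith
  qed
  fix x z :: 'a assume z: "norm z < 1"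
  have zg: "norm z * norm z \<le> norm z powr g"
    using powr_le_powr_of_le_one[of "norm z" g 2] z g by (simp add: powr_numeral power2_eq_square)
  have inc: "\<bar>\<eta> (x + z) - \<eta> x\<bar> * norm z \<le> 3 * C * norm z powr g"
  proof -
    have "\<bar>\<eta> (x + z) - \<eta> x\<bar> \<le> \<bar>\<eta> (x + z) - \<eta> x - W x \<bullet> z\<bar> + \<bar>W x \<bullet> z\<bar>" by linarith
    also have "\<dots> \<le> C * norm z powr g + C * norm z"
      using j2(5)[OF z, of x] Cauchy_Schwarz_ineq2[of "W x" z] mult_right_mono[OF j2(4)[of x], of "norm z"]
      by (intro add_mono) auto
    finally have "\<bar>\<eta> (x + z) - \<eta> x\<bar> * norm z \<le> (C * norm z powr g + C * norm z) * norm z"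
      by (intro mult_right_mono) auto
    also have "\<dots> = C * (norm z powr g * norm z) + C * (norm z * norm z)" by (simp add: algebra_simps)
    also have "\<dots> \<le> C * (norm z powr g) + C * (norm z powr g)"
      using z j2(6) zg by (intro add_mono mult_left_mono mult_left_le) auto
    also have "\<dots> \<le> 3 * C * norm z powr g"
      using j2(6) by (simp add: mult_nonneg_nonneg)
    finally show ?thesis .
  qed
  have "\<phi> (x + z) * \<eta> (x + z) - \<phi> x * \<eta> x - (\<eta> x *\<^sub>R V x + \<phi> x *\<^sub>R W x) \<bullet> z
     = \<eta> (x + z) * (\<phi> (x + z) - \<phi> x - V x \<bullet> z) + \<phi> x * (\<eta> (x + z) - \<eta> x - W x \<bullet> z)
       + (\<eta> (x + z) - \<eta> x) * (V x \<bullet> z)"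
    by (simp add: algebra_simps inner_add_left)
  also have "\<bar>\<dots>\<bar> \<le> C * (B * norm z powr g) + B * (C * norm z powr g) + B * (3 * C * norm z powr g)"
  proof (intro order_trans[OF abs_triangle_ineq] add_mono)
    show "\<bar>\<eta> (x + z) * (\<phi> (x + z) - \<phi> x - V x \<bullet> z)\<bar> \<le> C * (B * norm z powr g)"
      unfolding abs_mult using j2(3,6) j1(5)[OF z] by (intro mult_mono) auto
    show "\<bar>\<phi> x * (\<eta> (x + z) - \<eta> x - W x \<bullet> z)\<bar> \<le> B * (C * norm z powr g)"
      unfolding abs_mult using j1(3,6) j2(5)[OF z] by (intro mult_mono) auto
    have "\<bar>(\<eta> (x + z) - \<eta> x) * (V x \<bullet> z)\<bar> \<le> \<bar>\<eta> (x + z) - \<eta> x\<bar> * (B * norm z)"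
      unfolding abs_mult using Cauchy_Schwarz_ineq2[of "V x" z] mult_right_mono[OF j1(4)[of x], of "norm z"]
      by (intro mult_left_mono) auto
    also have "\<dots> = B * (\<bar>\<eta> (x + z) - \<eta> x\<bar> * norm z)" by simp
    also have "\<dots> \<le> B * (3 * C * norm z powr g)" using inc j1(6) by (intro mult_left_mono) auto
    finally show "\<bar>(\<eta> (x + z) - \<eta> x) * (V x \<bullet> z)\<bar> \<le> B * (3 * C * norm z powr g)" .
  qed
  also have "\<dots> = 5 * B * C * norm z powr g" by (simp add: algebra_simps)
  finally show "\<bar>\<phi> (x + z) * \<eta> (x + z) - \<phi> x * \<eta> x - (\<eta> x *\<^sub>R V x + \<phi> x *\<^sub>R W x) \<bullet> z\<bar> \<le> 5 * B * C * norm z powr g" .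
qed

text \<open>Averages of translates keep the constant of a jet; convolution with a Gaussian is of this form.\<close>

lemma jet_average:
  fixes \<phi> :: "'a::euclidean_space \<Rightarrow> real"
  assumes M: "prob_space M" and h[measurable]: "h \<in> borel_measurable M" and j: "jet g B \<phi> V"
  shows "jet g B (\<lambda>x. LINT y|M. \<phi> (x + h y)) (\<lambda>x. LINT y|M. V (x + h y))"
  unfolding jet_def
proof (intro conjI allI impI)
  interpret prob_space M by fact
  note j' = jetD[OF j]
  have [measurable]: "\<phi> \<in> borel_measurable borel" "V \<in> borel_measurable borel" using j' by auto
  have i1: "integrable M (\<lambda>y. \<phi> (x + h y))" for x
    by (rule integrable_const_bound[of _ B]) (use j' in auto)
  have i2: "integrable M (\<lambda>y. V (x + h y))" for x
    by (rule integrable_const_bound[of _ B]) (use j' in auto)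
  show "continuous_on UNIV (\<lambda>x. LINT y|M. \<phi> (x + h y))"
    by (rule continuous_on_lebesgue_integral[where h="\<lambda>_. B"])
      (use j' in \<open>auto intro!: continuous_intros continuous_on_compose2[OF j'(1)]\<close>)
  show "continuous_on UNIV (\<lambda>x. LINT y|M. V (x + h y))"
    by (rule continuous_on_lebesgue_integral[where h="\<lambda>_. B"])
      (use j' in \<open>auto intro!: continuous_intros continuous_on_compose2[OF j'(2)]\<close>)
  have bd: "norm (integral\<^sup>L M f) \<le> C" if "integrable M f" "\<And>y. norm (f y) \<le> C"
    for f :: "'b \<Rightarrow> 'c::{banach,second_countable_topology}" and C
  proof -
    have "norm (integral\<^sup>L M f) \<le> (LINT y|M. norm (f y))" by (rule integral_norm_bound)
    also have "\<dots> \<le> (LINT y|M. C)" using that by (intro integral_mono) auto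
    finally show ?thesis by (simp add: prob_space)
  qed
  show "\<bar>LINT y|M. \<phi> (x + h y)\<bar> \<le> B" for x using bd[OF i1[of x], of B] j' by simp
  show "norm (LINT y|M. V (x + h y)) \<le> B" for x using bd[OF i2[of x], of B] j' by simp
  fix x z :: 'a assume z: "norm z < 1"
  have "(LINT y|M. \<phi> (x + z + h y)) - (LINT y|M. \<phi> (x + h y)) - (LINT y|M. V (x + h y)) \<bullet> z
     = (LINT y|M. \<phi> (x + h y + z) - \<phi> (x + h y) - V (x + h y) \<bullet> z)"
    using i1[of "x + z"] i1[of x] i2[of x] by (simp add: algebra_simps)
  also have "\<bar>\<dots>\<bar> \<le> B * norm z powr g"
  proof -
    have "integrable M (\<lambda>y. \<phi> (x + h y + z))" using i1[of "x + z"] by (simp add: algebra_simps)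
    then have "integrable M (\<lambda>y. \<phi> (x + h y + z) - \<phi> (x + h y) - V (x + h y) \<bullet> z)"
      using i1[of x] i2[of x] by simp
    from bd[OF this, of "B * norm z powr g"] show ?thesis using j'(5)[OF z] by simp
  qed
  finally show "\<bar>(LINT y|M. \<phi> (x + z + h y)) - (LINT y|M. \<phi> (x + h y)) - (LINT y|M. V (x + h y)) \<bullet> z\<bar> \<le> B * norm z powr g" .
qed

lemma cis_taylor2: "norm (cis (s + t) - cis s - \<i> * of_real t * cis s) \<le> t\<^sup>2 / 2"
proof -
  have "cis (s + t) - cis s - \<i> * of_real t * cis s = cis s * (iexp t - (\<Sum>k\<le>1. (\<i> * t) ^ k / fact k))"
    by (simp add: cis_mult[symmetric] cis_conv_exp[symmetric] algebra_simps)
  then have "norm (cis (s + t) - cis s - \<i> * of_real t * cis s) = norm (iexp t - (\<Sum>k\<le>1. (\<i> * t) ^ k / fact k))"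
    by (simp add: norm_mult)
  also have "\<dots> \<le> \<bar>t\<bar> ^ Suc 1 / fact (Suc 1)" by (rule iexp_approx1)
  finally show ?thesis by (simp add: power2_eq_square)
qed

lemma wave_taylor:
  "\<bar>Re (c * cis (\<xi> \<bullet> (x + z))) - Re (c * cis (\<xi> \<bullet> x)) - ((- Im (c * cis (\<xi> \<bullet> x))) *\<^sub>R \<xi>) \<bullet> z\<bar>
     \<le> norm c * (norm \<xi>)\<^sup>2 * (norm z)\<^sup>2"
proof -
  have "Re (c * cis (\<xi> \<bullet> (x + z))) - Re (c * cis (\<xi> \<bullet> x)) - ((- Im (c * cis (\<xi> \<bullet> x))) *\<^sub>R \<xi>) \<bullet> z
    = Re (c * (cis (\<xi> \<bullet> x + \<xi> \<bullet> z) - cis (\<xi> \<bullet> x) - \<i> * of_real (\<xi> \<bullet> z) * cis (\<xi> \<bullet> x)))"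
    by (simp add: algebra_simps inner_add_right)
  also have "\<bar>\<dots>\<bar> \<le> norm c * ((\<xi> \<bullet> z)\<^sup>2 / 2)"
    by (rule order_trans[OF abs_Re_le_cmod]) (simp only: norm_mult mult_left_mono[OF cis_taylor2] norm_ge_zero)
  also have "\<dots> \<le> norm c * ((norm \<xi>)\<^sup>2 * (norm z)\<^sup>2)"
  proof (rule mult_left_mono)
    have "(\<xi> \<bullet> z)\<^sup>2 \<le> (norm \<xi> * norm z)\<^sup>2"
      using Cauchy_Schwarz_ineq2[of \<xi> z] by (subst abs_le_square_iff[symmetric]) auto
    then show "(\<xi> \<bullet> z)\<^sup>2 / 2 \<le> (norm \<xi>)\<^sup>2 * (norm z)\<^sup>2"
      unfolding power_mult_distrib using zero_le_power2[of "\<xi> \<bullet> z"] by linarith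
  qed simp
  finally show ?thesis by (simp add: mult.assoc)
qed

lemma norm_le_one_plus_square: "norm x \<le> 1 + (norm x)\<^sup>2"
  using zero_le_power2[of "norm x - 1/2"] by (simp add: power2_eq_square algebra_simps)

lemma wave_classD:
  assumes "wave_class G a"
  shows "finite_measure G" "sets G = sets borel" "a \<in> borel_measurable borel" "a \<in> borel_measurable G"
    "integrable G (\<lambda>\<xi>. norm (a \<xi>) * (1 + (norm \<xi>)\<^sup>2))" "integrable G (\<lambda>\<xi>. norm (a \<xi>))"
proof -
  show *: "finite_measure G" "sets G = sets borel" "a \<in> borel_measurable borel"
    "integrable G (\<lambda>\<xi>. norm (a \<xi>) * (1 + (norm \<xi>)\<^sup>2))"
    using assms by (auto simp: wave_class_def)
  show [measurable]: "a \<in> borel_measurable G" using * by (simp cong: measurable_cong_sets)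
  show "integrable G (\<lambda>\<xi>. norm (a \<xi>))"
    by (rule Bochner_Integration.integrable_bound[OF *(4)]) (auto simp: abs_mult algebra_simps)
qed

lemma wave_integrable:
  assumes "wave_class G a"
  shows "integrable G (\<lambda>\<xi>. a \<xi> * cis (\<xi> \<bullet> x))" "integrable G (\<lambda>\<xi>. Re (a \<xi> * cis (\<xi> \<bullet> x)))"
    "integrable G (\<lambda>\<xi>. (- Im (a \<xi> * cis (\<xi> \<bullet> x))) *\<^sub>R \<xi>)"
proof -
  note w = wave_classD[OF assms]
  note w(2)[measurable_cong] w(3)[measurable]
  show i: "integrable G (\<lambda>\<xi>. a \<xi> * cis (\<xi> \<bullet> x))"
    by (rule Bochner_Integration.integrable_bound[OF w(6)]) (auto simp: norm_mult)
  then show "integrable G (\<lambda>\<xi>. Re (a \<xi> * cis (\<xi> \<bullet> x)))" by (rule integrable_Re)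
  show "integrable G (\<lambda>\<xi>. (- Im (a \<xi> * cis (\<xi> \<bullet> x))) *\<^sub>R \<xi>)"
  proof (rule Bochner_Integration.integrable_bound[OF w(5)])
    have "\<bar>Im (a \<xi> * cis (\<xi> \<bullet> x))\<bar> * norm \<xi> \<le> norm (a \<xi>) * (1 + (norm \<xi>)\<^sup>2)" for \<xi>
      using abs_Im_le_cmod[of "a \<xi> * cis (\<xi> \<bullet> x)"] norm_le_one_plus_square[of \<xi>]
      by (intro mult_mono) (auto simp: norm_mult)
    then show "AE \<xi> in G. norm ((- Im (a \<xi> * cis (\<xi> \<bullet> x))) *\<^sub>R \<xi>) \<le> norm (norm (a \<xi>) * (1 + (norm \<xi>)\<^sup>2))"
      by (intro AE_I2) (simp only: norm_scaleR real_norm_def abs_minus_cancel abs_ge_self[THEN order_trans[rotated]])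
  qed measurable
qed

lemma waves_jet:
  assumes "wave_class G a"
  shows "\<exists>B. jet 2 B (waves G a) (waves_grad G a)"
proof -
  note w = wave_classD[OF assms] and i = wave_integrable[OF assms]
  note w(2)[measurable_cong] w(3)[measurable]
  define B where "B = (LINT \<xi>|G. norm (a \<xi>) * (1 + (norm \<xi>)\<^sup>2))"
  have b1: "\<bar>Re (a \<xi> * cis (\<xi> \<bullet> x))\<bar> \<le> norm (a \<xi>) * (1 + (norm \<xi>)\<^sup>2)" for \<xi> x
    by (rule order_trans[OF abs_Re_le_cmod]) (auto simp: norm_mult algebra_simps)
  have b2: "norm ((- Im (a \<xi> * cis (\<xi> \<bullet> x))) *\<^sub>R \<xi>) \<le> norm (a \<xi>) * (1 + (norm \<xi>)\<^sup>2)" for \<xi> x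
    unfolding norm_scaleR
    using abs_Im_le_cmod[of "a \<xi> * cis (\<xi> \<bullet> x)"] norm_le_one_plus_square[of \<xi>]
    by (intro mult_mono) (auto simp: norm_mult)
  have "jet 2 B (waves G a) (waves_grad G a)"
    unfolding jet_def
  proof (intro conjI allI impI)
    show "continuous_on UNIV (waves G a)"
      unfolding waves_def[abs_def]
      by (rule continuous_on_lebesgue_integral[OF _ _ w(5)]) (use b1 in \<open>auto intro!: continuous_intros\<close>)
    show "continuous_on UNIV (waves_grad G a)"
      unfolding waves_grad_def[abs_def]
      by (rule continuous_on_lebesgue_integral[OF _ _ w(5)]) (use b2 in \<open>auto intro!: continuous_intros\<close>)
    show "\<bar>waves G a x\<bar> \<le> B" for x
      unfolding waves_def B_def real_norm_def[symmetric]
      by (rule order_trans[OF integral_norm_bound])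
        (use b1 i w in \<open>auto intro!: integral_mono integrable_abs\<close>)
    show "norm (waves_grad G a x) \<le> B" for x
      unfolding waves_grad_def B_def
      by (rule order_trans[OF integral_norm_bound])
        (use b2 i w in \<open>intro integral_mono integrable_norm, auto\<close>)
    fix x z :: 'a
    have "waves G a (x + z) - waves G a x - waves_grad G a x \<bullet> z
      = (LINT \<xi>|G. Re (a \<xi> * cis (\<xi> \<bullet> (x + z))) - Re (a \<xi> * cis (\<xi> \<bullet> x)) - ((- Im (a \<xi> * cis (\<xi> \<bullet> x))) *\<^sub>R \<xi>) \<bullet> z)"
      unfolding waves_def waves_grad_def
      by (subst Bochner_Integration.integral_diff, intro Bochner_Integration.integrable_diff i,
          intro integrable_inner_left i, subst Bochner_Integration.integral_diff, rule i, rule i,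
          subst integral_inner_left, rule i, rule refl)
    also have "\<bar>\<dots>\<bar> \<le> (LINT \<xi>|G. (norm (a \<xi>) * (1 + (norm \<xi>)\<^sup>2)) * (norm z)\<^sup>2)"
      unfolding real_norm_def[symmetric]
    proof (rule order_trans[OF integral_norm_bound], rule integral_mono)
      show "integrable G (\<lambda>\<xi>. norm (Re (a \<xi> * cis (\<xi> \<bullet> (x + z))) - Re (a \<xi> * cis (\<xi> \<bullet> x)) - ((- Im (a \<xi> * cis (\<xi> \<bullet> x))) *\<^sub>R \<xi>) \<bullet> z))"
        by (intro integrable_norm Bochner_Integration.integrable_diff integrable_inner_left i)
      show "integrable G (\<lambda>\<xi>. (norm (a \<xi>) * (1 + (norm \<xi>)\<^sup>2)) * (norm z)\<^sup>2)" using w by simp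
      fix \<xi>
      show "norm (Re (a \<xi> * cis (\<xi> \<bullet> (x + z))) - Re (a \<xi> * cis (\<xi> \<bullet> x)) - ((- Im (a \<xi> * cis (\<xi> \<bullet> x))) *\<^sub>R \<xi>) \<bullet> z)
         \<le> (norm (a \<xi>) * (1 + (norm \<xi>)\<^sup>2)) * (norm z)\<^sup>2"
        unfolding real_norm_def
        by (rule order_trans[OF wave_taylor]) (auto intro!: mult_right_mono mult_left_mono)
    qed
    also have "\<dots> = B * norm z powr 2"
      unfolding B_def by (simp add: powr_numeral)
    finally show "\<bar>waves G a (x + z) - waves G a x - waves_grad G a x \<bullet> z\<bar> \<le> B * norm z powr 2" .
  qed
  then show ?thesis ..
qed

text \<open>The cutoff function: it is itself a superposition of waves, hence a jet, and it is integrable.\<close>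

definition bump :: "'a::euclidean_space \<Rightarrow> real" where
  "bump x = exp (- (norm x)\<^sup>2 / 2)"

lemma gauss_wave_class: "wave_class gauss (\<lambda>_. 1)"
proof -
  interpret prob_space "gauss :: 'a measure" by (rule prob_space_gauss)
  show ?thesis
    unfolding wave_class_def using gauss_norm_square_integrable finite_measure_axioms by auto
qed

lemma bump_eq_waves: "bump = waves gauss (\<lambda>_. 1)"
proof
  fix x :: 'a
  interpret prob_space "gauss :: 'a measure" by (rule prob_space_gauss)
  have "integrable gauss (\<lambda>\<xi>. cis (\<xi> \<bullet> x))"
    by (rule integrable_const_bound[of _ 1]) auto
  then have "waves gauss (\<lambda>_. 1) x = Re (LINT \<xi>|gauss. cis (\<xi> \<bullet> x))"
    unfolding waves_def mult_1 by (rule integral_Re)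
  then show "bump x = waves gauss (\<lambda>_. 1) x"
    unfolding gauss_char bump_def by simp
qed


lemma bump_scaled_integrable:
  assumes "N > 0"
  shows "integrable lborel (\<lambda>x::'a::euclidean_space. bump (x /\<^sub>R N))"
proof -
  have eq: "bump (x /\<^sub>R N) = exp (- (1 / (2 * N\<^sup>2)) * (norm x)\<^sup>2)" for x :: 'a
    unfolding bump_def using assms by (simp add: power_mult_distrib power_divide field_simps)
  show ?thesis
    unfolding eq using assms by (intro exp_norm_square_integrable) simp
qed

lemma bump_scaled_jet:
  "\<exists>C. \<forall>N\<ge>1. jet 2 C (\<lambda>x::'a::euclidean_space. bump (x /\<^sub>R N))
     (\<lambda>x. (waves_grad gauss (\<lambda>_. 1) (x /\<^sub>R N)) /\<^sub>R N)"
proof -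
  obtain C where C: "jet 2 C (bump :: 'a \<Rightarrow> real) (waves_grad gauss (\<lambda>_. 1))"
    using waves_jet[OF gauss_wave_class] unfolding bump_eq_waves by auto
  note j = jetD[OF C]
  have "jet 2 C (\<lambda>x::'a. bump (x /\<^sub>R N)) (\<lambda>x. (waves_grad gauss (\<lambda>_. 1) (x /\<^sub>R N)) /\<^sub>R N)" if N: "N \<ge> 1" for N
    unfolding jet_def
  proof (intro conjI allI impI)
    have d: "s / N \<le> s" if "s \<ge> 0" for s using N that by (simp add: divide_le_eq mult_left_le mult_le_cancel_left1)
    show "continuous_on UNIV (\<lambda>x::'a. bump (x /\<^sub>R N))"
      by (intro continuous_on_compose2[OF j(1)] continuous_intros) auto
    show "continuous_on UNIV (\<lambda>x::'a. (waves_grad gauss (\<lambda>_. 1) (x /\<^sub>R N)) /\<^sub>R N)"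
    proof -
      have "continuous_on UNIV (\<lambda>x::'a. waves_grad gauss (\<lambda>_. 1) (x /\<^sub>R N))"
        by (rule continuous_on_compose2[OF j(2)]) (auto intro!: continuous_intros)
      then show ?thesis by (rule continuous_on_scaleR[OF continuous_on_const])
    qed
    show "\<bar>bump (x /\<^sub>R N)\<bar> \<le> C" for x :: 'a by (rule j)
    show "norm (waves_grad gauss (\<lambda>_. 1) (x /\<^sub>R N) /\<^sub>R N) \<le> C" for x :: 'a
      using d[of "norm (waves_grad gauss (\<lambda>_. 1) (x /\<^sub>R N))"] j(4)[of "x /\<^sub>R N"] N
      by (simp add: divide_inverse mult.commute)
    fix x z :: 'a assume z: "norm z < 1"
    have nz: "norm (z /\<^sub>R N) \<le> norm z" using d[of "norm z"] N by (simp add: divide_inverse mult.commute)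
    then have "\<bar>bump (x /\<^sub>R N + z /\<^sub>R N) - bump (x /\<^sub>R N) - waves_grad gauss (\<lambda>_. 1) (x /\<^sub>R N) \<bullet> (z /\<^sub>R N)\<bar> \<le> C * norm (z /\<^sub>R N) powr 2"
      using z by (intro j) auto
    also have "\<dots> \<le> C * norm z powr 2" using nz j(6) by (intro mult_left_mono powr_mono2) auto
    finally show "\<bar>bump ((x + z) /\<^sub>R N) - bump (x /\<^sub>R N) - (waves_grad gauss (\<lambda>_. 1) (x /\<^sub>R N) /\<^sub>R N) \<bullet> z\<bar> \<le> C * norm z powr 2"
      by (simp add: scaleR_add_right)
  qed
  then show ?thesis by blast
qed

text \<open>The functions may depend on \<open>n\<close> because the width of the cutoff does.\<close>

lemma mollify_tendsto:
  fixes h :: "nat \<Rightarrow> 'a::euclidean_space \<Rightarrow> 'b::{banach,second_countable_topology}"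
  assumes meas[measurable]: "\<And>n. h n \<in> borel_measurable borel"
    and bound: "\<And>n x. norm (h n x) \<le> B"
    and lim: "\<And>u x. u \<longlonglongrightarrow> x \<Longrightarrow> (\<lambda>n. h n (u n)) \<longlonglongrightarrow> l x"
  shows "(\<lambda>n. LINT y|gauss. h n (x + y /\<^sub>R real (Suc n))) \<longlonglongrightarrow> l x"
proof -
  interpret prob_space "gauss :: 'a measure" by (rule prob_space_gauss)
  have "(\<lambda>n. LINT y|gauss. h n (x + y /\<^sub>R real (Suc n))) \<longlonglongrightarrow> (LINT y|(gauss :: 'a measure). l x)"
  proof (rule integral_dominated_convergence[where w="\<lambda>_. B"])
    have "(\<lambda>n. h n (x + y /\<^sub>R real (Suc n))) \<longlonglongrightarrow> l x" for y
    proof (rule lim)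
      have "(\<lambda>n. x + y /\<^sub>R real (Suc n)) \<longlonglongrightarrow> x + 0 *\<^sub>R y"
        by (intro tendsto_intros LIMSEQ_inverse_real_of_nat)
      then show "(\<lambda>n. x + y /\<^sub>R real (Suc n)) \<longlonglongrightarrow> x" by simp
    qed
    then show "AE y in gauss. (\<lambda>n. h n (x + y /\<^sub>R real (Suc n))) \<longlonglongrightarrow> l x" by simp
  qed (use bound in auto)
  then show ?thesis using prob_space by simp
qed

lemma bump_scaled_tendsto:
  assumes "u \<longlonglongrightarrow> (x :: 'a::euclidean_space)"
  shows "(\<lambda>n. bump (u n /\<^sub>R real (Suc n))) \<longlonglongrightarrow> 1" "(\<lambda>n. u n /\<^sub>R real (Suc n)) \<longlonglongrightarrow> 0"
proof -
  have "(\<lambda>n. inverse (real (Suc n)) *\<^sub>R u n) \<longlonglongrightarrow> 0 *\<^sub>R x"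
    by (intro tendsto_intros LIMSEQ_inverse_real_of_nat assms)
  then show *: "(\<lambda>n. u n /\<^sub>R real (Suc n)) \<longlonglongrightarrow> 0" by simp
  have "(\<lambda>n. bump (u n /\<^sub>R real (Suc n))) \<longlonglongrightarrow> exp (- (norm (0::'a))\<^sup>2 / 2)"
    unfolding bump_def by (intro tendsto_intros *) auto
  then show "(\<lambda>n. bump (u n /\<^sub>R real (Suc n))) \<longlonglongrightarrow> 1" by simp
qed

lemma bump_bounds: "0 \<le> bump x" "bump x \<le> 1"
  by (auto simp: bump_def)

lemma bump_measurable[measurable]: "bump \<in> borel_measurable borel"
  unfolding bump_def[abs_def] by measurable

text \<open>Cutting off with a wide bump and averaging over a narrow Gaussian turns a bounded continuous
  function into a superposition of waves. The explicit form of the approximation is recorded so that its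
  gradient can be identified when the function is a jet.\<close>

lemma approximation_by_waves:
  fixes f :: "'a::euclidean_space \<Rightarrow> real"
  assumes f: "continuous_on UNIV f" "\<And>x. \<bar>f x\<bar> \<le> B"
  shows "\<exists>G a. (\<forall>n::nat. wave_class (G n) (a n)) \<and> (\<forall>n x. \<bar>waves (G n) (a n) x\<bar> \<le> B) \<and>
    (\<forall>x. (\<lambda>n. waves (G n) (a n) x) \<longlonglongrightarrow> f x) \<and>
    (\<forall>n x. waves (G n) (a n) x = (LINT y|gauss. f (x + y /\<^sub>R real (Suc n)) * bump ((x + y /\<^sub>R real (Suc n)) /\<^sub>R real (Suc n))))"
proof -
  interpret prob_space "gauss :: 'a measure" by (rule prob_space_gauss)
  have [measurable]: "f \<in> borel_measurable borel" using f by (intro borel_measurable_continuous_onI)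
  define h where "h n x = f x * bump (x /\<^sub>R real (Suc n))" for n x
  have hB: "norm (h n x) \<le> B" for n x
  proof -
    have "\<bar>f x\<bar> * bump (x /\<^sub>R real (Suc n)) \<le> \<bar>f x\<bar> * 1"
      using bump_bounds by (intro mult_left_mono) auto
    then show ?thesis using f(2)[of x] bump_bounds(1)[of "x /\<^sub>R real (Suc n)"] by (simp add: h_def abs_mult)
  qed
  have hmeas[measurable]: "h n \<in> borel_measurable borel" for n unfolding h_def[abs_def] by measurable
  have "integrable lborel (h n)" for n
  proof (rule Bochner_Integration.integrable_bound)
    show "integrable lborel (\<lambda>x. B * bump (x /\<^sub>R real (Suc n)))"
      by (intro integrable_mult_right bump_scaled_integrable) auto
    show "AE x in lborel. norm (h n x) \<le> norm (B * bump (x /\<^sub>R real (Suc n)))"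
    proof (rule AE_I2)
      fix x :: 'a
      have "norm (h n x) = \<bar>f x\<bar> * bump (x /\<^sub>R real (Suc n))"
        using bump_bounds(1)[of "x /\<^sub>R real (Suc n)"] by (simp add: h_def abs_mult)
      also have "\<dots> \<le> B * bump (x /\<^sub>R real (Suc n))"
        by (intro mult_right_mono f bump_bounds)
      finally show "norm (h n x) \<le> norm (B * bump (x /\<^sub>R real (Suc n)))" by simp
    qed
  qed simp
  then have "\<exists>G a. wave_class G a \<and> (\<forall>x. (LINT y|gauss. h n (x + y /\<^sub>R real (Suc n))) = waves G a x)" for n
    by (rule gauss_average_eq_waves) simp
  then have "\<forall>n. \<exists>p. wave_class (fst p) (snd p) \<and> (\<forall>x. (LINT y|gauss. h n (x + y /\<^sub>R real (Suc n))) = waves (fst p) (snd p) x)"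
    by simp
  from choice[OF this] obtain p where
    p: "\<forall>n. wave_class (fst (p n)) (snd (p n)) \<and> (\<forall>x. (LINT y|gauss. h n (x + y /\<^sub>R real (Suc n))) = waves (fst (p n)) (snd (p n)) x)" ..
  define G where "G n = fst (p n)" for n
  define a where "a n = snd (p n)" for n
  have Ga: "wave_class (G n) (a n)" "(LINT y|gauss. h n (x + y /\<^sub>R real (Suc n))) = waves (G n) (a n) x" for n x
    using p unfolding G_def a_def by auto
  show ?thesis
  proof (intro exI[of _ G] exI[of _ a] conjI allI)
    show "wave_class (G n) (a n)" for n by (rule Ga)
    show "\<bar>waves (G n) (a n) x\<bar> \<le> B" for n x
    proof -
      have "\<bar>waves (G n) (a n) x\<bar> \<le> (LINT y|gauss. norm (h n (x + y /\<^sub>R real (Suc n))))"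
        unfolding Ga(2)[symmetric] real_norm_def[symmetric] by (rule integral_norm_bound)
      also have "\<dots> \<le> (LINT y|(gauss :: 'a measure). B)"
      proof (rule integral_mono)
        show "integrable gauss (\<lambda>y. norm (h n (x + y /\<^sub>R real (Suc n))))"
          by (rule integrable_const_bound[of _ B]) (use hB in auto)
      qed (use hB in auto)
      finally show ?thesis using prob_space by simp
    qed
    show "(\<lambda>n. waves (G n) (a n) x) \<longlonglongrightarrow> f x" for x
      unfolding Ga(2)[symmetric]
    proof (rule mollify_tendsto[OF hmeas hB])
      fix u and x :: 'a assume u: "u \<longlonglongrightarrow> x"
      have "(\<lambda>n. f (u n)) \<longlonglongrightarrow> f x"
        using f(1) u by (auto simp: continuous_on_sequentially comp_def)
      from tendsto_mult[OF this bump_scaled_tendsto(1)[OF u]]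
      show "(\<lambda>n. h n (u n)) \<longlonglongrightarrow> f x" by (simp add: h_def)
    qed
    show "waves (G n) (a n) x = (LINT y|gauss. f (x + y /\<^sub>R real (Suc n)) * bump ((x + y /\<^sub>R real (Suc n)) /\<^sub>R real (Suc n)))" for n x
      unfolding Ga(2)[symmetric] h_def ..
  qed
qed

text \<open>The approximations of the previous lemma are averages of the jet cut off, so they are jets with a
  common constant. Their fields are the averages of the field cut off; by uniqueness of the field these
  are the gradients of the superpositions of waves.\<close>

lemma jet_approximation_by_waves:
  fixes \<phi> :: "'a::euclidean_space \<Rightarrow> real"
  assumes j: "jet g B \<phi> V" and g: "1 < g" "g \<le> 2"
  shows "\<exists>G a K. (\<forall>n::nat. wave_class (G n) (a n)) \<and>
    (\<forall>n. jet g K (waves (G n) (a n)) (waves_grad (G n) (a n))) \<and>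
    (\<forall>x. (\<lambda>n. waves (G n) (a n) x) \<longlonglongrightarrow> \<phi> x) \<and>
    (\<forall>x. (\<lambda>n. waves_grad (G n) (a n) x) \<longlonglongrightarrow> V x)"
proof -
  note j' = jetD[OF j]
  note j'(7)[measurable] j'(8)[measurable]
  define W where "W = waves_grad gauss (\<lambda>_::'a. 1)"
  have "\<exists>C. \<forall>N\<ge>1. jet 2 C (\<lambda>x::'a. bump (x /\<^sub>R N)) (\<lambda>x. W (x /\<^sub>R N) /\<^sub>R N)"
    unfolding W_def by (rule bump_scaled_jet)
  then obtain C where C': "\<forall>N\<ge>1. jet 2 C (\<lambda>x::'a. bump (x /\<^sub>R N)) (\<lambda>x. W (x /\<^sub>R N) /\<^sub>R N)" ..
  have C: "jet 2 C (\<lambda>x::'a. bump (x /\<^sub>R N)) (\<lambda>x. W (x /\<^sub>R N) /\<^sub>R N)" if "N \<ge> 1" for N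
    using C' that by simp
  have W1: "jet 2 C bump W" using C[of 1] by simp
  note [measurable] = jetD(8)[OF W1]
  from approximation_by_waves[OF j'(1,3)]
  obtain G a where Ga: "\<And>n::nat. wave_class (G n) (a n)" "\<And>n x. \<bar>waves (G n) (a n) x\<bar> \<le> B"
    "\<And>x. (\<lambda>n. waves (G n) (a n) x) \<longlonglongrightarrow> \<phi> x"
    "\<And>n x. waves (G n) (a n) x = (LINT y|gauss. \<phi> (x + y /\<^sub>R real (Suc n)) * bump ((x + y /\<^sub>R real (Suc n)) /\<^sub>R real (Suc n)))"
    by (elim exE conjE) (rule that; blast)
  define V' where "V' n x = bump (x /\<^sub>R real (Suc n)) *\<^sub>R V x + \<phi> x *\<^sub>R (W (x /\<^sub>R real (Suc n)) /\<^sub>R real (Suc n))" for n x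
  have prod: "jet g (5 * B * C) (\<lambda>x. \<phi> x * bump (x /\<^sub>R real (Suc n))) (V' n)" for n
    unfolding V'_def by (intro jet_product[OF j] jet_mono[OF C[of "real (Suc n)"]] g) auto
  have avg: "jet g (5 * B * C) (waves (G n) (a n)) (\<lambda>x. LINT y|gauss. V' n (x + y /\<^sub>R real (Suc n)))" for n
    using jet_average[OF prob_space_gauss _ prod[of n], of "\<lambda>y. y /\<^sub>R real (Suc n)"]
    unfolding Ga(4) by simp
  have grad: "waves_grad (G n) (a n) = (\<lambda>x. LINT y|gauss. V' n (x + y /\<^sub>R real (Suc n)))" for n
  proof -
    obtain B' where "jet 2 B' (waves (G n) (a n)) (waves_grad (G n) (a n))"
      using waves_jet[OF Ga(1)] by blast
    then have "jet g B' (waves (G n) (a n)) (waves_grad (G n) (a n))" using g by (rule_tac jet_mono) auto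
    then show ?thesis using avg g(1) by (rule jet_field_unique)
  qed
  show ?thesis
  proof (intro exI[of _ G] exI[of _ a] exI[of _ "5 * B * C"] conjI allI)
    show "wave_class (G n) (a n)" for n by (rule Ga)
    show "jet g (5 * B * C) (waves (G n) (a n)) (waves_grad (G n) (a n))" for n
      unfolding grad by (rule avg)
    show "(\<lambda>n. waves (G n) (a n) x) \<longlonglongrightarrow> \<phi> x" for x by (rule Ga(3))
    show "(\<lambda>n. waves_grad (G n) (a n) x) \<longlonglongrightarrow> V x" for x
      unfolding grad
    proof (rule mollify_tendsto)
      show "V' n \<in> borel_measurable borel" for n unfolding V'_def by measurable
      show "norm (V' n x) \<le> 5 * B * C" for n x by (rule jetD(4)[OF prod])
      fix u and x :: 'a assume u: "u \<longlonglongrightarrow> x"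
      have 1: "(\<lambda>n. V (u n)) \<longlonglongrightarrow> V x" "(\<lambda>n. \<phi> (u n)) \<longlonglongrightarrow> \<phi> x"
        using j'(1,2) u by (auto simp: continuous_on_sequentially comp_def)
      have 2: "(\<lambda>n. W (u n /\<^sub>R real (Suc n))) \<longlonglongrightarrow> W 0"
        using jetD(2)[OF W1] bump_scaled_tendsto(2)[OF u] by (auto simp: continuous_on_sequentially comp_def)
      have "(\<lambda>n. bump (u n /\<^sub>R real (Suc n)) *\<^sub>R V (u n) + \<phi> (u n) *\<^sub>R (W (u n /\<^sub>R real (Suc n)) /\<^sub>R real (Suc n)))
         \<longlonglongrightarrow> 1 *\<^sub>R V x + \<phi> x *\<^sub>R (0 *\<^sub>R W 0)"
        by (intro tendsto_intros 1 2 bump_scaled_tendsto(1)[OF u] LIMSEQ_inverse_real_of_nat)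
      then show "(\<lambda>n. V' n (u n)) \<longlonglongrightarrow> V x" by (simp add: V'_def)
    qed
  qed
qed


section \<open>Levy semigroups and their generators\<close>

lemma unit_ball_measurable[measurable]: "ball (0::'a::euclidean_space) 1 \<in> sets borel"
  by simp

text \<open>The gradient is an argument of its own, so that the operator acts on jets.\<close>

definition levy_op :: "'a::euclidean_space measure \<Rightarrow> ('a \<Rightarrow> real) \<Rightarrow> ('a \<Rightarrow> 'a) \<Rightarrow> 'a \<Rightarrow> real" where
  "levy_op \<mu> \<phi> V x = (LINT z|\<mu>. \<phi> (x + z) - \<phi> x - indicator (ball 0 1) z * (V x \<bullet> z))"

text \<open>The measure \<open>\<nu> t\<close> is the one with density \<open>p\<^sub>t\<close>. It is tied to the jump measure \<open>\<mu>\<close> only by its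
  characteristic function. The exponent \<open>g\<close> is the order of the first-order remainders that \<open>\<mu>\<close>
  integrates near the origin.\<close>

locale levy_semigroup =
  fixes \<mu> :: "'a::euclidean_space measure" and \<nu> :: "real \<Rightarrow> 'a measure"
    and \<psi> :: "'a \<Rightarrow> complex" and g :: real
  assumes sets_mu[measurable_cong, simp]: "sets \<mu> = sets borel" and mu_0: "emeasure \<mu> {0} = 0"
    and jump: "(\<integral>\<^sup>+z. ennreal (min 1 (norm z powr g)) \<partial>\<mu>) < \<infinity>"
    and g: "1 < g" "g \<le> 2"
    and symbol: "\<And>\<xi>. \<psi> \<xi> = (LINT z|\<mu>. 1 - cis (\<xi> \<bullet> z) + \<i> * of_real (\<xi> \<bullet> z) * indicator (ball 0 1) z)"
    and prob: "\<And>t. 0 < t \<Longrightarrow> prob_space (\<nu> t)"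
    and sets_nu[measurable_cong, simp]: "\<And>t. sets (\<nu> t) = sets borel"
    and char: "\<And>t \<xi>. 0 < t \<Longrightarrow> (LINT y|\<nu> t. cis (- (\<xi> \<bullet> y))) = exp (- of_real t * \<psi> \<xi>)"
begin

definition P :: "real \<Rightarrow> ('a \<Rightarrow> real) \<Rightarrow> 'a \<Rightarrow> real" where
  "P t f x = (LINT y|\<nu> t. f (x - y))"

definition jump_weight :: "'a \<Rightarrow> real" where
  "jump_weight z = min 1 (norm z powr g)"

definition jump_mass :: real where
  "jump_mass = (LINT z|\<mu>. jump_weight z)"

lemma space_mu[simp]: "space \<mu> = UNIV" and space_nu[simp]: "space (\<nu> t) = UNIV"
  using sets_eq_imp_space_eq[OF sets_mu] sets_eq_imp_space_eq[OF sets_nu[of t]] by auto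

lemma jump_weight_nonneg: "0 \<le> jump_weight z"
  by (simp add: jump_weight_def)

lemma jump_weight_small: "norm z < 1 \<Longrightarrow> jump_weight z = norm z powr g"
  using g powr_le1[of g "norm z"] by (simp add: jump_weight_def)

lemma jump_weight_large: "1 \<le> norm z \<Longrightarrow> jump_weight z = 1"
  using g ge_one_powr_ge_zero[of "norm z" g] by (simp add: jump_weight_def)

lemma square_le_jump_weight: "norm z < 1 \<Longrightarrow> (norm z)\<^sup>2 \<le> jump_weight z"
  using powr_le_powr_of_le_one[of "norm z" g 2] g by (simp add: jump_weight_small powr_numeral)

lemma jump_weight_measurable[measurable]: "jump_weight \<in> borel_measurable borel"
  unfolding jump_weight_def[abs_def] by measurable

lemma integrable_jump_weight: "integrable \<mu> jump_weight"
  using jump by (intro integrableI_nonneg) (auto simp: jump_weight_def)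

lemma jump_mass_nonneg: "0 \<le> jump_mass"
  unfolding jump_mass_def by (intro integral_nonneg_AE) (simp add: jump_weight_nonneg)

text \<open>The weight vanishes at the origin only, and the origin is a null set; the sets where the
  weight is at least \<open>1/n\<close> have finite measure and exhaust the rest.\<close>

lemma sigma_finite_mu: "sigma_finite_measure \<mu>"
proof
  define A where "A n = {z::'a. 1 \<le> real (Suc n) * jump_weight z}" for n
  have A[measurable]: "A n \<in> sets borel" for n unfolding A_def by measurable
  have fin: "emeasure \<mu> (A n) < \<infinity>" for n
  proof -
    have "emeasure \<mu> (A n) = emeasure \<mu> {z\<in>UNIV. 1 \<le> ennreal (real (Suc n)) * ennreal (jump_weight z)}"
      unfolding A_def
      by (intro arg_cong[where f="emeasure \<mu>"])
        (auto simp: ennreal_mult'[symmetric] jump_weight_nonneg simp del: of_nat_Suc ennreal_1 simp flip: ennreal_1)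
    also have "\<dots> \<le> ennreal (real (Suc n)) * (\<integral>\<^sup>+ z. ennreal (jump_weight z) * indicator UNIV z \<partial>\<mu>)"
      by (rule nn_integral_Markov_inequality) auto
    also have "\<dots> < \<infinity>"
      using jump by (auto simp: jump_weight_def ennreal_mult_less_top simp del: of_nat_Suc)
    finally show ?thesis .
  qed
  have "z \<in> (\<Union>n. A n)" if "z \<noteq> 0" for z
  proof -
    have "jump_weight z > 0" using that by (simp add: jump_weight_def)
    then obtain n where "1 / jump_weight z < real n" using reals_Archimedean2 by blast
    then have "1 \<le> real (Suc n) * jump_weight z" using \<open>jump_weight z > 0\<close> by (simp add: field_simps)
    then show ?thesis by (auto simp: A_def)
  qed
  then show "\<exists>B. countable B \<and> B \<subseteq> sets \<mu> \<and> \<Union> B = space \<mu> \<and> (\<forall>a\<in>B. emeasure \<mu> a \<noteq> \<infinity>)"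
    using fin mu_0 by (intro exI[of _ "insert {0} (range A)"]) (auto simp: less_top)
qed

lemma levy_integrand_bound:
  assumes "jet g B \<phi> V"
  shows "\<bar>\<phi> (x + z) - \<phi> x - indicator (ball 0 1) z * (V x \<bullet> z)\<bar> \<le> 2 * B * jump_weight z"
proof (cases "norm z < 1")
  case True
  then show ?thesis
    using jetD(5)[OF assms True, of x] jetD(6)[OF assms]
      mult_nonneg_nonneg[of B "norm z powr g"] by (simp add: jump_weight_small)
next
  case False
  then show ?thesis
    using jetD(3)[OF assms, of x] jetD(3)[OF assms, of "x + z"] by (simp add: jump_weight_large)
qed

lemma levy_integrand_measurable:
  assumes "jet g B \<phi> V"
  shows "(\<lambda>(x, z). \<phi> (x + z) - \<phi> x - indicator (ball 0 1) z * (V x \<bullet> z)) \<in> borel_measurable (borel \<Otimes>\<^sub>M borel)"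
proof -
  note [measurable] = jetD(7,8)[OF assms]
  show ?thesis by measurable
qed

lemma levy_integrable:
  assumes "jet g B \<phi> V"
  shows "integrable \<mu> (\<lambda>z. \<phi> (x + z) - \<phi> x - indicator (ball 0 1) z * (V x \<bullet> z))"
proof (rule Bochner_Integration.integrable_bound)
  note [measurable] = jetD(7,8)[OF assms]
  show "(\<lambda>z. \<phi> (x + z) - \<phi> x - indicator (ball 0 1) z * (V x \<bullet> z)) \<in> borel_measurable \<mu>" by measurable
  show "integrable \<mu> (\<lambda>z. 2 * B * jump_weight z)" by (intro integrable_mult_right integrable_jump_weight)
  show "AE z in \<mu>. norm (\<phi> (x + z) - \<phi> x - indicator (ball 0 1) z * (V x \<bullet> z)) \<le> norm (2 * B * jump_weight z)"
    using levy_integrand_bound[OF assms] by (intro AE_I2) (auto intro: order_trans[OF _ abs_ge_self])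
qed

lemma levy_op_bound:
  assumes "jet g B \<phi> V"
  shows "\<bar>levy_op \<mu> \<phi> V x\<bar> \<le> 2 * B * jump_mass"
proof -
  have "\<bar>levy_op \<mu> \<phi> V x\<bar> \<le> (LINT z|\<mu>. norm (\<phi> (x + z) - \<phi> x - indicator (ball 0 1) z * (V x \<bullet> z)))"
    unfolding levy_op_def real_norm_def[symmetric] by (rule integral_norm_bound)
  also have "\<dots> \<le> (LINT z|\<mu>. 2 * B * jump_weight z)"
    using levy_integrable[OF assms] levy_integrand_bound[OF assms] integrable_jump_weight
    by (intro integral_mono integrable_norm) auto
  finally show ?thesis by (simp add: jump_mass_def)
qed

lemma levy_op_measurable:
  assumes "jet g B \<phi> V"
  shows "levy_op \<mu> \<phi> V \<in> borel_measurable borel"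
proof -
  interpret sigma_finite_measure \<mu> by (rule sigma_finite_mu)
  note levy_integrand_measurable[OF assms]
  then show ?thesis
    unfolding levy_op_def[abs_def] by (intro borel_measurable_lebesgue_integral) simp
qed

lemma levy_op_tendsto:
  assumes jn: "\<And>n. jet g B (\<phi> n) (V n)" and j: "jet g B' \<phi>' V'"
    and lim: "\<And>x. (\<lambda>n. \<phi> n x) \<longlonglongrightarrow> \<phi>' x" "\<And>x. (\<lambda>n. V n x) \<longlonglongrightarrow> V' x"
  shows "(\<lambda>n. levy_op \<mu> (\<phi> n) (V n) x) \<longlonglongrightarrow> levy_op \<mu> \<phi>' V' x"
  unfolding levy_op_def
proof (rule integral_dominated_convergence[where w="\<lambda>z. 2 * B * jump_weight z"])
  show "AE z in \<mu>. (\<lambda>n. \<phi> n (x + z) - \<phi> n x - indicator (ball 0 1) z * (V n x \<bullet> z))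
      \<longlonglongrightarrow> \<phi>' (x + z) - \<phi>' x - indicator (ball 0 1) z * (V' x \<bullet> z)"
    by (intro AE_I2 tendsto_intros lim)
  show "AE z in \<mu>. norm (\<phi> n (x + z) - \<phi> n x - indicator (ball 0 1) z * (V n x \<bullet> z)) \<le> 2 * B * jump_weight z" for n
    using levy_integrand_bound[OF jn] by simp
qed (use levy_integrable[OF jn] levy_integrable[OF j] integrable_jump_weight in auto)

subsection \<open>The symbol\<close>

lemma symbol_integrand_bound:
  "norm (1 - cis (\<xi> \<bullet> z) + \<i> * of_real (\<xi> \<bullet> z) * indicator (ball 0 1) z) \<le> 2 * (1 + (norm \<xi>)\<^sup>2) * jump_weight z"
proof (cases "norm z < 1")
  case True
  have "norm (1 - cis (\<xi> \<bullet> z) + \<i> * of_real (\<xi> \<bullet> z)) = norm (cis (0 + \<xi> \<bullet> z) - cis 0 - \<i> * of_real (\<xi> \<bullet> z) * cis 0)"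
    by (subst norm_minus_cancel[symmetric]) (simp add: algebra_simps)
  also have "\<dots> \<le> (\<xi> \<bullet> z)\<^sup>2 / 2" by (rule cis_taylor2)
  also have "\<dots> \<le> (norm \<xi> * norm z)\<^sup>2"
  proof -
    have "(\<xi> \<bullet> z)\<^sup>2 \<le> (norm \<xi> * norm z)\<^sup>2"
      using Cauchy_Schwarz_ineq2[of \<xi> z] abs_le_square_iff[of "\<xi> \<bullet> z" "norm \<xi> * norm z"] by simp
    then show ?thesis using zero_le_power2[of "\<xi> \<bullet> z"] by linarith
  qed
  also have "\<dots> \<le> 2 * (1 + (norm \<xi>)\<^sup>2) * jump_weight z"
    unfolding power_mult_distrib by (intro mult_mono square_le_jump_weight True) auto
  finally show ?thesis using True by simp
next
  case False
  then have 1: "jump_weight z = 1" by (intro jump_weight_large) simp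
  have 2: "norm (1 - cis (\<xi> \<bullet> z)) \<le> 1 + 1"
    by (rule order_trans[OF norm_triangle_ineq4]) simp
  have 3: "(1::real) + 1 \<le> 2 * (1 + (norm \<xi>)\<^sup>2)" by simp
  have 4: "1 - cis (\<xi> \<bullet> z) + \<i> * of_real (\<xi> \<bullet> z) * indicator (ball 0 1) z = 1 - cis (\<xi> \<bullet> z)"
    using False by simp
  show ?thesis unfolding 1 4 mult_1_right by (rule order_trans[OF 2 3])
qed

lemma symbol_integrable:
  "integrable \<mu> (\<lambda>z. 1 - cis (\<xi> \<bullet> z) + \<i> * of_real (\<xi> \<bullet> z) * indicator (ball 0 1) z)"
proof (rule Bochner_Integration.integrable_bound)
  show "integrable \<mu> (\<lambda>z. 2 * (1 + (norm \<xi>)\<^sup>2) * jump_weight z)"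
    by (intro integrable_mult_right integrable_jump_weight)
  show "AE z in \<mu>. norm (1 - cis (\<xi> \<bullet> z) + \<i> * of_real (\<xi> \<bullet> z) * indicator (ball 0 1) z)
      \<le> norm (2 * (1 + (norm \<xi>)\<^sup>2) * jump_weight z)"
    using symbol_integrand_bound by (intro AE_I2) (auto intro: order_trans[OF _ abs_ge_self] simp del: norm_mult)
qed measurable

lemma symbol_measurable[measurable]: "\<psi> \<in> borel_measurable borel"
proof -
  interpret sigma_finite_measure \<mu> by (rule sigma_finite_mu)
  have "(\<lambda>\<xi>. LINT z|\<mu>. 1 - cis (\<xi> \<bullet> z) + \<i> * of_real (\<xi> \<bullet> z) * indicator (ball 0 1) z) \<in> borel_measurable borel"
    by (intro borel_measurable_lebesgue_integral) measurable
  then show ?thesis unfolding symbol[abs_def] .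
qed

lemma symbol_bound: "norm (\<psi> \<xi>) \<le> 2 * jump_mass * (1 + (norm \<xi>)\<^sup>2)"
proof -
  have "norm (\<psi> \<xi>) \<le> (LINT z|\<mu>. norm (1 - cis (\<xi> \<bullet> z) + \<i> * of_real (\<xi> \<bullet> z) * indicator (ball 0 1) z))"
    unfolding symbol by (rule integral_norm_bound)
  also have "\<dots> \<le> (LINT z|\<mu>. 2 * (1 + (norm \<xi>)\<^sup>2) * jump_weight z)"
    using symbol_integrable symbol_integrand_bound integrable_jump_weight
    by (intro integral_mono integrable_norm) auto
  also have "\<dots> = 2 * jump_mass * (1 + (norm \<xi>)\<^sup>2)"
    unfolding integral_mult_right_zero jump_mass_def by (simp only: mult_ac)
  finally show ?thesis .
qed

text \<open>The real part of the integrand is \<open>1 - cos (\<xi> \<bullet> z)\<close>.\<close>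

lemma symbol_Re_nonneg: "0 \<le> Re (\<psi> \<xi>)"
proof -
  have "Re (\<psi> \<xi>) = (LINT z|\<mu>. Re (1 - cis (\<xi> \<bullet> z) + \<i> * of_real (\<xi> \<bullet> z) * indicator (ball 0 1) z))"
    unfolding symbol by (rule integral_Re[OF symbol_integrable, symmetric])
  also have "\<dots> \<ge> 0"
    by (intro integral_nonneg_AE AE_I2) (auto simp: indicator_def)
  finally show ?thesis .
qed

lemma norm_exp_symbol: "0 \<le> t \<Longrightarrow> norm (exp (- of_real t * \<psi> \<xi>)) \<le> 1"
  using symbol_Re_nonneg[of \<xi>] by simp

subsection \<open>Action on waves\<close>

lemma P_wave:
  assumes "0 < t"
  shows "integrable (\<nu> t) (\<lambda>y. Re (c * cis (\<xi> \<bullet> (x - y))))"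
    "(LINT y|\<nu> t. Re (c * cis (\<xi> \<bullet> (x - y)))) = Re (c * exp (- of_real t * \<psi> \<xi>) * cis (\<xi> \<bullet> x))"
proof -
  interpret prob_space "\<nu> t" using assms by (rule prob)
  have i: "integrable (\<nu> t) (\<lambda>y. c * cis (\<xi> \<bullet> (x - y)))"
    by (rule integrable_const_bound[of _ "norm c"]) (auto simp: norm_mult)
  then show "integrable (\<nu> t) (\<lambda>y. Re (c * cis (\<xi> \<bullet> (x - y))))" by (rule integrable_Re)
  have eq: "(LINT y|\<nu> t. Re (c * cis (\<xi> \<bullet> (x - y)))) = Re (LINT y|\<nu> t. c * cis (\<xi> \<bullet> (x - y)))"
    using i by (rule integral_Re)
  have "(\<lambda>y. c * cis (\<xi> \<bullet> (x - y))) = (\<lambda>y. (c * cis (\<xi> \<bullet> x)) * cis (- (\<xi> \<bullet> y)))"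
    by (simp add: inner_diff_right cis_mult algebra_simps)
  moreover have "(LINT y|\<nu> t. (c * cis (\<xi> \<bullet> x)) * cis (- (\<xi> \<bullet> y))) = c * exp (- of_real t * \<psi> \<xi>) * cis (\<xi> \<bullet> x)"
    unfolding integral_mult_right_zero char[OF assms] by (simp only: mult_ac)
  ultimately show "(LINT y|\<nu> t. Re (c * cis (\<xi> \<bullet> (x - y)))) = Re (c * exp (- of_real t * \<psi> \<xi>) * cis (\<xi> \<bullet> x))"
    unfolding eq by (simp only:)
qed

lemma P_waves:
  assumes t: "0 < t" and G: "finite_measure G" "sets G = sets borel"
    and a[measurable]: "a \<in> borel_measurable borel" and int: "integrable G (\<lambda>\<xi>. norm (a \<xi>))"
  shows "P t (waves G a) = waves G (\<lambda>\<xi>. a \<xi> * exp (- of_real t * \<psi> \<xi>))"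
proof
  fix x
  interpret prob_space "\<nu> t" using t by (rule prob)
  interpret G: finite_measure G by fact
  note G(2)[measurable_cong]
  have "P t (waves G a) x = (LINT y|\<nu> t. LINT \<xi>|G. Re (a \<xi> * cis (\<xi> \<bullet> (x - y))))"
    by (simp add: P_def waves_def)
  also have "\<dots> = (LINT \<xi>|G. LINT y|\<nu> t. Re (a \<xi> * cis (\<xi> \<bullet> (x - y))))"
  proof (rule Fubini_product_bound(1)[where g="\<lambda>_. 1" and h="\<lambda>\<xi>. norm (a \<xi>)"])
    show "norm (Re (a \<xi> * cis (\<xi> \<bullet> (x - y)))) \<le> 1 * norm (a \<xi>)" for y \<xi>
      using abs_Re_le_cmod[of "a \<xi> * cis (\<xi> \<bullet> (x - y))"] by (simp add: norm_mult)
  qed (use int sigma_finite_measure_axioms G.sigma_finite_measure_axioms in auto)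
  also have "\<dots> = waves G (\<lambda>\<xi>. a \<xi> * exp (- of_real t * \<psi> \<xi>)) x"
    unfolding waves_def by (simp only: P_wave[OF t])
  finally show "P t (waves G a) x = waves G (\<lambda>\<xi>. a \<xi> * exp (- of_real t * \<psi> \<xi>)) x" .
qed

lemma levy_wave:
  "(LINT z|\<mu>. Re (c * cis (\<xi> \<bullet> (x + z))) - Re (c * cis (\<xi> \<bullet> x))
       - indicator (ball 0 1) z * (((- Im (c * cis (\<xi> \<bullet> x))) *\<^sub>R \<xi>) \<bullet> z))
     = Re (- \<psi> \<xi> * c * cis (\<xi> \<bullet> x))"
proof -
  let ?k = "\<lambda>z. 1 - cis (\<xi> \<bullet> z) + \<i> * of_real (\<xi> \<bullet> z) * indicator (ball 0 1) z"
  have "Re (c * cis (\<xi> \<bullet> (x + z))) - Re (c * cis (\<xi> \<bullet> x))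
       - indicator (ball 0 1) z * (((- Im (c * cis (\<xi> \<bullet> x))) *\<^sub>R \<xi>) \<bullet> z)
     = Re (- (c * cis (\<xi> \<bullet> x)) * ?k z)" for z
  proof -
    have "c * cis (\<xi> \<bullet> (x + z)) = (c * cis (\<xi> \<bullet> x)) * cis (\<xi> \<bullet> z)"
      by (simp add: inner_add_right cis_mult[symmetric] mult.assoc)
    then show ?thesis
      by (simp only:) (simp add: algebra_simps indicator_def del: mult_minus_left)
  qed
  then have "(LINT z|\<mu>. Re (c * cis (\<xi> \<bullet> (x + z))) - Re (c * cis (\<xi> \<bullet> x))
       - indicator (ball 0 1) z * (((- Im (c * cis (\<xi> \<bullet> x))) *\<^sub>R \<xi>) \<bullet> z))
     = (LINT z|\<mu>. Re (- (c * cis (\<xi> \<bullet> x)) * ?k z))"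
    by simp
  also have "\<dots> = Re (LINT z|\<mu>. - (c * cis (\<xi> \<bullet> x)) * ?k z)"
    by (rule integral_Re) (intro integrable_mult_right symbol_integrable)
  also have "(LINT z|\<mu>. - (c * cis (\<xi> \<bullet> x)) * ?k z) = - (c * cis (\<xi> \<bullet> x)) * \<psi> \<xi>"
    unfolding symbol by (rule integral_mult_right_zero)
  also have "\<dots> = - \<psi> \<xi> * c * cis (\<xi> \<bullet> x)" by simp
  finally show ?thesis .
qed

lemma levy_waves:
  assumes w: "wave_class G a"
  shows "levy_op \<mu> (waves G a) (waves_grad G a) = waves G (\<lambda>\<xi>. - \<psi> \<xi> * a \<xi>)"
proof
  fix x
  note wc = wave_classD[OF w] and i = wave_integrable[OF w]
  note wc(2)[measurable_cong] wc(3)[measurable]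
  interpret G: finite_measure G by (rule wc)
  let ?F = "\<lambda>z \<xi>. Re (a \<xi> * cis (\<xi> \<bullet> (x + z))) - Re (a \<xi> * cis (\<xi> \<bullet> x))
       - indicator (ball 0 1) z * (((- Im (a \<xi> * cis (\<xi> \<bullet> x))) *\<^sub>R \<xi>) \<bullet> z)"
  have "levy_op \<mu> (waves G a) (waves_grad G a) x = (LINT z|\<mu>. LINT \<xi>|G. ?F z \<xi>)"
    unfolding levy_op_def
  proof (intro Bochner_Integration.integral_cong refl)
    fix z
    show "waves G a (x + z) - waves G a x - indicator (ball 0 1) z * (waves_grad G a x \<bullet> z) = (LINT \<xi>|G. ?F z \<xi>)"
      unfolding waves_def waves_grad_def
      by (subst Bochner_Integration.integral_diff, intro Bochner_Integration.integrable_diff i,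
          intro integrable_mult_right integrable_inner_left i, subst Bochner_Integration.integral_diff, rule i, rule i,
          subst integral_mult_right_zero, subst integral_inner_left, rule i, rule refl)
  qed
  also have "\<dots> = (LINT \<xi>|G. LINT z|\<mu>. ?F z \<xi>)"
  proof (rule Fubini_product_bound(1)[where g="\<lambda>z. 2 * jump_weight z" and h="\<lambda>\<xi>. norm (a \<xi>) * (1 + (norm \<xi>)\<^sup>2)"])
    show "norm (?F z \<xi>) \<le> (2 * jump_weight z) * (norm (a \<xi>) * (1 + (norm \<xi>)\<^sup>2))" for z \<xi>
    proof (cases "norm z < 1")
      case True
      have "norm (?F z \<xi>) \<le> norm (a \<xi>) * (norm \<xi>)\<^sup>2 * (norm z)\<^sup>2"
        using wave_taylor[of "a \<xi>" \<xi> x z] True by simp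
      also have "\<dots> \<le> (norm (a \<xi>) * (1 + (norm \<xi>)\<^sup>2)) * (2 * jump_weight z)"
        using square_le_jump_weight[OF True] jump_weight_nonneg[of z] by (intro mult_mono) auto
      finally show ?thesis by (simp add: mult.commute)
    next
      case False
      then have 1: "jump_weight z = 1" by (intro jump_weight_large) simp
      have "norm (?F z \<xi>) \<le> norm (a \<xi>) + norm (a \<xi>)"
        using abs_Re_le_cmod[of "a \<xi> * cis (\<xi> \<bullet> (x + z))"] abs_Re_le_cmod[of "a \<xi> * cis (\<xi> \<bullet> x)"] False
        by (simp add: norm_mult)
      also have "\<dots> \<le> 2 * (norm (a \<xi>) * (1 + (norm \<xi>)\<^sup>2))" by (simp add: algebra_simps)
      finally show ?thesis using 1 by simp
    qed
  qed (use wc G.sigma_finite_measure_axioms sigma_finite_mu integrable_jump_weight in auto)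
  also have "\<dots> = waves G (\<lambda>\<xi>. - \<psi> \<xi> * a \<xi>) x"
    unfolding waves_def by (simp only: levy_wave)
  finally show "levy_op \<mu> (waves G a) (waves_grad G a) x = waves G (\<lambda>\<xi>. - \<psi> \<xi> * a \<xi>) x" .
qed

subsection \<open>The semigroup on bounded continuous functions\<close>

lemma P_integrable:
  assumes "0 < t" and "f \<in> borel_measurable borel" "\<And>y. \<bar>f y\<bar> \<le> (B::real)"
  shows "integrable (\<nu> t) (\<lambda>y. f (x - y))"
proof -
  interpret prob_space "\<nu> t" using assms(1) by (rule prob)
  note assms(2)[measurable]
  show ?thesis by (rule integrable_const_bound[of _ B]) (use assms(3) in auto)
qed

lemma integral_nu_bound:
  assumes t: "0 < t" and f: "integrable (\<nu> t) f" "\<And>y. \<bar>f y\<bar> \<le> (B::real)"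
  shows "\<bar>LINT y|\<nu> t. f y\<bar> \<le> B"
proof -
  interpret prob_space "\<nu> t" using t by (rule prob)
  have "\<bar>LINT y|\<nu> t. f y\<bar> \<le> (LINT y|\<nu> t. norm (f y))"
    unfolding real_norm_def[symmetric] by (rule integral_norm_bound)
  also have "\<dots> \<le> (LINT y|\<nu> t. B)"
    using f by (intro integral_mono) auto
  finally show ?thesis using prob_space by simp
qed

lemma P_bound:
  assumes "0 < t" and "f \<in> borel_measurable borel" "\<And>y. \<bar>f y\<bar> \<le> B"
  shows "\<bar>P t f x\<bar> \<le> B"
  unfolding P_def by (rule integral_nu_bound[OF assms(1) P_integrable[OF assms] assms(3)])

lemma P_diff:
  assumes "0 < t" and "f \<in> borel_measurable borel" "\<And>y. \<bar>f y\<bar> \<le> B"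
    and "h \<in> borel_measurable borel" "\<And>y. \<bar>h y\<bar> \<le> C"
  shows "P t f x - P t h x = P t (\<lambda>y. f y - h y) x"
  unfolding P_def
  by (rule Bochner_Integration.integral_diff[symmetric, OF P_integrable[OF assms(1-3)] P_integrable[OF assms(1,4,5)]])

lemma P_shift: "P t f (x + a) = P t (\<lambda>y. f (y + a)) x"
  by (simp add: P_def algebra_simps)

lemma P_continuous:
  assumes "0 < t" and f: "continuous_on UNIV f" "\<And>y. \<bar>f y\<bar> \<le> B"
  shows "continuous_on UNIV (P t f)"
proof -
  interpret prob_space "\<nu> t" using assms(1) by (rule prob)
  have [measurable]: "f \<in> borel_measurable borel" using f by (intro borel_measurable_continuous_onI)
  show ?thesis
    unfolding P_def[abs_def]
    by (rule continuous_on_lebesgue_integral[where h="\<lambda>_. B"])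
      (use f in \<open>auto intro!: continuous_on_compose2[OF f(1)] continuous_intros\<close>)
qed

lemma P_tendsto:
  assumes t: "0 < t" and f: "\<And>n::nat. f n \<in> borel_measurable borel" "\<And>n y. \<bar>f n y\<bar> \<le> B"
    and lim: "\<And>y. (\<lambda>n. f n y) \<longlonglongrightarrow> l y"
  shows "(\<lambda>n. P t (f n) x) \<longlonglongrightarrow> P t l x"
proof -
  interpret prob_space "\<nu> t" using t by (rule prob)
  note f(1)[measurable]
  have [measurable]: "l \<in> borel_measurable borel" using borel_measurable_LIMSEQ_real[OF lim f(1)] .
  show ?thesis
    unfolding P_def
    by (rule integral_dominated_convergence[where w="\<lambda>_. B"]) (use f lim in auto)
qed

lemma waves_measurable:
  assumes "finite_measure G" "sets G = sets borel" and [measurable]: "a \<in> borel_measurable borel"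
  shows "waves G a \<in> borel_measurable borel"
proof -
  interpret finite_measure G by fact
  note assms(2)[measurable_cong]
  show ?thesis unfolding waves_def[abs_def] by (intro borel_measurable_lebesgue_integral) measurable
qed

text \<open>On a superposition of waves both sides multiply the amplitude by \<open>exp (- (s + t) \<psi>)\<close>.\<close>

lemma P_add:
  assumes st: "0 < s" "0 < t" and f: "continuous_on UNIV f" "\<And>y. \<bar>f y\<bar> \<le> B"
  shows "P (s + t) f x = P s (P t f) x"
proof -
  from approximation_by_waves[OF f] obtain G a where Ga':
    "\<forall>n::nat. wave_class (G n) (a n)" "\<forall>n x. \<bar>waves (G n) (a n) x\<bar> \<le> B"
    "\<forall>x. (\<lambda>n. waves (G n) (a n) x) \<longlonglongrightarrow> f x"
    by (elim exE conjE) (rule that; assumption)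
  note Ga = Ga'(1)[rule_format] Ga'(2)[rule_format] Ga'(3)[rule_format]
  note w = wave_classD[OF Ga(1)]
  have meas: "waves (G n) (a n) \<in> borel_measurable borel" for n
    by (rule waves_measurable) (use w in auto)
  have eq: "P (s + t) (waves (G n) (a n)) x = P s (P t (waves (G n) (a n))) x" for n
  proof -
    note w(3)[measurable]
    have "P s (P t (waves (G n) (a n))) = P s (waves (G n) (\<lambda>\<xi>. a n \<xi> * exp (- of_real t * \<psi> \<xi>)))"
      by (simp only: P_waves[OF st(2) w(1,2,3,6)])
    also have "\<dots> = waves (G n) (\<lambda>\<xi>. a n \<xi> * exp (- of_real t * \<psi> \<xi>) * exp (- of_real s * \<psi> \<xi>))"
    proof (rule P_waves[OF st(1) w(1,2)])
      show "integrable (G n) (\<lambda>\<xi>. norm (a n \<xi> * exp (- of_real t * \<psi> \<xi>)))"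
      proof (rule Bochner_Integration.integrable_bound[OF w(6)])
        note w(2)[measurable_cong]
        show "(\<lambda>\<xi>. norm (a n \<xi> * exp (- of_real t * \<psi> \<xi>))) \<in> borel_measurable (G n)" by measurable
        show "AE \<xi> in G n. norm (norm (a n \<xi> * exp (- of_real t * \<psi> \<xi>))) \<le> norm (norm (a n \<xi>))"
          using norm_exp_symbol[of t] st by (intro AE_I2) (auto simp: norm_mult intro!: mult_left_le)
      qed
    qed measurable
    also have "\<dots> = P (s + t) (waves (G n) (a n))"
      unfolding P_waves[OF add_pos_pos[OF st] w(1,2,3,6)]
      by (simp add: mult.assoc exp_add[symmetric] algebra_simps)
    finally show ?thesis by simp
  qed
  have 1: "(\<lambda>n. P (s + t) (waves (G n) (a n)) x) \<longlonglongrightarrow> P (s + t) f x"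
    by (rule P_tendsto[OF add_pos_pos[OF st] meas Ga(2,3)])
  have 2: "(\<lambda>n. P t (waves (G n) (a n)) y) \<longlonglongrightarrow> P t f y" for y
    by (rule P_tendsto[OF st(2) meas Ga(2,3)])
  have 3: "P t (waves (G n) (a n)) \<in> borel_measurable borel" for n
  proof -
    obtain C where "jet 2 C (waves (G n) (a n)) (waves_grad (G n) (a n))" using waves_jet[OF Ga(1)] by blast
    from jetD(1,3)[OF this] show ?thesis
      by (intro borel_measurable_continuous_onI P_continuous[OF st(2)])
  qed
  have "(\<lambda>n. P s (P t (waves (G n) (a n))) x) \<longlonglongrightarrow> P s (P t f) x"
    by (rule P_tendsto[OF st(1) 3 P_bound[OF st(2) meas Ga(2)] 2])
  with 1 show ?thesis unfolding eq by (rule LIMSEQ_unique)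
qed

lemma integral_exp_decay:
  fixes c z :: complex
  assumes "0 < h"
  shows "(LINT s:{0<..<h}|lborel. Re (- z * c * exp (- of_real s * z))) = Re (c * (exp (- of_real h * z) - 1))"
proof -
  have "(LBINT s=0..h. Re (- z * c * exp (- of_real s * z))) = Re (c * exp (- of_real h * z)) - Re (c * exp (- of_real 0 * z))"
    unfolding zero_ereal_def
  proof (rule interval_integral_FTC_finite)
    show "continuous_on {min 0 h..max 0 h} (\<lambda>s. Re (- z * c * exp (- of_real s * z)))"
      by (intro continuous_intros)
    fix s
    have "((\<lambda>s. c * exp (- of_real s * z)) has_vector_derivative (c * (exp (- of_real s * z) * (- z)))) (at s within {min 0 h..max 0 h})"
      by (auto intro!: derivative_eq_intros has_vector_derivative_real_field simp: scaleR_conv_of_real)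
    from bounded_linear.has_vector_derivative[OF bounded_linear_Re this]
    show "((\<lambda>s. Re (c * exp (- of_real s * z))) has_vector_derivative Re (- z * c * exp (- of_real s * z))) (at s within {min 0 h..max 0 h})"
      by (simp add: algebra_simps)
  qed
  then show ?thesis using assms by (simp add: interval_integral_Ioo zero_ereal_def algebra_simps)
qed

text \<open>Dynkin's formula. It holds for superpositions of waves by the fundamental theorem of calculus
  in time, and it survives bounded pointwise limits of jets.\<close>

lemma generator_waves:
  assumes h: "0 < h" and w: "wave_class G a"
  defines "\<phi> \<equiv> waves G a" and "V \<equiv> waves_grad G a"
  shows "(\<lambda>s. indicator {0<..<h} s * P s (levy_op \<mu> \<phi> V) x) \<in> borel_measurable lborel"
    and "P h \<phi> x - \<phi> x = (LINT s|lborel. indicator {0<..<h} s * P s (levy_op \<mu> \<phi> V) x)"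
proof -
  note wc = wave_classD[OF w]
  note wc(2)[measurable_cong] wc(3)[measurable]
  interpret G: finite_measure G by (rule wc)
  have C: "2 * jump_mass \<ge> 0" using jump_mass_nonneg by simp
  have intC: "integrable G (\<lambda>\<xi>. norm (- \<psi> \<xi> * a \<xi>))"
  proof (rule Bochner_Integration.integrable_bound)
    show "integrable G (\<lambda>\<xi>. 2 * jump_mass * (norm (a \<xi>) * (1 + (norm \<xi>)\<^sup>2)))"
      using wc by simp
    have "norm (\<psi> \<xi>) * norm (a \<xi>) \<le> (2 * jump_mass * (1 + (norm \<xi>)\<^sup>2)) * norm (a \<xi>)" for \<xi>
      by (intro mult_right_mono symbol_bound) auto
    then show "AE \<xi> in G. norm (norm (- \<psi> \<xi> * a \<xi>)) \<le> norm (2 * jump_mass * (norm (a \<xi>) * (1 + (norm \<xi>)\<^sup>2)))"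
      using C jump_mass_nonneg by (intro AE_I2) (auto simp: norm_mult abs_mult algebra_simps)
  qed measurable
  have L: "levy_op \<mu> \<phi> V = waves G (\<lambda>\<xi>. - \<psi> \<xi> * a \<xi>)" unfolding \<phi>_def V_def by (rule levy_waves[OF w])
  have PL: "P s (levy_op \<mu> \<phi> V) = waves G (\<lambda>\<xi>. - \<psi> \<xi> * a \<xi> * exp (- of_real s * \<psi> \<xi>))" if "0 < s" for s
    unfolding L by (rule P_waves[OF that wc(1,2) _ intC]) measurable
  let ?F = "\<lambda>s \<xi>. indicator {0<..<h} s * Re (- \<psi> \<xi> * a \<xi> * exp (- of_real s * \<psi> \<xi>) * cis (\<xi> \<bullet> x))"
  have F: "indicator {0<..<h} s * P s (levy_op \<mu> \<phi> V) x = (LINT \<xi>|G. ?F s \<xi>)" for s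
    by (cases "s \<in> {0<..<h}") (auto simp: PL waves_def)
  have Fm: "(\<lambda>(s, \<xi>). ?F s \<xi>) \<in> borel_measurable (lborel \<Otimes>\<^sub>M G)" by measurable
  show "(\<lambda>s. indicator {0<..<h} s * P s (levy_op \<mu> \<phi> V) x) \<in> borel_measurable lborel"
    unfolding F using Fm by (rule G.borel_measurable_lebesgue_integral)
  have "(LINT s|lborel. indicator {0<..<h} s * P s (levy_op \<mu> \<phi> V) x) = (LINT s|lborel. LINT \<xi>|G. ?F s \<xi>)"
    by (simp only: F)
  also have "\<dots> = (LINT \<xi>|G. LINT s|lborel. ?F s \<xi>)"
  proof (rule Fubini_product_bound(1)[where g="\<lambda>s. indicator {0<..<h} s" and h="\<lambda>\<xi>. norm (- \<psi> \<xi> * a \<xi>)", OF _ _ Fm _ intC])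
    show "integrable lborel (indicator {0<..<h} :: real \<Rightarrow> real)" using h by simp
    show "norm (?F s \<xi>) \<le> indicator {0<..<h} s * norm (- \<psi> \<xi> * a \<xi>)" for s \<xi>
    proof (cases "s \<in> {0<..<h}")
      case True
      have "norm (?F s \<xi>) \<le> norm (- \<psi> \<xi> * a \<xi> * exp (- of_real s * \<psi> \<xi>) * cis (\<xi> \<bullet> x))"
        using True abs_Re_le_cmod[of "- \<psi> \<xi> * a \<xi> * exp (- of_real s * \<psi> \<xi>) * cis (\<xi> \<bullet> x)"] by simp
      also have "\<dots> = norm (- \<psi> \<xi> * a \<xi>) * norm (exp (- of_real s * \<psi> \<xi>))" by (simp only: norm_mult norm_cis mult_1_right)
      also have "\<dots> \<le> norm (- \<psi> \<xi> * a \<xi>)" using True norm_exp_symbol[of s \<xi>] by (intro mult_left_le) auto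
      finally show ?thesis using True by simp
    qed simp
  qed (use G.sigma_finite_measure_axioms sigma_finite_lborel in auto)
  also have "\<dots> = (LINT \<xi>|G. Re (a \<xi> * exp (- of_real h * \<psi> \<xi>) * cis (\<xi> \<bullet> x)) - Re (a \<xi> * cis (\<xi> \<bullet> x)))"
  proof (intro Bochner_Integration.integral_cong refl)
    fix \<xi>
    have "(LINT s|lborel. ?F s \<xi>) = (LINT s:{0<..<h}|lborel. Re (- \<psi> \<xi> * (a \<xi> * cis (\<xi> \<bullet> x)) * exp (- of_real s * \<psi> \<xi>)))"
      unfolding set_lebesgue_integral_def by (simp only: real_scaleR_def mult_ac)
    also have "\<dots> = Re (a \<xi> * cis (\<xi> \<bullet> x) * (exp (- of_real h * \<psi> \<xi>) - 1))"
      by (rule integral_exp_decay[OF h])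
    finally show "(LINT s|lborel. ?F s \<xi>) = Re (a \<xi> * exp (- of_real h * \<psi> \<xi>) * cis (\<xi> \<bullet> x)) - Re (a \<xi> * cis (\<xi> \<bullet> x))"
      by (simp add: algebra_simps)
  qed
  also have "\<dots> = P h \<phi> x - \<phi> x"
  proof -
    have "integrable G (\<lambda>\<xi>. a \<xi> * exp (- of_real h * \<psi> \<xi>) * cis (\<xi> \<bullet> x))"
    proof (rule Bochner_Integration.integrable_bound[OF wc(6)])
      show "AE \<xi> in G. norm (a \<xi> * exp (- of_real h * \<psi> \<xi>) * cis (\<xi> \<bullet> x)) \<le> norm (norm (a \<xi>))"
        using norm_exp_symbol[of h] h by (intro AE_I2) (auto simp: norm_mult intro!: mult_left_le)
    qed measurable
    then have "integrable G (\<lambda>\<xi>. Re (a \<xi> * exp (- of_real h * \<psi> \<xi>) * cis (\<xi> \<bullet> x)))" by (rule integrable_Re)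
    then show ?thesis
      unfolding \<phi>_def P_waves[OF h wc(1,2,3,6)] unfolding waves_def
      by (rule Bochner_Integration.integral_diff) (rule wave_integrable[OF w])
  qed
  finally show "P h \<phi> x - \<phi> x = (LINT s|lborel. indicator {0<..<h} s * P s (levy_op \<mu> \<phi> V) x)" ..
qed

lemma generator_formula:
  assumes h: "0 < h" and j: "jet g B \<phi> V"
  shows "integrable lborel (\<lambda>s. indicator {0<..<h} s * P s (levy_op \<mu> \<phi> V) x)"
    and "P h \<phi> x - \<phi> x = (LINT s|lborel. indicator {0<..<h} s * P s (levy_op \<mu> \<phi> V) x)"
proof -
  from jet_approximation_by_waves[OF j g] obtain G a K where Ga':
    "\<forall>n::nat. wave_class (G n) (a n)" "\<forall>n. jet g K (waves (G n) (a n)) (waves_grad (G n) (a n))"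
    "\<forall>x. (\<lambda>n. waves (G n) (a n) x) \<longlonglongrightarrow> \<phi> x"
    "\<forall>x. (\<lambda>n. waves_grad (G n) (a n) x) \<longlonglongrightarrow> V x"
    by (elim exE conjE) (rule that; assumption)
  note Ga = Ga'(1)[rule_format] Ga'(2)[rule_format] Ga'(3)[rule_format] Ga'(4)[rule_format]
  define L where "L n = levy_op \<mu> (waves (G n) (a n)) (waves_grad (G n) (a n))" for n
  have Lb: "\<bar>L n y\<bar> \<le> 2 * K * jump_mass" for n y unfolding L_def by (rule levy_op_bound[OF Ga(2)])
  have Lm: "L n \<in> borel_measurable borel" for n unfolding L_def by (rule levy_op_measurable[OF Ga(2)])
  have Ll: "(\<lambda>n. L n y) \<longlonglongrightarrow> levy_op \<mu> \<phi> V y" for y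
    unfolding L_def by (rule levy_op_tendsto[OF Ga(2) j Ga(3,4)])
  let ?F = "\<lambda>n s. indicator {0<..<h} s * P s (L n) x" and ?f = "\<lambda>s. indicator {0<..<h} s * P s (levy_op \<mu> \<phi> V) x"
  let ?w = "\<lambda>s. indicator {0<..<h} s * (2 * K * jump_mass)"
  have Fm: "?F n \<in> borel_measurable lborel" for n unfolding L_def by (rule generator_waves[OF h Ga(1)])
  have lim: "(\<lambda>n. ?F n s) \<longlonglongrightarrow> ?f s" for s
    by (cases "0 < s") (auto intro!: tendsto_intros P_tendsto[OF _ Lm Lb Ll])
  have fm: "?f \<in> borel_measurable lborel" using lim Fm by (rule borel_measurable_LIMSEQ_real)
  have wi: "integrable lborel ?w" using h by (intro integrable_mult_left) simp
  have bd: "norm (?F n s) \<le> ?w s" for n s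
    using P_bound[OF _ Lm Lb, of s n x] by (auto simp: indicator_def)
  have dct: "integrable lborel ?f" "(\<lambda>n. LINT s|lborel. ?F n s) \<longlonglongrightarrow> (LINT s|lborel. ?f s)"
    by (rule integrable_dominated_convergence[OF fm Fm wi AE_I2[OF lim] AE_I2[OF bd]])
      (rule integral_dominated_convergence[OF fm Fm wi AE_I2[OF lim] AE_I2[OF bd]])
  show "integrable lborel ?f" by (rule dct)
  have "(\<lambda>n. P h (waves (G n) (a n)) x - waves (G n) (a n) x) \<longlonglongrightarrow> P h \<phi> x - \<phi> x"
    using jetD[OF Ga(2)] by (intro tendsto_intros Ga P_tendsto[OF h]) auto
  then have "(\<lambda>n. LINT s|lborel. ?F n s) \<longlonglongrightarrow> P h \<phi> x - \<phi> x"
    unfolding L_def generator_waves(2)[OF h Ga(1)] .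
  with dct(2) show "P h \<phi> x - \<phi> x = (LINT s|lborel. ?f s)" by (rule LIMSEQ_unique[symmetric])
qed

lemma bump_abs: "\<bar>bump y\<bar> \<le> 1" "\<bar>1 - bump y\<bar> \<le> 1"
  using bump_bounds[of y] by auto

subsection \<open>Strong continuity on Hoelder functions\<close>

lemma norm_one_minus_exp_le:
  fixes z :: complex
  assumes "0 \<le> Re z"
  shows "norm (1 - exp (- z)) \<le> norm z"
proof -
  have "norm (exp 0 - exp (- z)) \<le> 1 * norm (0 - (- z))"
  proof (rule field_differentiable_bound[where S="{w. Re w \<le> 0}" and f'=exp])
    show "convex {w. Re w \<le> 0}" by (rule convex_halfspace_Re_le)
    show "(exp has_field_derivative exp w) (at w within {w. Re w \<le> 0})" for w :: complex
      by (auto intro!: derivative_eq_intros)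
  qed (use assms in auto)
  then show ?thesis by simp
qed

text \<open>A truncated moment of the heat kernel. It bounds the modulus of continuity at time zero of the
  semigroup, uniformly over bounded sets of Hoelder functions.\<close>

definition spread :: "real \<Rightarrow> real \<Rightarrow> real" where
  "spread b t = (LINT y|\<nu> t. min 2 (norm y powr b))"

lemma spread_integrable: "0 < t \<Longrightarrow> integrable (\<nu> t) (\<lambda>y. min 2 (norm y powr b))"
proof -
  assume "0 < t"
  then interpret prob_space "\<nu> t" by (rule prob)
  show ?thesis by (rule integrable_const_bound[of _ 2]) auto
qed

lemma spread_nonneg: "0 \<le> spread b t"
  unfolding spread_def by (intro integral_nonneg_AE) auto

lemma P_modulus:
  assumes t: "0 < t" and f: "f \<in> borel_measurable borel" "\<And>y. \<bar>f y\<bar> \<le> B"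
    and hol: "\<And>x y. \<bar>f x - f y\<bar> \<le> B * norm (x - y) powr b"
  shows "\<bar>P t f x - f x\<bar> \<le> B * spread b t"
proof -
  interpret prob_space "\<nu> t" using t by (rule prob)
  have i: "integrable (\<nu> t) (\<lambda>y. f (x - y))" by (rule P_integrable[OF t f])
  have "P t f x - f x = (LINT y|\<nu> t. f (x - y) - f x)"
    unfolding P_def using i prob_space by simp
  also have "\<bar>\<dots>\<bar> \<le> (LINT y|\<nu> t. norm (f (x - y) - f x))"
    unfolding real_norm_def[symmetric] by (rule integral_norm_bound)
  also have "\<dots> \<le> (LINT y|\<nu> t. B * min 2 (norm y powr b))"
  proof (rule integral_mono)
    show "integrable (\<nu> t) (\<lambda>y. norm (f (x - y) - f x))" using i by simp
    show "integrable (\<nu> t) (\<lambda>y. B * min 2 (norm y powr b))" using spread_integrable[OF t] by simp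
    fix y
    have "\<bar>f (x - y) - f x\<bar> \<le> B * norm y powr b" using hol[of "x - y" x] by simp
    moreover have "\<bar>f (x - y) - f x\<bar> \<le> B * 2" using f(2)[of "x - y"] f(2)[of x] by linarith
    ultimately show "norm (f (x - y) - f x) \<le> B * min 2 (norm y powr b)" by (simp add: min_def)
  qed
  finally show ?thesis by (simp add: spread_def)
qed

text \<open>The mass that the heat kernel places away from the origin is controlled by its pairing with
  \<open>1 - bump\<close>, and this is an explicit average of \<open>1 - exp (- t \<psi>)\<close>.\<close>

lemma bump_defect:
  assumes t: "0 < t"
  shows "(LINT y|\<nu> t. 1 - bump y) \<le> t * (LINT \<xi>|gauss. norm (\<psi> \<xi>))"
proof -
  interpret prob_space "\<nu> t" using t by (rule prob)
  interpret G: prob_space "gauss :: 'a measure" by (rule prob_space_gauss)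
  note w = wave_classD[OF gauss_wave_class, where 'a='a]
  have ib: "integrable (\<nu> t) bump"
    by (rule integrable_const_bound[of _ 1]) (auto simp: bump_abs)
  have ie: "integrable gauss (\<lambda>\<xi>. exp (- of_real t * \<psi> \<xi>))"
    by (rule G.integrable_const_bound[of _ 1]) (use norm_exp_symbol t in auto)
  have ip: "integrable gauss (\<lambda>\<xi>. norm (\<psi> \<xi>))"
  proof (rule Bochner_Integration.integrable_bound)
    show "integrable gauss (\<lambda>\<xi>::'a. 2 * jump_mass * (1 + (norm \<xi>)\<^sup>2))"
      using gauss_norm_square_integrable by (intro integrable_mult_right Bochner_Integration.integrable_add) auto
    show "AE \<xi> in gauss. norm (norm (\<psi> \<xi>)) \<le> norm (2 * jump_mass * (1 + (norm \<xi>)\<^sup>2))"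
      using symbol_bound by (intro AE_I2) (auto intro: order_trans[OF _ abs_ge_self])
  qed simp
  have "(LINT y|\<nu> t. 1 - bump y) = 1 - P t bump 0"
  proof -
    have "bump (0 - y) = bump y" for y :: 'a by (simp add: bump_def)
    then have "P t bump 0 = (LINT y|\<nu> t. bump y)" unfolding P_def by presburger
    then show ?thesis using ib prob_space by simp
  qed
  also have "P t bump 0 = (LINT \<xi>|gauss. Re (exp (- of_real t * \<psi> \<xi>)))"
    unfolding bump_eq_waves P_waves[OF t w(1,2,3,6)] unfolding waves_def by simp
  also have "1 - \<dots> = (LINT \<xi>|gauss. 1 - Re (exp (- of_real t * \<psi> \<xi>)))"
    using integrable_Re[OF ie] G.prob_space by (subst Bochner_Integration.integral_diff) auto
  also have "\<dots> \<le> (LINT \<xi>|gauss. t * norm (\<psi> \<xi>))"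
  proof (rule integral_mono)
    show "integrable gauss (\<lambda>\<xi>. 1 - Re (exp (- of_real t * \<psi> \<xi>)))"
      by (intro Bochner_Integration.integrable_diff integrable_Re[OF ie]) simp
    show "integrable gauss (\<lambda>\<xi>. t * norm (\<psi> \<xi>))" using ip by simp
    fix \<xi>
    have "1 - Re (exp (- of_real t * \<psi> \<xi>)) = Re (1 - exp (- (of_real t * \<psi> \<xi>)))" by simp
    also have "\<dots> \<le> norm (1 - exp (- (of_real t * \<psi> \<xi>)))" by (rule complex_Re_le_cmod)
    also have "\<dots> \<le> norm (of_real t * \<psi> \<xi>)"
      using symbol_Re_nonneg[of \<xi>] t by (intro norm_one_minus_exp_le) simp
    finally show "1 - Re (exp (- of_real t * \<psi> \<xi>)) \<le> t * norm (\<psi> \<xi>)" using t by (simp add: norm_mult)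
  qed
  finally show ?thesis by simp
qed

text \<open>Split at the radius \<open>r\<close> where \<open>|y|\<^sup>b\<close> reaches \<open>e/2\<close>. Outside this ball \<open>1 - bump\<close> is bounded
  below, so the mass there is of order \<open>t\<close>.\<close>

lemma spread_tendsto_0:
  assumes b: "0 < b"
  shows "(spread b \<longlongrightarrow> 0) (at_right 0)"
proof (rule order_tendstoI)
  fix e :: real assume e: "0 < e"
  define r where "r = (e / 2) powr (1 / b)"
  have r: "r > 0" "r powr b = e / 2" using e b by (auto simp: r_def powr_powr)
  define q where "q = 1 - exp (- r\<^sup>2 / 2)"
  have q: "q > 0" using r by (simp add: q_def)
  define C where "C = (LINT \<xi>|gauss. norm (\<psi> (\<xi>::'a)))"
  have C: "C \<ge> 0" by (simp add: C_def)
  have main: "spread b t \<le> e / 2 + 2 / q * (t * C)" if t: "0 < t" for t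
  proof -
    interpret prob_space "\<nu> t" using t by (rule prob)
    have ib: "integrable (\<nu> t) (\<lambda>y. 1 - bump y)"
      by (rule integrable_const_bound[of _ 1]) (auto simp: bump_abs)
    have "spread b t \<le> (LINT y|\<nu> t. e / 2 + 2 / q * (1 - bump y))"
      unfolding spread_def
    proof (rule integral_mono[OF spread_integrable[OF t]])
      show "integrable (\<nu> t) (\<lambda>y. e / 2 + 2 / q * (1 - bump y))"
        by (intro Bochner_Integration.integrable_add integrable_mult_right ib) simp
      fix y :: 'a
      show "min 2 (norm y powr b) \<le> e / 2 + 2 / q * (1 - bump y)"
      proof (cases "norm y \<le> r")
        case True
        then have "norm y powr b \<le> e / 2" using b r(2) powr_mono2[of b "norm y" r] by simp
        moreover have "0 \<le> 2 / q * (1 - bump y)" using q bump_bounds[of y] by simp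
        ultimately show ?thesis by linarith
      next
        case False
        then have "r\<^sup>2 \<le> (norm y)\<^sup>2" using r by (intro power_mono) auto
        then have "q \<le> 1 - bump y" by (simp add: q_def bump_def)
        then have "2 / q * q \<le> 2 / q * (1 - bump y)" using q by (intro mult_left_mono) auto
        then show ?thesis using q e by simp
      qed
    qed
    also have "\<dots> = e / 2 + 2 / q * (LINT y|\<nu> t. 1 - bump y)"
    proof -
      have "(LINT y|\<nu> t. e / 2 + 2 / q * (1 - bump y)) = (LINT y|\<nu> t. e / 2) + (LINT y|\<nu> t. 2 / q * (1 - bump y))"
        by (intro Bochner_Integration.integral_add integrable_mult_right ib) simp
      moreover have "(LINT y|\<nu> t. e / 2) = e / 2" using prob_space by simp
      ultimately show ?thesis by (simp only: integral_mult_right_zero)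
    qed
    also have "\<dots> \<le> e / 2 + 2 / q * (t * C)"
      using bump_defect[OF t] q unfolding C_def by (intro add_left_mono mult_left_mono) auto
    finally show ?thesis .
  qed
  have "((\<lambda>t. e / 2 + 2 / q * (t * C)) \<longlongrightarrow> e / 2 + 2 / q * (0 * C)) (at_right 0)"
    by (intro tendsto_intros)
  then have "\<forall>\<^sub>F t in at_right 0. e / 2 + 2 / q * (t * C) < e"
    by (rule order_tendstoD) (use e in simp)
  moreover have "\<forall>\<^sub>F t in at_right 0. 0 < (t::real)" by (simp add: eventually_at_right_less)
  ultimately show "\<forall>\<^sub>F t in at_right 0. spread b t < e"
    by eventually_elim (use main in force)
qed (use spread_nonneg in \<open>auto intro!: always_eventually intro: less_le_trans\<close>)

end

section \<open>Hoelder estimates for first-order remainders\<close>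

lemma increment_bound:
  fixes f :: "'a::real_normed_vector \<Rightarrow> 'b::real_normed_vector"
  assumes d: "\<And>x. (f has_derivative f' x) (at x)" and K: "0 \<le> K"
    and b: "\<And>t h. 0 \<le> t \<Longrightarrow> t \<le> 1 \<Longrightarrow> norm (f' (x + t *\<^sub>R y) h) \<le> K * norm h"
  shows "norm (f (x + y) - f x) \<le> K * norm y"
proof -
  have "norm (f (x + y) - f x) \<le> norm y * K"
  proof (rule differentiable_bound_segment[where G=UNIV and f'=f'])
    show "(f has_derivative f' x) (at x within UNIV)" for x using d by simp
    show "onorm (f' (x + t *\<^sub>R y)) \<le> K" if "t \<in> {0..1}" for t
      using b that K by (intro onorm_bound) auto
  qed auto
  then show ?thesis by (simp add: mult.commute)
qed

lemma has_derivative_shift: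
  assumes "(f has_derivative F) (at (a + v))"
  shows "((\<lambda>v. f (a + v)) has_derivative F) (at v)" "((\<lambda>v. f (v + a)) has_derivative F) (at v)"
proof -
  have "((\<lambda>v. a + v) has_derivative (\<lambda>h. h)) (at v)" by (auto intro!: derivative_eq_intros)
  from has_derivative_compose[OF this assms] show "((\<lambda>v. f (a + v)) has_derivative F) (at v)" .
  then show "((\<lambda>v. f (v + a)) has_derivative F) (at v)" by (simp add: add.commute)
qed

text \<open>Functions of class \<open>C\<^sup>\<gamma>\<close> for \<open>1 < \<gamma> < 3\<close>, \<open>\<gamma> \<noteq> 2\<close>, with gradient \<open>V\<close> and, if \<open>\<gamma> > 2\<close>,
  with second derivative \<open>W\<close>.\<close>

definition holder_class :: "real \<Rightarrow> real \<Rightarrow> ('a::euclidean_space \<Rightarrow> real) \<Rightarrow> ('a \<Rightarrow> 'a) \<Rightarrow> ('a \<Rightarrow> 'a \<Rightarrow>\<^sub>L 'a) \<Rightarrow> bool" where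
  "holder_class \<gamma> B \<phi> V W \<longleftrightarrow>
     (\<forall>x. (\<phi> has_derivative (\<lambda>h. V x \<bullet> h)) (at x)) \<and> (\<forall>x. \<bar>\<phi> x\<bar> \<le> B) \<and> (\<forall>x. norm (V x) \<le> B) \<and>
     (\<gamma> < 2 \<longrightarrow> (\<forall>x y. norm (V x - V y) \<le> B * norm (x - y) powr (\<gamma> - 1))) \<and>
     (2 < \<gamma> \<longrightarrow> (\<forall>x. (V has_derivative blinfun_apply (W x)) (at x)) \<and> (\<forall>x. norm (W x) \<le> B) \<and>
        (\<forall>x y. norm (W x - W y) \<le> B * norm (x - y) powr (\<gamma> - 2)))"

lemma holder_classD:
  assumes "holder_class \<gamma> B \<phi> V W"
  shows "(\<phi> has_derivative (\<lambda>h. V x \<bullet> h)) (at x)" "\<bar>\<phi> x\<bar> \<le> B" "norm (V x) \<le> B" "0 \<le> B"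
    "\<gamma> < 2 \<Longrightarrow> norm (V x - V y) \<le> B * norm (x - y) powr (\<gamma> - 1)"
    "2 < \<gamma> \<Longrightarrow> (V has_derivative blinfun_apply (W x)) (at x)"
    "2 < \<gamma> \<Longrightarrow> norm (W x) \<le> B"
    "2 < \<gamma> \<Longrightarrow> norm (W x - W y) \<le> B * norm (x - y) powr (\<gamma> - 2)"
    "continuous_on UNIV \<phi>"
proof -
  note a = assms[unfolded holder_class_def]
  show d: "(\<phi> has_derivative (\<lambda>h. V x \<bullet> h)) (at x)" for x using a by simp
  show "continuous_on UNIV \<phi>"
    by (intro continuous_at_imp_continuous_on ballI has_derivative_continuous[OF d])
  show "\<bar>\<phi> x\<bar> \<le> B" "norm (V x) \<le> B" using a by auto
  then show "0 \<le> B" using norm_ge_zero[of "V x"] by linarith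
qed (use assms in \<open>auto simp: holder_class_def\<close>)

lemma holder_class_mono:
  assumes "holder_class \<gamma> B \<phi> V W" "B \<le> B'"
  shows "holder_class \<gamma> B' \<phi> V W"
proof -
  have le: "s \<le> B' * u powr a" if "s \<le> B * u powr a" for s u a :: real
    using mult_right_mono[OF assms(2), of "u powr a"] that by simp
  have le2: "s \<le> B'" if "s \<le> B" for s using that assms(2) by simp
  show ?thesis
    unfolding holder_class_def
    using holder_classD[OF assms(1)] assms(2) by (auto intro: le le2)
qed

lemma holder_class_diff:
  assumes "holder_class \<gamma> B \<phi> V W" "holder_class \<gamma> C \<phi>' V' W'"
  shows "holder_class \<gamma> (B + C) (\<lambda>x. \<phi> x - \<phi>' x) (\<lambda>x. V x - V' x) (\<lambda>x. W x - W' x)"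
  unfolding holder_class_def
proof (intro conjI allI impI)
  note a = holder_classD[OF assms(1)] and b = holder_classD[OF assms(2)]
  show "((\<lambda>x. \<phi> x - \<phi>' x) has_derivative (\<lambda>h. (V x - V' x) \<bullet> h)) (at x)" for x
    unfolding inner_diff_left by (intro has_derivative_diff a b)
  show "\<bar>\<phi> x - \<phi>' x\<bar> \<le> B + C" for x using a(2)[of x] b(2)[of x] by linarith
  show "norm (V x - V' x) \<le> B + C" for x
    using norm_triangle_ineq4[of "V x" "V' x"] a(3)[of x] b(3)[of x] by linarith
  show "norm (V x - V' x - (V y - V' y)) \<le> (B + C) * norm (x - y) powr (\<gamma> - 1)" if "\<gamma> < 2" for x y
  proof -
    have "V x - V' x - (V y - V' y) = (V x - V y) - (V' x - V' y)" by simp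
    then show ?thesis
      using norm_triangle_ineq4[of "V x - V y" "V' x - V' y"] a(5)[OF that, of x y] b(5)[OF that, of x y]
      by (simp add: algebra_simps)
  qed
  assume g: "2 < \<gamma>"
  show "((\<lambda>x. V x - V' x) has_derivative blinfun_apply (W x - W' x)) (at x)" for x
    unfolding minus_blinfun.rep_eq by (intro has_derivative_diff a b g)
  show "norm (W x - W' x) \<le> B + C" for x
    using norm_triangle_ineq4[of "W x" "W' x"] a(7)[OF g, of x] b(7)[OF g, of x] by linarith
  show "norm (W x - W' x - (W y - W' y)) \<le> (B + C) * norm (x - y) powr (\<gamma> - 2)" for x y
  proof -
    have "W x - W' x - (W y - W' y) = (W x - W y) - (W' x - W' y)" by simp
    then show ?thesis
      using norm_triangle_ineq4[of "W x - W y" "W' x - W' y"] a(8)[OF g, of x y] b(8)[OF g, of x y]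
      by (simp add: algebra_simps)
  qed
qed

text \<open>This is the mean value inequality for \<open>\<phi>\<close> minus the linear map \<open>x \<mapsto> v \<bullet> x\<close>.\<close>

lemma remainder_bound:
  fixes \<phi> :: "'a::euclidean_space \<Rightarrow> real"
  assumes d: "\<And>x. (\<phi> has_derivative (\<lambda>h. V x \<bullet> h)) (at x)"
    and b: "\<And>t. 0 \<le> t \<Longrightarrow> t \<le> 1 \<Longrightarrow> norm (V (x + t *\<^sub>R y) - v) \<le> K"
  shows "\<bar>\<phi> (x + y) - \<phi> x - v \<bullet> y\<bar> \<le> K * norm y"
proof -
  have "norm ((\<phi> (x + y) - v \<bullet> (x + y)) - (\<phi> x - v \<bullet> x)) \<le> K * norm y"
  proof (rule increment_bound)
    show "0 \<le> K" using norm_ge_zero[of "V (x + 0 *\<^sub>R y) - v"] b[of 0] by linarith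
    show "((\<lambda>x. \<phi> x - v \<bullet> x) has_derivative (\<lambda>h. (V x - v) \<bullet> h)) (at x)" for x
      unfolding inner_diff_left by (intro has_derivative_diff d derivative_intros)
    fix t h assume t: "0 \<le> t" "t \<le> (1::real)"
    have "norm ((V (x + t *\<^sub>R y) - v) \<bullet> h) \<le> norm (V (x + t *\<^sub>R y) - v) * norm h"
      by (rule Cauchy_Schwarz_ineq2[folded real_norm_def])
    also have "\<dots> \<le> K * norm h" using b[OF t] by (intro mult_right_mono) auto
    finally show "norm ((V (x + t *\<^sub>R y) - v) \<bullet> h) \<le> K * norm h" .
  qed
  then show ?thesis by (simp add: inner_add_right algebra_simps)
qed

lemma blinfun_increment_bound:
  fixes V :: "'a::euclidean_space \<Rightarrow> 'a"
  assumes d: "\<And>x. (V has_derivative blinfun_apply (W x)) (at x)"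
    and b: "\<And>t. 0 \<le> t \<Longrightarrow> t \<le> 1 \<Longrightarrow> norm (W (x + t *\<^sub>R y)) \<le> K"
  shows "norm (V (x + y) - V x) \<le> K * norm y"
proof (rule increment_bound[OF d])
  show "0 \<le> K" using norm_ge_zero[of "W (x + 0 *\<^sub>R y)"] b[of 0] by linarith
  fix t h assume t: "0 \<le> t" "t \<le> (1::real)"
  show "norm (W (x + t *\<^sub>R y) h) \<le> K * norm h"
    using b[OF t] by (intro order_trans[OF norm_blinfun] mult_right_mono) auto
qed

lemma powr_minus_one_mult: "0 \<le> (s::real) \<Longrightarrow> s powr (a - 1) * s = s powr a"
  by (cases "s = 0") (auto simp: powr_diff)

lemma powr_scaled_le:
  assumes "0 \<le> t" "t \<le> (1::real)" "0 \<le> a"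
  shows "norm (t *\<^sub>R y) powr a \<le> norm y powr a"
  using assms by (intro powr_mono2) (auto intro: mult_left_le_one_le)

lemma holder_taylor:
  assumes \<phi>: "holder_class \<gamma> B \<phi> V W" and \<gamma>: "1 < \<gamma>" "\<gamma> \<noteq> 2"
  shows "\<bar>\<phi> (x + y) - \<phi> x - V x \<bullet> y\<bar> \<le> B * norm y powr min \<gamma> 2"
proof (cases "\<gamma> < 2")
  case True
  note h = holder_classD[OF \<phi>]
  have "\<bar>\<phi> (x + y) - \<phi> x - V x \<bullet> y\<bar> \<le> (B * norm y powr (\<gamma> - 1)) * norm y"
  proof (rule remainder_bound[OF h(1)])
    fix t :: real assume t: "0 \<le> t" "t \<le> 1"
    have "norm (V (x + t *\<^sub>R y) - V x) \<le> B * norm (t *\<^sub>R y) powr (\<gamma> - 1)"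
      using h(5)[OF True, of "x + t *\<^sub>R y" x] by simp
    also have "\<dots> \<le> B * norm y powr (\<gamma> - 1)"
      using t h(4) \<gamma> by (intro mult_left_mono powr_scaled_le) auto
    finally show "norm (V (x + t *\<^sub>R y) - V x) \<le> B * norm y powr (\<gamma> - 1)" .
  qed
  then show ?thesis using True by (simp add: powr_minus_one_mult mult.assoc)
next
  case False
  then have g: "2 < \<gamma>" using \<gamma> by simp
  note h = holder_classD[OF \<phi>]
  have "\<bar>\<phi> (x + y) - \<phi> x - V x \<bullet> y\<bar> \<le> (B * norm y) * norm y"
  proof (rule remainder_bound[OF h(1)])
    fix t :: real assume t: "0 \<le> t" "t \<le> 1"
    have "norm (V (x + t *\<^sub>R y) - V x) \<le> B * norm (t *\<^sub>R y)"
      by (rule blinfun_increment_bound[OF h(6)[OF g] h(7)[OF g]])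
    also have "\<dots> \<le> B * norm y" using t h(4) by (intro mult_left_mono) (auto intro: mult_left_le_one_le)
    finally show "norm (V (x + t *\<^sub>R y) - V x) \<le> B * norm y" .
  qed
  then show ?thesis using g by (simp add: powr_numeral power2_eq_square min_def mult.assoc)
qed

lemma holder_gradient:
  assumes \<phi>: "holder_class \<gamma> B \<phi> V W" and \<gamma>: "1 < \<gamma>" "\<gamma> \<noteq> 2" and b: "0 \<le> b" "b \<le> 1" "b \<le> \<gamma> - 1"
  shows "norm (V x - V y) \<le> 2 * B * norm (x - y) powr b"
proof (cases "norm (x - y) < 1")
  case True
  note h = holder_classD[OF \<phi>]
  have "norm (V x - V y) \<le> B * norm (x - y) powr b"
  proof (cases "\<gamma> < 2")
    case g: True
    have "norm (V x - V y) \<le> B * norm (x - y) powr (\<gamma> - 1)" by (rule h(5)[OF g])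
    also have "\<dots> \<le> B * norm (x - y) powr b"
      using True b h(4) by (intro mult_left_mono powr_le_powr_of_le_one) auto
    finally show ?thesis .
  next
    case False
    then have g: "2 < \<gamma>" using \<gamma> by simp
    have "norm (V (y + (x - y)) - V y) \<le> B * norm (x - y)"
      by (rule blinfun_increment_bound[OF h(6)[OF g] h(7)[OF g]])
    also have "\<dots> \<le> B * norm (x - y) powr b"
      using True b h(4) powr_le_powr_of_le_one[of "norm (x - y)" b 1] by (intro mult_left_mono) auto
    finally show ?thesis by simp
  qed
  also have "\<dots> \<le> 2 * B * norm (x - y) powr b" using h(4) by (intro mult_right_mono) auto
  finally show ?thesis .
next
  case False
  note h = holder_classD[OF \<phi>]
  have "norm (V x - V y) \<le> 2 * B" using norm_triangle_ineq4[of "V x" "V y"] h(3)[of x] h(3)[of y] by linarith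
  also have "\<dots> \<le> 2 * B * norm (x - y) powr b"
    using False b h(4) ge_one_powr_ge_zero[of "norm (x - y)" b] by (simp add: mult_le_cancel_left1)
  finally show ?thesis .
qed

lemma holder_class_jet:
  assumes \<phi>: "holder_class \<gamma> B \<phi> V W" and \<gamma>: "1 < \<gamma>" "\<gamma> \<noteq> 2"
  shows "jet (min \<gamma> 2) B \<phi> V"
  unfolding jet_def
proof (intro conjI allI impI)
  note h = holder_classD[OF \<phi>]
  show "continuous_on UNIV \<phi>" "\<bar>\<phi> x\<bar> \<le> B" "norm (V x) \<le> B" for x by (rule h)+
  show "continuous_on UNIV V"
    by (rule holder_imp_continuous_on[where b="min (\<gamma> - 1) 1"]) (use \<gamma> in \<open>auto intro!: holder_gradient[OF \<phi> \<gamma>]\<close>)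
  show "\<bar>\<phi> (x + z) - \<phi> x - V x \<bullet> z\<bar> \<le> B * norm z powr min \<gamma> 2" for x z
    by (rule holder_taylor[OF \<phi> \<gamma>])
qed

text \<open>The following weight is the common majorant of the two kinds of remainders that occur: that of
  the increment of a function by a translation of length \<open>r\<close>, and that of a function which is small
  of order \<open>r\<^sup>\<gamma>\<^sup>-\<^sup>\<beta>\<close> in \<open>C\<^sup>\<beta>\<close>. It is also what the growth condition on the jump measure controls.\<close>

definition remainder_weight :: "real \<Rightarrow> real \<Rightarrow> 'a::real_normed_vector \<Rightarrow> real" where
  "remainder_weight \<gamma> r y =
     (if \<gamma> < 2 then (if norm y < r then norm y powr \<gamma> else r powr (\<gamma> - 1) * norm y)
      else (if norm y < r then r powr (\<gamma> - 2) * (norm y)\<^sup>2 else r * norm y powr (\<gamma> - 1)))"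

lemma remainder_weight_nonneg: "0 \<le> r \<Longrightarrow> 0 \<le> remainder_weight \<gamma> r y"
  by (simp add: remainder_weight_def)

text \<open>The left-hand side is the remainder at the origin of \<open>v \<mapsto> \<phi>(x + v) - \<phi>(x' + v)\<close>. The oscillation
  of the gradient of this function is a second difference of \<open>V\<close> with steps \<open>t y\<close> and \<open>x - x'\<close>; one takes
  the differences in the order that gives the better bound, according to which step is smaller.\<close>

lemma remainder_translation:
  assumes \<phi>: "holder_class \<gamma> B \<phi> V W" and \<gamma>: "1 < \<gamma>" "\<gamma> < 3" "\<gamma> \<noteq> 2"
  shows "\<bar>(\<phi> (x + y) - \<phi> x) - (\<phi> (x' + y) - \<phi> x') - (V x - V x') \<bullet> y\<bar> \<le> 2 * B * remainder_weight \<gamma> (norm (x - x')) y"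
proof -
  note h = holder_classD[OF \<phi>]
  define r where "r = norm (x - x')"
  define G where "G v = \<phi> (x + v) - \<phi> (x' + v)" for v
  have dG: "(G has_derivative (\<lambda>h. (V (x + v) - V (x' + v)) \<bullet> h)) (at v)" for v
  proof -
    have "((\<lambda>v. \<phi> (a + v)) has_derivative (\<lambda>h. V (a + v) \<bullet> h)) (at v)" for a
      by (rule has_derivative_shift[OF h(1)])
    then show ?thesis unfolding G_def[abs_def] inner_diff_left by (intro has_derivative_diff)
  qed
  have rem: "\<bar>(\<phi> (x + y) - \<phi> x) - (\<phi> (x' + y) - \<phi> x') - (V x - V x') \<bullet> y\<bar> \<le> K * norm y"
    if K: "\<And>t. 0 \<le> t \<Longrightarrow> t \<le> 1 \<Longrightarrow> norm (V (x + t *\<^sub>R y) - V (x' + t *\<^sub>R y) - (V x - V x')) \<le> K" for K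
    using remainder_bound[of G "\<lambda>v. V (x + v) - V (x' + v)" 0 y "V x - V x'" K, OF dG] K
    by (simp add: G_def algebra_simps)
  show ?thesis
  proof (cases "\<gamma> < 2")
    case g: True
    show ?thesis
    proof (cases "norm y < r")
      case True
      have "norm (V (x + t *\<^sub>R y) - V (x' + t *\<^sub>R y) - (V x - V x')) \<le> 2 * B * norm y powr (\<gamma> - 1)"
        if t: "0 \<le> t" "t \<le> 1" for t
      proof -
        have *: "norm (V (a + t *\<^sub>R y) - V a) \<le> B * norm y powr (\<gamma> - 1)" for a
        proof -
          have "norm (V (a + t *\<^sub>R y) - V a) \<le> B * norm (t *\<^sub>R y) powr (\<gamma> - 1)"
            using h(5)[OF g, of "a + t *\<^sub>R y" a] by simp
          also have "\<dots> \<le> B * norm y powr (\<gamma> - 1)"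
            using t h(4) \<gamma> by (intro mult_left_mono powr_scaled_le) auto
          finally show ?thesis .
        qed
        have eq: "V (x + t *\<^sub>R y) - V (x' + t *\<^sub>R y) - (V x - V x') = (V (x + t *\<^sub>R y) - V x) - (V (x' + t *\<^sub>R y) - V x')"
          by simp
        show ?thesis
          unfolding eq
          using norm_triangle_ineq4[of "V (x + t *\<^sub>R y) - V x" "V (x' + t *\<^sub>R y) - V x'"] *[of x] *[of x'] by simp
      qed
      from rem[OF this] show ?thesis
        using True g by (simp add: remainder_weight_def r_def mult.assoc powr_minus_one_mult)
    next
      case False
      have "norm (V (x + t *\<^sub>R y) - V (x' + t *\<^sub>R y) - (V x - V x')) \<le> 2 * B * r powr (\<gamma> - 1)" for t
        using norm_triangle_ineq4[of "V (x + t *\<^sub>R y) - V (x' + t *\<^sub>R y)" "V x - V x'"]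
          h(5)[OF g, of "x + t *\<^sub>R y" "x' + t *\<^sub>R y"] h(5)[OF g, of x x'] by (simp add: r_def)
      from rem[OF this] show ?thesis
        using False g by (simp add: remainder_weight_def r_def mult.assoc)
    qed
  next
    case False
    then have g: "2 < \<gamma>" using \<gamma> by simp
    have dV: "((\<lambda>v. V (a + v)) has_derivative blinfun_apply (W (a + v))) (at v)" for a v
      by (rule has_derivative_shift[OF h(6)[OF g]])
    show ?thesis
    proof (cases "norm y < r")
      case True
      have "norm (V (x + t *\<^sub>R y) - V (x' + t *\<^sub>R y) - (V x - V x')) \<le> B * r powr (\<gamma> - 2) * norm y"
        if t: "0 \<le> t" "t \<le> 1" for t
      proof -
        have "norm ((V (x + (0 + t *\<^sub>R y)) - V (x' + (0 + t *\<^sub>R y))) - (V (x + 0) - V (x' + 0))) \<le> (B * r powr (\<gamma> - 2)) * norm (t *\<^sub>R y)"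
        proof (rule blinfun_increment_bound)
          show "((\<lambda>v. V (x + v) - V (x' + v)) has_derivative blinfun_apply (W (x + v) - W (x' + v))) (at v)" for v
            unfolding minus_blinfun.rep_eq by (intro has_derivative_diff dV)
          show "norm (W (x + (0 + s *\<^sub>R t *\<^sub>R y)) - W (x' + (0 + s *\<^sub>R t *\<^sub>R y))) \<le> B * r powr (\<gamma> - 2)" for s
            using h(8)[OF g, of "x + (0 + s *\<^sub>R t *\<^sub>R y)" "x' + (0 + s *\<^sub>R t *\<^sub>R y)"] by (simp add: r_def)
        qed
        also have "\<dots> \<le> B * r powr (\<gamma> - 2) * norm y"
          using t h(4) by (intro mult_left_mono) (auto intro: mult_left_le_one_le)
        finally show ?thesis by simp
      qed
      from rem[OF this] have "\<bar>(\<phi> (x + y) - \<phi> x) - (\<phi> (x' + y) - \<phi> x') - (V x - V x') \<bullet> y\<bar> \<le> B * remainder_weight \<gamma> r y"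
        using True g by (simp add: remainder_weight_def mult.assoc power2_eq_square)
      also have "\<dots> \<le> 2 * B * remainder_weight \<gamma> r y"
        using h(4) by (intro mult_right_mono remainder_weight_nonneg) (auto simp: r_def)
      finally show ?thesis by (simp add: r_def)
    next
      case False
      have "norm (V (x + t *\<^sub>R y) - V (x' + t *\<^sub>R y) - (V x - V x')) \<le> B * norm y powr (\<gamma> - 2) * r"
        if t: "0 \<le> t" "t \<le> 1" for t
      proof -
        have "norm ((V (t *\<^sub>R y + (x' + (x - x'))) - V (0 + (x' + (x - x')))) - (V (t *\<^sub>R y + x') - V (0 + x'))) \<le> (B * norm y powr (\<gamma> - 2)) * norm (x - x')"
        proof (rule blinfun_increment_bound)
          show "((\<lambda>v. V (t *\<^sub>R y + v) - V (0 + v)) has_derivative blinfun_apply (W (t *\<^sub>R y + v) - W (0 + v))) (at v)" for v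
            unfolding minus_blinfun.rep_eq by (intro has_derivative_diff dV)
          fix s :: real
          have "norm (W (t *\<^sub>R y + (x' + s *\<^sub>R (x - x'))) - W (0 + (x' + s *\<^sub>R (x - x')))) \<le> B * norm (t *\<^sub>R y) powr (\<gamma> - 2)"
            using h(8)[OF g, of "t *\<^sub>R y + (x' + s *\<^sub>R (x - x'))" "0 + (x' + s *\<^sub>R (x - x'))"] by simp
          also have "\<dots> \<le> B * norm y powr (\<gamma> - 2)"
            using t h(4) g by (intro mult_left_mono powr_scaled_le) auto
          finally show "norm (W (t *\<^sub>R y + (x' + s *\<^sub>R (x - x'))) - W (0 + (x' + s *\<^sub>R (x - x')))) \<le> B * norm y powr (\<gamma> - 2)" .
        qed
        then show ?thesis by (simp add: r_def algebra_simps)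
      qed
      from rem[OF this] have "\<bar>(\<phi> (x + y) - \<phi> x) - (\<phi> (x' + y) - \<phi> x') - (V x - V x') \<bullet> y\<bar> \<le> B * r * (norm y powr ((\<gamma> - 1) - 1) * norm y)"
        by (simp add: mult_ac)
      then have "\<bar>(\<phi> (x + y) - \<phi> x) - (\<phi> (x' + y) - \<phi> x') - (V x - V x') \<bullet> y\<bar> \<le> B * remainder_weight \<gamma> r y"
        unfolding powr_minus_one_mult[OF norm_ge_zero] using False g by (simp add: remainder_weight_def mult.assoc)
      also have "\<dots> \<le> 2 * B * remainder_weight \<gamma> r y"
        using h(4) by (intro mult_right_mono remainder_weight_nonneg) (auto simp: r_def)
      finally show ?thesis by (simp add: r_def)
    qed
  qed
qed

lemma norm_le_from_unit_vectors:
  fixes v :: "'a::euclidean_space"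
  assumes r: "r > 0" and b: "\<And>e. norm e = 1 \<Longrightarrow> \<bar>v \<bullet> (r *\<^sub>R e)\<bar> \<le> K" and K: "0 \<le> K"
  shows "r * norm v \<le> K"
proof (cases "v = 0")
  case False
  have "v \<bullet> v = norm v * norm v" by (simp add: power2_norm_eq_inner[symmetric] power2_eq_square)
  then have eq: "v \<bullet> (r *\<^sub>R (v /\<^sub>R norm v)) = r * norm v" using False by (simp add: field_simps)
  have "\<bar>v \<bullet> (r *\<^sub>R (v /\<^sub>R norm v))\<bar> \<le> K" using False by (intro b) simp
  then show ?thesis unfolding eq by linarith
qed (use K in simp)

text \<open>Interpolation. A function bounded in \<open>C\<^sup>\<gamma>\<close> whose \<open>C\<^sup>\<beta>\<close> seminorm is of order \<open>r\<^sup>\<alpha>\<close>, where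
  \<open>\<gamma> = \<alpha> + \<beta>\<close>, has derivatives of order \<open>k\<close> of size \<open>r\<^sup>\<gamma>\<^sup>-\<^sup>k\<close>: compare them with difference quotients
  of step \<open>r\<close>.\<close>

lemma interpolation:
  assumes \<phi>: "holder_class \<gamma> B \<phi> V W" and \<gamma>: "1 < \<gamma>" "\<gamma> < 3" "\<gamma> \<noteq> 2" "\<gamma> = \<alpha> + \<beta>"
    and r: "0 < r" and osc: "\<And>x y. \<bar>\<phi> x - \<phi> y\<bar> \<le> B * r powr \<alpha> * norm (x - y) powr \<beta>"
  shows "norm (V x) \<le> 5 * B * r powr (\<gamma> - 1)"
    and "2 < \<gamma> \<Longrightarrow> norm (W x) \<le> 4 * B * r powr (\<gamma> - 2)"
    and "\<bar>\<phi> (x + y) - \<phi> x - V x \<bullet> y\<bar> \<le> 10 * B * remainder_weight \<gamma> r y"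
proof -
  note h = holder_classD[OF \<phi>]
  have step: "\<bar>\<phi> (v + r *\<^sub>R e) - \<phi> v\<bar> \<le> B * r powr \<gamma>" if "norm e = 1" for v e
    using osc[of "v + r *\<^sub>R e" v] that r \<gamma>(4) by (simp add: powr_add mult.assoc)
  have r1: "r powr \<gamma> = r * r powr (\<gamma> - 1)" using r by (simp add: powr_diff)
  have r2: "r powr (\<gamma> - 1) = r * r powr (\<gamma> - 2)" using r powr_add[of r 1 "\<gamma> - 2"] by simp
  have W: "norm (W x) \<le> 4 * B * r powr (\<gamma> - 2)" if g: "2 < \<gamma>" for x
  proof (rule norm_blinfun_bound)
    show "0 \<le> 4 * B * r powr (\<gamma> - 2)" using h(4) by simp
    have dV: "((\<lambda>v. V (v + a)) has_derivative blinfun_apply (W (v + a))) (at v)" for a v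
      using has_derivative_shift(2)[of V "blinfun_apply (W (a + v))" a v, OF h(6)[OF g]] by (simp add: add.commute)
    have unit: "norm (W x e) \<le> 4 * B * r powr (\<gamma> - 2)" if e: "norm e = 1" for e
    proof -
      \<comment> \<open>The increment of \<open>V\<close> over a step of length \<open>r\<close> in direction \<open>e\<close>. It is also the gradient of an increment of \<open>\<phi>\<close>,
        and increments of \<open>\<phi>\<close> over length \<open>r\<close> are of order \<open>r\<^sup>\<gamma>\<close>.\<close>
      define G where "G v = V (v + r *\<^sub>R e) - V v" for v
      have dK: "((\<lambda>v. \<phi> (v + r *\<^sub>R e) - \<phi> v) has_derivative (\<lambda>h. G v \<bullet> h)) (at v)" for v
      proof -
        have "((\<lambda>v. \<phi> (v + r *\<^sub>R e)) has_derivative (\<lambda>h. V (v + r *\<^sub>R e) \<bullet> h)) (at v)"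
          using has_derivative_shift(2)[OF h(1), of "r *\<^sub>R e" v] by (simp add: add.commute)
        then show ?thesis unfolding G_def inner_diff_left by (intro has_derivative_diff h)
      qed
      have Gx: "r * norm (G x) \<le> 3 * B * r powr \<gamma>"
      proof (rule norm_le_from_unit_vectors[OF r])
        fix e' :: 'a assume e': "norm e' = 1"
        have "\<bar>(\<phi> (x + r *\<^sub>R e' + r *\<^sub>R e) - \<phi> (x + r *\<^sub>R e')) - (\<phi> (x + r *\<^sub>R e) - \<phi> x) - G x \<bullet> (r *\<^sub>R e')\<bar>
            \<le> (B * r powr (\<gamma> - 2) * r) * norm (r *\<^sub>R e')"
        proof (rule remainder_bound[OF dK])
          fix t :: real assume t: "0 \<le> t" "t \<le> 1"
          have "norm ((V (x + t *\<^sub>R r *\<^sub>R e' + r *\<^sub>R e) - V (x + t *\<^sub>R r *\<^sub>R e' + 0)) - (V (x + r *\<^sub>R e) - V (x + 0))) \<le> (B * r powr (\<gamma> - 2)) * norm (t *\<^sub>R r *\<^sub>R e')"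
          proof (rule blinfun_increment_bound)
            show "((\<lambda>v. V (v + r *\<^sub>R e) - V (v + 0)) has_derivative blinfun_apply (W (v + r *\<^sub>R e) - W (v + 0))) (at v)" for v
              unfolding minus_blinfun.rep_eq by (intro has_derivative_diff dV)
            show "norm (W (x + s *\<^sub>R t *\<^sub>R r *\<^sub>R e' + r *\<^sub>R e) - W (x + s *\<^sub>R t *\<^sub>R r *\<^sub>R e' + 0)) \<le> B * r powr (\<gamma> - 2)" for s
              using h(8)[OF g, of "x + s *\<^sub>R t *\<^sub>R r *\<^sub>R e' + r *\<^sub>R e" "x + s *\<^sub>R t *\<^sub>R r *\<^sub>R e' + 0"] e r by simp
          qed
          also have "\<dots> \<le> B * r powr (\<gamma> - 2) * r"
            using t e' h(4) r by (intro mult_left_mono) (auto intro: mult_left_le_one_le)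
          finally show "norm (G (x + t *\<^sub>R r *\<^sub>R e') - G x) \<le> B * r powr (\<gamma> - 2) * r"
            by (simp add: G_def)
        qed
        also have "\<dots> = B * r powr \<gamma>" using e' r by (simp add: r1 r2 mult_ac)
        finally show "\<bar>G x \<bullet> (r *\<^sub>R e')\<bar> \<le> 3 * B * r powr \<gamma>"
          using step[OF e, of "x + r *\<^sub>R e'"] step[OF e, of x] by linarith
      qed (use h(4) in simp)
      have "norm (V (x + r *\<^sub>R e) - W x (x + r *\<^sub>R e) - (V x - W x x)) \<le> (B * r powr (\<gamma> - 2)) * norm (r *\<^sub>R e)"
      proof (rule blinfun_increment_bound)
        show "((\<lambda>v. V v - W x v) has_derivative blinfun_apply (W v - W x)) (at v)" for v
          unfolding minus_blinfun.rep_eq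
          by (intro has_derivative_diff h(6)[OF g] bounded_linear_imp_has_derivative blinfun.bounded_linear_right)
        fix t :: real assume t: "0 \<le> t" "t \<le> 1"
        have "norm (W (x + t *\<^sub>R r *\<^sub>R e) - W x) \<le> B * norm (t *\<^sub>R r *\<^sub>R e) powr (\<gamma> - 2)"
          using h(8)[OF g, of "x + t *\<^sub>R r *\<^sub>R e" x] by simp
        also have "\<dots> \<le> B * norm (r *\<^sub>R e) powr (\<gamma> - 2)"
          using t h(4) g by (intro mult_left_mono powr_scaled_le) auto
        finally show "norm (W (x + t *\<^sub>R r *\<^sub>R e) - W x) \<le> B * r powr (\<gamma> - 2)" using e r by simp
      qed
      then have "norm (G x - r *\<^sub>R W x e) \<le> B * r powr (\<gamma> - 1)"
        using e r by (simp add: G_def blinfun.add_right blinfun.scaleR_right r2 mult_ac algebra_simps)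
      moreover have "norm (G x) \<le> 3 * B * r powr (\<gamma> - 1)"
        using Gx r unfolding r1 by (simp add: mult.left_commute)
      ultimately have "norm (r *\<^sub>R W x e) \<le> 4 * B * r powr (\<gamma> - 1)"
        using norm_triangle_ineq2[of "r *\<^sub>R W x e" "G x"] by (simp add: norm_minus_commute)
      then show ?thesis using r unfolding r2 by (simp add: mult.left_commute)
    qed
    fix v :: 'a
    show "norm (W x v) \<le> 4 * B * r powr (\<gamma> - 2) * norm v"
    proof (cases "v = 0")
      case False
      have "norm (W x v) = norm v * norm (W x (v /\<^sub>R norm v))"
        using False by (simp add: blinfun.scaleR_right)
      also have "\<dots> \<le> norm v * (4 * B * r powr (\<gamma> - 2))"
        using False by (intro mult_left_mono unit) auto
      finally show ?thesis by (simp add: mult.commute)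
    qed simp
  qed
  then show "2 < \<gamma> \<Longrightarrow> norm (W x) \<le> 4 * B * r powr (\<gamma> - 2)" .
  have V: "norm (V x) \<le> 5 * B * r powr (\<gamma> - 1)" for x
  proof -
    have "r * norm (V x) \<le> 5 * B * r powr \<gamma>"
    proof (rule norm_le_from_unit_vectors[OF r])
      fix e :: 'a assume e: "norm e = 1"
      have "\<bar>\<phi> (x + r *\<^sub>R e) - \<phi> x - V x \<bullet> (r *\<^sub>R e)\<bar> \<le> 4 * B * r powr \<gamma>"
      proof (cases "\<gamma> < 2")
        case True
        have "B * r powr \<gamma> \<ge> 0" using h(4) by simp
        then show ?thesis
          using holder_taylor[OF \<phi> \<gamma>(1,3), of x "r *\<^sub>R e"] True e r by simp
      next
        case False
        then have g: "2 < \<gamma>" using \<gamma> by simp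
        have "\<bar>\<phi> (x + r *\<^sub>R e) - \<phi> x - V x \<bullet> (r *\<^sub>R e)\<bar> \<le> (4 * B * r powr (\<gamma> - 2) * r) * norm (r *\<^sub>R e)"
        proof (rule remainder_bound[OF h(1)])
          fix t :: real assume t: "0 \<le> t" "t \<le> 1"
          have "norm (V (x + t *\<^sub>R r *\<^sub>R e) - V x) \<le> 4 * B * r powr (\<gamma> - 2) * norm (t *\<^sub>R r *\<^sub>R e)"
            by (rule blinfun_increment_bound[OF h(6)[OF g] W[OF g]])
          also have "\<dots> \<le> 4 * B * r powr (\<gamma> - 2) * r"
            using t e r h(4) by (intro mult_left_mono) (auto intro: mult_left_le_one_le)
          finally show "norm (V (x + t *\<^sub>R r *\<^sub>R e) - V x) \<le> 4 * B * r powr (\<gamma> - 2) * r" .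
        qed
        then show ?thesis using e r by (simp add: r1 r2 mult_ac)
      qed
      then show "\<bar>V x \<bullet> (r *\<^sub>R e)\<bar> \<le> 5 * B * r powr \<gamma>" using step[OF e, of x] by linarith
    qed (use h(4) in simp)
    then show ?thesis using r unfolding r1 by (simp add: mult.left_commute)
  qed
  then show "norm (V x) \<le> 5 * B * r powr (\<gamma> - 1)" .
  have far: "\<bar>\<phi> (x + y) - \<phi> x - V x \<bullet> y\<bar> \<le> (10 * B * r powr (\<gamma> - 1)) * norm y"
  proof (rule remainder_bound[OF h(1)])
    fix t :: real
    show "norm (V (x + t *\<^sub>R y) - V x) \<le> 10 * B * r powr (\<gamma> - 1)"
      using norm_triangle_ineq4[of "V (x + t *\<^sub>R y)" "V x"] V[of "x + t *\<^sub>R y"] V[of x] by linarith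
  qed
  show "\<bar>\<phi> (x + y) - \<phi> x - V x \<bullet> y\<bar> \<le> 10 * B * remainder_weight \<gamma> r y"
  proof (cases "\<gamma> < 2")
    case True
    have "B * norm y powr \<gamma> \<ge> 0" using h(4) by simp
    then show ?thesis
      using far holder_taylor[OF \<phi> \<gamma>(1,3), of x y] True by (simp add: remainder_weight_def mult.assoc)
  next
    case False
    then have g: "2 < \<gamma>" using \<gamma> by simp
    show ?thesis
    proof (cases "norm y < r")
      case True
      have "\<bar>\<phi> (x + y) - \<phi> x - V x \<bullet> y\<bar> \<le> (4 * B * r powr (\<gamma> - 2) * norm y) * norm y"
      proof (rule remainder_bound[OF h(1)])
        fix t :: real assume t: "0 \<le> t" "t \<le> 1"
        have "norm (V (x + t *\<^sub>R y) - V x) \<le> 4 * B * r powr (\<gamma> - 2) * norm (t *\<^sub>R y)"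
          by (rule blinfun_increment_bound[OF h(6)[OF g] W[OF g]])
        also have "\<dots> \<le> 4 * B * r powr (\<gamma> - 2) * norm y"
          using t h(4) by (intro mult_left_mono) (auto intro: mult_left_le_one_le)
        finally show "norm (V (x + t *\<^sub>R y) - V x) \<le> 4 * B * r powr (\<gamma> - 2) * norm y" .
      qed
      also have "\<dots> = 4 * B * remainder_weight \<gamma> r y"
        using True g by (simp add: remainder_weight_def power2_eq_square mult_ac)
      also have "\<dots> \<le> 10 * B * remainder_weight \<gamma> r y"
        using h(4) r by (intro mult_right_mono remainder_weight_nonneg) auto
      finally show ?thesis .
    next
      case False
      have "r powr (\<gamma> - 1) * norm y = r * (r powr (\<gamma> - 2) * norm y)" by (simp add: r2)
      also have "\<dots> \<le> r * (norm y powr (\<gamma> - 2) * norm y)"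
        using False r g by (intro mult_left_mono mult_right_mono powr_mono2) auto
      also have "\<dots> = remainder_weight \<gamma> r y"
        using False g powr_minus_one_mult[of "norm y" "\<gamma> - 1"] by (simp add: remainder_weight_def)
      finally have "10 * B * (r powr (\<gamma> - 1) * norm y) \<le> 10 * B * remainder_weight \<gamma> r y"
        using h(4) by (intro mult_left_mono) auto
      with far show ?thesis by (simp add: mult.assoc)
    qed
  qed
qed

section \<open>Levy operators on Hoelder spaces\<close>

text \<open>The growth condition on the jump measure in the form in which it is used: over the small jumps, the
  majorant \<open>remainder_weight\<close> has an integral of order \<open>r\<^sup>\<beta>\<close>.\<close>

locale levy_growth = levy_semigroup \<mu> \<nu> \<psi> g
  for \<mu> :: "'a::euclidean_space measure" and \<nu> :: "real \<Rightarrow> 'a measure" and \<psi> :: "'a \<Rightarrow> complex" and g :: real +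
  fixes \<alpha> \<beta> \<gamma> c :: real
  assumes alpha: "1 < \<alpha>" "\<alpha> \<le> 2" and beta: "0 < \<beta>" "\<beta> < 1" and gamma: "\<gamma> = \<alpha> + \<beta>" "\<gamma> \<noteq> 2"
    and g_eq: "g = min \<gamma> 2" and c: "0 \<le> c"
    and growth: "\<And>r. 0 < r \<Longrightarrow> r < 1 \<Longrightarrow>
      (\<integral>\<^sup>+y\<in>ball 0 1. ennreal (remainder_weight \<gamma> r y) \<partial>\<mu>) \<le> ennreal (c * r powr \<beta>)"
begin

definition jump_const :: real where
  "jump_const = c + jump_mass"

lemma gamma_bounds: "1 < \<gamma>" "\<gamma> < 3"
  using gamma alpha beta by auto

lemma jump_const_nonneg: "0 \<le> jump_const"
  using c jump_mass_nonneg by (simp add: jump_const_def)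

lemma class_jet: "holder_class \<gamma> B \<phi> V W \<Longrightarrow> jet g B \<phi> V"
  unfolding g_eq using holder_class_jet gamma_bounds gamma by blast

lemma remainder_weight_measurable[measurable]: "(\<lambda>y::'a. remainder_weight \<gamma> r y) \<in> borel_measurable borel"
  unfolding remainder_weight_def[abs_def] by measurable

lemma remainder_weight_integral:
  assumes r: "0 < r" "r < 1"
  shows "integrable \<mu> (\<lambda>y. indicator (ball 0 1) y * remainder_weight \<gamma> r y)" (is "integrable _ ?w")
    and "(LINT y|\<mu>. indicator (ball 0 1) y * remainder_weight \<gamma> r y) \<le> c * r powr \<beta>"
proof -
  have eq: "(\<integral>\<^sup>+y. ennreal (?w y) \<partial>\<mu>) = (\<integral>\<^sup>+y\<in>ball 0 1. ennreal (remainder_weight \<gamma> r y) \<partial>\<mu>)"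
    by (intro nn_integral_cong) (simp add: indicator_def)
  have nn: "0 \<le> ?w y" for y using r by (simp add: remainder_weight_nonneg)
  have le: "(\<integral>\<^sup>+y. ennreal (?w y) \<partial>\<mu>) \<le> ennreal (c * r powr \<beta>)" unfolding eq by (rule growth[OF r])
  show i: "integrable \<mu> ?w"
    by (rule integrableI_nonneg) (use nn le in \<open>auto intro: le_less_trans\<close>)
  show "(LINT y|\<mu>. ?w y) \<le> c * r powr \<beta>"
    using le c nn nn_integral_eq_integral[OF i] by simp
qed

text \<open>Both Hoelder bounds for \<open>levy_op\<close> below come from this one: small jumps are handled by the
  remainder, jumps of size at least one by the increment itself.\<close>

lemma levy_increment:
  assumes r: "0 < r" "r < 1" and K: "0 \<le> K"
    and int: "integrable \<mu> (\<lambda>y. D y - indicator (ball 0 1) y * (d \<bullet> y))"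
    and small: "\<And>y. norm y < 1 \<Longrightarrow> \<bar>D y - d \<bullet> y\<bar> \<le> K * remainder_weight \<gamma> r y"
    and large: "\<And>y. \<bar>D y\<bar> \<le> K * r powr \<beta>"
  shows "\<bar>LINT y|\<mu>. D y - indicator (ball 0 1) y * (d \<bullet> y)\<bar> \<le> K * jump_const * r powr \<beta>"
proof -
  let ?k = "\<lambda>y. D y - indicator (ball 0 1) y * (d \<bullet> y)"
  let ?m = "\<lambda>y. K * (indicator (ball 0 1) y * remainder_weight \<gamma> r y) + (K * r powr \<beta>) * jump_weight y"
  note w = remainder_weight_integral[OF r]
  have "\<bar>LINT y|\<mu>. ?k y\<bar> \<le> (LINT y|\<mu>. norm (?k y))"
    unfolding real_norm_def[symmetric] by (rule integral_norm_bound)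
  also have "\<dots> \<le> (LINT y|\<mu>. ?m y)"
  proof (rule integral_mono)
    show "integrable \<mu> (\<lambda>y. norm (?k y))" using int by (rule integrable_norm)
    show "integrable \<mu> ?m"
      by (intro Bochner_Integration.integrable_add integrable_mult_right w integrable_jump_weight)
    fix y
    show "norm (?k y) \<le> ?m y"
    proof (cases "norm y < 1")
      case True
      have "0 \<le> (K * r powr \<beta>) * jump_weight y" using K by (simp add: jump_weight_nonneg)
      then show ?thesis using small[OF True] True by simp
    next
      case False
      then have "jump_weight y = 1" by (intro jump_weight_large) simp
      then show ?thesis using large[of y] False by simp
    qed
  qed
  also have "\<dots> = K * (LINT y|\<mu>. indicator (ball 0 1) y * remainder_weight \<gamma> r y) + (K * r powr \<beta>) * jump_mass"
    unfolding jump_mass_def integral_mult_right_zero[symmetric]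
    by (intro Bochner_Integration.integral_add integrable_mult_right w integrable_jump_weight)
  also have "\<dots> \<le> K * (c * r powr \<beta>) + (K * r powr \<beta>) * jump_mass"
    using w(2) K by (intro add_right_mono mult_left_mono)
  also have "\<dots> = K * jump_const * r powr \<beta>" by (simp add: jump_const_def algebra_simps)
  finally show ?thesis .
qed

lemma levy_op_class_bound:
  assumes "holder_class \<gamma> B \<phi> V W"
  shows "\<bar>levy_op \<mu> \<phi> V x\<bar> \<le> 2 * B * jump_const"
proof -
  have "\<bar>levy_op \<mu> \<phi> V x\<bar> \<le> 2 * B * jump_mass" by (rule levy_op_bound[OF class_jet[OF assms]])
  also have "\<dots> \<le> 2 * B * jump_const"
    using c holder_classD(4)[OF assms] by (intro mult_left_mono) (auto simp: jump_const_def)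
  finally show ?thesis .
qed

text \<open>The remainders at \<open>x\<close> and \<open>x'\<close> differ by at most the majorant with \<open>r = |x - x'|\<close>. Points at distance
  at least one are covered by the bound on \<open>levy_op\<close> itself.\<close>

lemma levy_op_holder:
  assumes \<phi>: "holder_class \<gamma> B \<phi> V W"
  shows "\<bar>levy_op \<mu> \<phi> V x - levy_op \<mu> \<phi> V x'\<bar> \<le> 4 * B * jump_const * norm (x - x') powr \<beta>"
proof -
  note h = holder_classD[OF \<phi>]
  define r where "r = norm (x - x')"
  have BJ: "0 \<le> B * jump_const" using h(4) jump_const_nonneg by simp
  consider "r = 0" | "0 < r" "r < 1" | "1 \<le> r" unfolding r_def by fastforce
  then have "\<bar>levy_op \<mu> \<phi> V x - levy_op \<mu> \<phi> V x'\<bar> \<le> 4 * (B * jump_const) * r powr \<beta>"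
  proof cases
    case 1
    then show ?thesis by (simp add: r_def)
  next
    case 2
    note i = levy_integrable[OF class_jet[OF \<phi>]]
    let ?D = "\<lambda>y. (\<phi> (x + y) - \<phi> x) - (\<phi> (x' + y) - \<phi> x')"
    have eq: "levy_op \<mu> \<phi> V x - levy_op \<mu> \<phi> V x' = (LINT y|\<mu>. ?D y - indicator (ball 0 1) y * ((V x - V x') \<bullet> y))"
      unfolding levy_op_def Bochner_Integration.integral_diff[OF i i, symmetric]
      by (intro Bochner_Integration.integral_cong) (auto simp: algebra_simps inner_diff_left)
    have "\<bar>levy_op \<mu> \<phi> V x - levy_op \<mu> \<phi> V x'\<bar> \<le> (2 * B) * jump_const * r powr \<beta>"
      unfolding eq
    proof (rule levy_increment[OF 2])
      show "0 \<le> 2 * B" using h(4) by simp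
      show "integrable \<mu> (\<lambda>y. ?D y - indicator (ball 0 1) y * ((V x - V x') \<bullet> y))"
        using Bochner_Integration.integrable_diff[OF i[of x] i[of x']]
        by (simp add: algebra_simps inner_diff_left)
      show "\<bar>?D y - (V x - V x') \<bullet> y\<bar> \<le> 2 * B * remainder_weight \<gamma> r y" for y
        unfolding r_def by (rule remainder_translation[OF \<phi> gamma_bounds gamma(2)])
      fix y
      have lip: "\<bar>\<phi> (x + a) - \<phi> (x' + a)\<bar> \<le> B * r powr \<beta>" for a
      proof -
        have "norm (\<phi> ((x' + a) + (x - x')) - \<phi> (x' + a)) \<le> B * norm (x - x')"
        proof (rule increment_bound[OF h(1)])
          show "norm (V (x' + a + t *\<^sub>R (x - x')) \<bullet> h) \<le> B * norm h" for t h
            using h(3)[of "x' + a + t *\<^sub>R (x - x')"] Cauchy_Schwarz_ineq2[of "V (x' + a + t *\<^sub>R (x - x'))" h]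
              mult_right_mono[OF h(3)[of "x' + a + t *\<^sub>R (x - x')"], of "norm h"] by simp
        qed (rule h)
        moreover have "r \<le> r powr \<beta>"
          using powr_le_powr_of_le_one[of r \<beta> 1] 2 beta by simp
        then have "B * r \<le> B * r powr \<beta>" using h(4) by (intro mult_left_mono)
        ultimately show ?thesis by (simp add: r_def algebra_simps)
      qed
      show "\<bar>?D y\<bar> \<le> 2 * B * r powr \<beta>" using lip[of y] lip[of 0] by simp
    qed
    also have "\<dots> \<le> 4 * (B * jump_const) * r powr \<beta>"
      using BJ mult_nonneg_nonneg[OF BJ, of "r powr \<beta>"] by (simp add: algebra_simps)
    finally show ?thesis .
  next
    case 3
    then have "1 \<le> r powr \<beta>" using beta by (intro ge_one_powr_ge_zero) auto
    have "\<bar>levy_op \<mu> \<phi> V x - levy_op \<mu> \<phi> V x'\<bar> \<le> 4 * (B * jump_const)"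
      using levy_op_class_bound[OF \<phi>, of x] levy_op_class_bound[OF \<phi>, of x'] by simp
    also have "\<dots> \<le> 4 * (B * jump_const) * r powr \<beta>"
      using BJ \<open>1 \<le> r powr \<beta>\<close> by (simp add: mult_le_cancel_left1)
    finally show ?thesis .
  qed
  then show ?thesis by (simp add: r_def mult.assoc)
qed

text \<open>The remainder of a function that is small in \<open>C\<^sup>\<beta>\<close> and bounded in \<open>C\<^sup>\<gamma>\<close> is bounded by the same majorant,
  by interpolation.\<close>

lemma levy_op_small:
  assumes \<phi>: "holder_class \<gamma> B \<phi> V W" and r: "0 < r" "r < 1"
    and osc: "\<And>x y. \<bar>\<phi> x - \<phi> y\<bar> \<le> B * r powr \<alpha> * norm (x - y) powr \<beta>"
    and sup: "\<And>x. \<bar>\<phi> x\<bar> \<le> B * r powr \<alpha>"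
  shows "\<bar>levy_op \<mu> \<phi> V x\<bar> \<le> 10 * B * jump_const * r powr \<beta>"
  unfolding levy_op_def
proof (rule levy_increment[OF r])
  note h = holder_classD[OF \<phi>]
  show "0 \<le> 10 * B" using h(4) by simp
  show "integrable \<mu> (\<lambda>y. \<phi> (x + y) - \<phi> x - indicator (ball 0 1) y * (V x \<bullet> y))"
    by (rule levy_integrable[OF class_jet[OF \<phi>]])
  show "\<bar>\<phi> (x + y) - \<phi> x - V x \<bullet> y\<bar> \<le> 10 * B * remainder_weight \<gamma> r y" for y
    by (rule interpolation(3)[OF \<phi> gamma_bounds gamma(2,1) r(1) osc])
  fix y
  have "B * r powr \<alpha> \<le> B * r powr \<beta>"
    using r alpha beta h(4) by (intro mult_left_mono powr_le_powr_of_le_one) auto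
  moreover have "0 \<le> B * r powr \<beta>" using h(4) by simp
  ultimately show "\<bar>\<phi> (x + y) - \<phi> x\<bar> \<le> 10 * B * r powr \<beta>"
    using sup[of "x + y"] sup[of x] by linarith
qed

lemma levy_op_diff:
  assumes "holder_class \<gamma> B \<phi> V W" "holder_class \<gamma> B' \<phi>' V' W'"
  shows "levy_op \<mu> (\<lambda>x. \<phi> x - \<phi>' x) (\<lambda>x. V x - V' x) x = levy_op \<mu> \<phi> V x - levy_op \<mu> \<phi>' V' x"
  unfolding levy_op_def
    Bochner_Integration.integral_diff[OF levy_integrable[OF class_jet[OF assms(1)]] levy_integrable[OF class_jet[OF assms(2)]], symmetric]
  by (intro Bochner_Integration.integral_cong) (auto simp: algebra_simps inner_diff_left)

lemma levy_op_continuous: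
  assumes "holder_class \<gamma> B \<phi> V W"
  shows "continuous_on UNIV (levy_op \<mu> \<phi> V)"
  by (rule holder_imp_continuous_on[OF beta(1)]) (use levy_op_holder[OF assms] in auto)

lemma spread_small:
  assumes "0 < e"
  obtains d where "0 < d" "\<And>h. 0 < h \<Longrightarrow> h < d \<Longrightarrow> spread \<beta> h < e"
proof -
  have "\<forall>\<^sub>F h in at_right 0. spread \<beta> h < e"
    using spread_tendsto_0[OF beta(1)] assms by (rule order_tendstoD)
  then show ?thesis unfolding eventually_at_right[OF zero_less_one] using that by auto
qed

lemma P_time_modulus:
  assumes t: "0 < s" "0 < t" "s \<noteq> t" and f: "continuous_on UNIV f" "\<And>y. \<bar>f y\<bar> \<le> B"
    and hol: "\<And>x y. \<bar>f x - f y\<bar> \<le> B * norm (x - y) powr \<beta>"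
  shows "\<bar>P t f x - P s f x\<bar> \<le> B * spread \<beta> \<bar>t - s\<bar>"
proof -
  have fm: "f \<in> borel_measurable borel" using f(1) by (intro borel_measurable_continuous_onI)
  have *: "\<bar>P b f x - P a f x\<bar> \<le> B * spread \<beta> (b - a)" if "0 < a" "a < b" for a b
  proof -
    have ba: "0 < b - a" using that by simp
    have "P b f x = P a (P (b - a) f) x" using P_add[OF that(1) ba f] by simp
    then have "P b f x - P a f x = P a (\<lambda>y. P (b - a) f y - f y) x"
      using P_diff[OF that(1) _ P_bound[OF ba fm f(2)] fm f(2)] P_continuous[OF ba f]
      by (simp add: borel_measurable_continuous_onI)
    also have "\<bar>\<dots>\<bar> \<le> B * spread \<beta> (b - a)"
      using P_continuous[OF ba f] f fm
      by (intro P_bound[OF that(1)] P_modulus[OF ba fm f(2) hol] borel_measurable_diff borel_measurable_continuous_onI) auto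
    finally show ?thesis .
  qed
  show ?thesis using *[of s t] *[of t s] t by (cases "s < t") (auto simp: abs_minus_commute)
qed

lemma P_space_holder:
  assumes t: "0 < t" and f: "f \<in> borel_measurable borel" "\<And>y. \<bar>f y\<bar> \<le> B"
    and hol: "\<And>x y. \<bar>f x - f y\<bar> \<le> C * norm (x - y) powr \<beta>"
  shows "\<bar>P t f x - P t f y\<bar> \<le> C * norm (x - y) powr \<beta>"
proof -
  note f(1)[measurable]
  have eq: "P t f x = P t (\<lambda>z. f (z + (x - y))) y" using P_shift[of t f y "x - y"] by simp
  have m: "(\<lambda>z. f (z + (x - y))) \<in> borel_measurable borel" by measurable
  have "P t f x - P t f y = P t (\<lambda>z. f (z + (x - y)) - f z) y"
    unfolding eq by (rule P_diff[OF t m f(2) f])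
  also have "\<bar>\<dots>\<bar> \<le> C * norm (x - y) powr \<beta>"
    by (rule P_bound[OF t]) (use hol[of "z + (x - y)" z for z] in auto)
  finally show ?thesis .
qed

end

section \<open>Mild solutions in Hoelder spaces are classical\<close>

lemma integral_indicator_Ioo_bound:
  fixes k :: "real \<Rightarrow> real"
  assumes "a \<le> b" "0 \<le> K" "\<And>s. a < s \<Longrightarrow> s < b \<Longrightarrow> \<bar>k s\<bar> \<le> K"
  shows "\<bar>LINT s|lborel. indicator {a<..<b} s * k s\<bar> \<le> (b - a) * K"
proof (cases "integrable lborel (\<lambda>s. indicator {a<..<b} s * k s)")
  case True
  have "\<bar>LINT s|lborel. indicator {a<..<b} s * k s\<bar> \<le> (LINT s|lborel. norm (indicator {a<..<b} s * k s))"
    unfolding real_norm_def[symmetric] by (rule integral_norm_bound)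
  also have "\<dots> \<le> (LINT s|lborel. indicator {a<..<b} s * K)"
  proof (rule integral_mono)
    show "integrable lborel (\<lambda>s. norm (indicator {a<..<b} s * k s))" using True by (rule integrable_norm)
    show "integrable lborel (\<lambda>s. indicator {a<..<b} s * K)"
      using assms(1) by (intro integrable_mult_left) simp
    show "norm (indicator {a<..<b} s * k s) \<le> indicator {a<..<b} s * K" for s
      using assms(3)[of s] by (auto simp: indicator_def)
  qed
  also have "\<dots> = (b - a) * K" using assms(1) by simp
  finally show ?thesis .
next
  case False
  then show ?thesis using assms by (simp add: not_integrable_integral_eq)
qed

lemma Ioo_split_AE:
  fixes k :: "real \<Rightarrow> real"
  assumes ab: "a \<le> b" "b \<le> c" and i1: "integrable lborel (\<lambda>s. indicator {a<..<b} s * k s)"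
    and i2: "integrable lborel (\<lambda>s. indicator {b<..<c} s * k s)"
  shows "(LINT s|lborel. indicator {a<..<c} s * k s)
    = (LINT s|lborel. indicator {a<..<b} s * k s) + (LINT s|lborel. indicator {b<..<c} s * k s)"
proof -
  have [measurable]: "(\<lambda>s. indicator {a<..<b} s * k s) \<in> borel_measurable borel"
    "(\<lambda>s. indicator {b<..<c} s * k s) \<in> borel_measurable borel"
    using i1 i2 by auto
  define kb where "kb = indicator {a<..<c} b * k b"
  have pt: "indicator {a<..<c} s * k s = indicator {a<..<b} s * k s + indicator {b<..<c} s * k s
      + indicator {b} s * kb" for s
    using ab by (auto simp: indicator_def kb_def)
  have "(LINT s|lborel. indicator {a<..<c} s * k s) = (LINT s|lborel. indicator {a<..<b} s * k s + indicator {b<..<c} s * k s)"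
  proof (rule integral_cong_AE)
    show "(\<lambda>s. indicator {a<..<c} s * k s) \<in> borel_measurable lborel" 
      by (subst pt) measurable
    show "AE s in lborel. indicator {a<..<c} s * k s = indicator {a<..<b} s * k s + indicator {b<..<c} s * k s"
      using AE_lborel_singleton[of b] by eventually_elim (subst pt, simp)
  qed measurable
  also have "\<dots> = (LINT s|lborel. indicator {a<..<b} s * k s) + (LINT s|lborel. indicator {b<..<c} s * k s)"
    by (rule Bochner_Integration.integral_add[OF i1 i2])
  finally show ?thesis .
qed

text \<open>A mild solution with source \<open>f\<close>, bounded in \<open>C\<^sup>\<gamma>\<close>. The bounds on \<open>f\<close> concern positive times only:
  for \<open>f(t,x) = H(t,x,Du(t,x))\<close> they involve a bound on the gradient, which at time zero is obtained as
  a limit once the gradient is known to be continuous in time.\<close>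

locale mild_evolution = levy_growth \<mu> \<nu> \<psi> g \<alpha> \<beta> \<gamma> c
  for \<mu> :: "'a::euclidean_space measure" and \<nu> :: "real \<Rightarrow> 'a measure" and \<psi> :: "'a \<Rightarrow> complex" and g \<alpha> \<beta> \<gamma> c :: real +
  fixes T S F0 :: real and u :: "real \<Rightarrow> 'a \<Rightarrow> real" and V :: "real \<Rightarrow> 'a \<Rightarrow> 'a" and W :: "real \<Rightarrow> 'a \<Rightarrow> 'a \<Rightarrow>\<^sub>L 'a"
    and f :: "real \<Rightarrow> 'a \<Rightarrow> real"
  assumes T: "0 < T" and u_class: "\<And>t. 0 \<le> t \<Longrightarrow> t \<le> T \<Longrightarrow> holder_class \<gamma> S (u t) (V t) (W t)"
    and F0: "0 \<le> F0"
    and f_bound: "\<And>t x. 0 < t \<Longrightarrow> t \<le> T \<Longrightarrow> \<bar>f t x\<bar> \<le> F0"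
    and f_holder: "\<And>t x y. 0 < t \<Longrightarrow> t \<le> T \<Longrightarrow> \<bar>f t x - f t y\<bar> \<le> F0 * norm (x - y) powr \<beta>"
    and f_cont: "\<And>t e. 0 < t \<Longrightarrow> t \<le> T \<Longrightarrow> 0 < e \<Longrightarrow>
      \<exists>d>0. \<forall>s. 0 < s \<longrightarrow> s \<le> T \<longrightarrow> \<bar>s - t\<bar> < d \<longrightarrow> (\<forall>x. \<bar>f s x - f t x\<bar> \<le> e)"
    and mild: "\<And>t x. 0 < t \<Longrightarrow> t \<le> T \<Longrightarrow>
      u t x = P t (u 0) x + (LINT s|lborel. indicator {0<..<t} s * P (t - s) (f s) x)"
begin

lemma S_nonneg: "0 \<le> S"
  using holder_classD(4)[OF u_class[of 0]] T by simp

lemma f_continuous: "0 < t \<Longrightarrow> t \<le> T \<Longrightarrow> continuous_on UNIV (f t)"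
  by (rule holder_imp_continuous_on[OF beta(1)]) (use f_holder in auto)

lemma f_measurable: "0 < t \<Longrightarrow> t \<le> T \<Longrightarrow> f t \<in> borel_measurable borel"
  by (intro borel_measurable_continuous_onI f_continuous)

text \<open>Joint continuity gives the joint measurability that Fubini's theorem asks for when the mild formula
  is restarted. Move the space variable, the source and the time of the kernel one after the other.\<close>

lemma duhamel_continuous:
  assumes t: "t \<le> T"
  shows "continuous_on ({0<..<t} \<times> UNIV) (\<lambda>(s, x). P (t - s) (f s) x)"
proof (rule continuous_on_sequentiallyI)
  fix w :: "nat \<Rightarrow> real \<times> 'a" and a assume w: "\<forall>n. w n \<in> {0<..<t} \<times> UNIV" and a: "a \<in> {0<..<t} \<times> UNIV" and wa: "w \<longlonglongrightarrow> a"
  obtain s x where sx: "a = (s, x)" by (cases a)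
  have s: "0 < s" "s < t" "s \<le> T" "0 < t - s" using a sx t by auto
  have lims: "(\<lambda>n. fst (w n)) \<longlonglongrightarrow> s" "(\<lambda>n. snd (w n)) \<longlonglongrightarrow> x"
    using tendsto_fst[OF wa] tendsto_snd[OF wa] sx by auto
  have "(\<lambda>n. P (t - fst (w n)) (f (fst (w n))) (snd (w n))) \<longlonglongrightarrow> P (t - s) (f s) x"
  proof (rule tendstoI)
    fix e :: real assume e: "0 < e"
    obtain d1 where d1: "0 < d1" "\<And>s'. 0 < s' \<Longrightarrow> s' \<le> T \<Longrightarrow> \<bar>s' - s\<bar> < d1 \<Longrightarrow> (\<forall>x. \<bar>f s' x - f s x\<bar> \<le> e / 4)"
      using f_cont[OF s(1,3), of "e / 4"] e by auto
    have "0 < e / (4 * (F0 + 1))" using e F0 by simp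
    then obtain d2 where d2: "0 < d2" "\<And>h. 0 < h \<Longrightarrow> h < d2 \<Longrightarrow> spread \<beta> h < e / (4 * (F0 + 1))"
      by (rule spread_small) blast
    have "(\<lambda>n. norm (snd (w n) - x)) \<longlonglongrightarrow> 0" using lims by (simp add: LIM_zero_iff tendsto_norm_zero_iff)
    from tendsto_powr'[OF this tendsto_const, of \<beta>] beta
    have "(\<lambda>n. F0 * norm (snd (w n) - x) powr \<beta>) \<longlonglongrightarrow> F0 * 0"
      by (intro tendsto_mult tendsto_const) auto
    then have "\<forall>\<^sub>F n in sequentially. F0 * norm (snd (w n) - x) powr \<beta> < e / 4"
      by (rule order_tendstoD) (use e in simp)
    moreover have "\<forall>\<^sub>F n in sequentially. dist (fst (w n)) s < min d1 d2"
      using lims(1) d1 d2 by (intro tendstoD) auto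
    ultimately show "\<forall>\<^sub>F n in sequentially. dist (P (t - fst (w n)) (f (fst (w n))) (snd (w n))) (P (t - s) (f s) x) < e"
    proof eventually_elim
      case (elim n)
      define s' x' where "s' = fst (w n)" and "x' = snd (w n)"
      have "w n \<in> {0<..<t} \<times> UNIV" using w by blast
      then have s': "0 < s'" "s' < t" "s' \<le> T" "0 < t - s'" using t by (auto simp: s'_def mem_Times_iff)
      have "\<bar>P (t - s') (f s') x' - P (t - s') (f s') x\<bar> \<le> F0 * norm (x' - x) powr \<beta>"
        by (rule P_space_holder[OF s'(4) f_measurable f_bound f_holder]) (use s' in auto)
      then have 1: "\<bar>P (t - s') (f s') x' - P (t - s') (f s') x\<bar> < e / 4"
        using elim by (simp add: x'_def)
      have 2: "\<bar>P (t - s') (f s') x - P (t - s') (f s) x\<bar> \<le> e / 4"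
      proof -
        have "P (t - s') (f s') x - P (t - s') (f s) x = P (t - s') (\<lambda>y. f s' y - f s y) x"
          by (rule P_diff[OF s'(4)]) (use s s' f_measurable f_bound in auto)
        also have "\<bar>\<dots>\<bar> \<le> e / 4"
          using d1(2)[OF s'(1,3)] elim s s' f_measurable
          by (intro P_bound[OF s'(4)] borel_measurable_diff) (auto simp: dist_real_def s'_def)
        finally show ?thesis .
      qed
      have 3: "\<bar>P (t - s') (f s) x - P (t - s) (f s) x\<bar> \<le> e / 4"
      proof (cases "s' = s")
        case False
        have "\<bar>P (t - s') (f s) x - P (t - s) (f s) x\<bar> \<le> F0 * spread \<beta> \<bar>(t - s') - (t - s)\<bar>"
          by (rule P_time_modulus) (use s s' False f_continuous f_bound f_holder in auto)
        also have "\<dots> \<le> (F0 + 1) * (e / (4 * (F0 + 1)))"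
          using d2(2)[of "\<bar>s - s'\<bar>"] elim False F0 spread_nonneg[of \<beta> "\<bar>s - s'\<bar>"]
          by (intro mult_mono) (auto simp: dist_real_def s'_def abs_minus_commute)
        also have "\<dots> = e / 4" using F0 by (simp add: field_simps)
        finally show ?thesis .
      qed (use e in simp)
      have "\<bar>P (t - s') (f s') x' - P (t - s) (f s) x\<bar> < e" using 1 2 3 e by linarith
      then show ?case by (simp add: dist_real_def s'_def x'_def)
    qed
  qed
  then show "(\<lambda>n. (\<lambda>(s, x). P (t - s) (f s) x) (w n)) \<longlonglongrightarrow> (\<lambda>(s, x). P (t - s) (f s) x) a"
    by (simp add: sx case_prod_beta)
qed

lemma duhamel_measurable:
  assumes t: "t \<le> T"
  shows "(\<lambda>(s, x). indicator {0<..<t} s * P (t - s) (f s) x) \<in> borel_measurable (borel \<Otimes>\<^sub>M borel)"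
proof -
  have "open ({0<..<t} \<times> (UNIV :: 'a set))" by (intro open_Times) auto
  then have "(\<lambda>p. indicator ({0<..<t} \<times> UNIV) p *\<^sub>R (case p of (s, x) \<Rightarrow> P (t - s) (f s) x)) \<in> borel_measurable borel"
    by (intro borel_measurable_continuous_on_indicator duhamel_continuous t) auto
  moreover have "(\<lambda>p. indicator ({0<..<t} \<times> UNIV) p *\<^sub>R (case p of (s, x) \<Rightarrow> P (t - s) (f s) x))
      = (\<lambda>(s, x). indicator {0<..<t} s * P (t - s) (f s) x)"
    by (auto simp: fun_eq_iff indicator_def)
  ultimately show ?thesis by (simp add: borel_prod)
qed

lemma duhamel_bound:
  assumes "t \<le> T" "0 < s" "s < t"
  shows "\<bar>P (t - s) (f s) x\<bar> \<le> F0"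
  by (rule P_bound) (use assms f_measurable f_bound in auto)

lemma duhamel_integrable:
  assumes t: "t \<le> T" and ab: "0 \<le> a" "a \<le> b" "b \<le> t"
  shows "integrable lborel (\<lambda>s. indicator {a<..<b} s * P (t - s) (f s) x)"
proof (rule Bochner_Integration.integrable_bound)
  show "integrable lborel (\<lambda>s. indicator {a<..<b} s * F0)" using ab by (intro integrable_mult_left) simp
  have "(\<lambda>s. (\<lambda>(s, x). indicator {0<..<t} s * P (t - s) (f s) x) (s, x)) \<in> borel_measurable borel"
    by (rule measurable_compose[OF _ duhamel_measurable[OF t]]) measurable
  then have m: "(\<lambda>s. indicator {0<..<t} s * P (t - s) (f s) x) \<in> borel_measurable borel"
    unfolding prod.case .
  have "(\<lambda>s. indicator {a<..<b} s * (indicator {0<..<t} s * P (t - s) (f s) x)) \<in> borel_measurable borel"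
    by (rule borel_measurable_times[OF _ m]) simp
  also have "(\<lambda>s. indicator {a<..<b} s * (indicator {0<..<t} s * P (t - s) (f s) x)) = (\<lambda>s. indicator {a<..<b} s * P (t - s) (f s) x)"
    using ab by (auto simp: indicator_def fun_eq_iff)
  finally show "(\<lambda>s. indicator {a<..<b} s * P (t - s) (f s) x) \<in> borel_measurable lborel" by simp
  show "AE s in lborel. norm (indicator {a<..<b} s * P (t - s) (f s) x) \<le> norm (indicator {a<..<b} s * F0)"
    using duhamel_bound[OF t] ab F0 by (intro AE_I2) (auto simp: indicator_def)
qed

text \<open>Restarting the mild formula at time \<open>t\<close>: this is where the semigroup property enters.\<close>

lemma duhamel_restart:
  assumes t: "0 \<le> t" and h: "0 < h" "t + h \<le> T"
  shows "u (t + h) x = P h (u t) x + (LINT s|lborel. indicator {t<..<t + h} s * P (t + h - s) (f s) x)"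
proof (cases "t = 0")
  case True
  then show ?thesis using mild[of h x] h by simp
next
  case False
  then have t: "0 < t" "t \<le> T" using t h by auto
  interpret N: prob_space "\<nu> h" using h(1) by (rule prob)
  note u0 = holder_classD[OF u_class[of 0]]
  have u0c: "continuous_on UNIV (u 0)" "\<And>x. \<bar>u 0 x\<bar> \<le> S" using u0 T by auto
  have u0m: "u 0 \<in> borel_measurable borel" using u0c by (intro borel_measurable_continuous_onI)
  have Pm: "P t (u 0) \<in> borel_measurable borel"
    by (intro borel_measurable_continuous_onI P_continuous[OF t(1) u0c])
  have Pb: "\<bar>P t (u 0) y\<bar> \<le> S" for y by (rule P_bound[OF t(1) u0m u0c(2)])
  let ?q = "\<lambda>y s. indicator {0<..<t} s * P (t - s) (f s) (x - y)"
  have qm: "(\<lambda>(y, s). ?q y s) \<in> borel_measurable (\<nu> h \<Otimes>\<^sub>M lborel)"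
  proof -
    have "(\<lambda>p. (\<lambda>(s, x). indicator {0<..<t} s * P (t - s) (f s) x) (snd p, x - fst p)) \<in> borel_measurable (\<nu> h \<Otimes>\<^sub>M lborel)"
      by (rule measurable_compose[OF _ duhamel_measurable[OF t(2)]]) measurable
    then show ?thesis by (simp add: case_prod_beta')
  qed
  have gi: "integrable (\<nu> h) (\<lambda>y. 1 :: real)" by simp
  have hi: "integrable lborel (\<lambda>s. indicator {0<..<t} s * F0)" using t by (intro integrable_mult_left) simp
  have qb: "norm (?q y s) \<le> 1 * (indicator {0<..<t} s * F0)" for y s
    using duhamel_bound[OF t(2), of s "x - y"] by (auto simp: indicator_def)
  note fub = Fubini_product_bound[OF N.sigma_finite_measure_axioms sigma_finite_lborel qm gi hi qb]
  have "P h (u t) x = (LINT y|\<nu> h. P t (u 0) (x - y) + (LINT s|lborel. ?q y s))"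
    unfolding P_def[of h] using mild[OF t] by simp
  also have "\<dots> = (LINT y|\<nu> h. P t (u 0) (x - y)) + (LINT y|\<nu> h. LINT s|lborel. ?q y s)"
    by (rule Bochner_Integration.integral_add[OF P_integrable[OF h(1) Pm Pb] fub(2)])
  also have "(LINT y|\<nu> h. P t (u 0) (x - y)) = P (t + h) (u 0) x"
    using P_add[OF h(1) t(1) u0c, of x] by (simp add: P_def[of h] add.commute)
  also have "(LINT y|\<nu> h. LINT s|lborel. ?q y s) = (LINT s|lborel. LINT y|\<nu> h. ?q y s)"
    by (rule fub(1))
  also have "\<dots> = (LINT s|lborel. indicator {0<..<t} s * P (t + h - s) (f s) x)"
  proof (intro Bochner_Integration.integral_cong refl)
    fix s
    show "(LINT y|\<nu> h. ?q y s) = indicator {0<..<t} s * P (t + h - s) (f s) x"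
    proof (cases "s \<in> {0<..<t}")
      case True
      then have "P (h + (t - s)) (f s) x = P h (P (t - s) (f s)) x"
        using t h by (intro P_add[where B=F0] f_continuous f_bound) auto
      also have "h + (t - s) = t + h - s" by simp
      finally show ?thesis using True by (simp add: P_def[of h])
    qed simp
  qed
  finally have "P h (u t) x = P (t + h) (u 0) x + (LINT s|lborel. indicator {0<..<t} s * P (t + h - s) (f s) x)" .
  moreover have "u (t + h) x = P (t + h) (u 0) x + (LINT s|lborel. indicator {0<..<t + h} s * P (t + h - s) (f s) x)"
    using mild[of "t + h" x] t h by simp
  moreover have "(LINT s|lborel. indicator {0<..<t + h} s * P (t + h - s) (f s) x)
      = (LINT s|lborel. indicator {0<..<t} s * P (t + h - s) (f s) x) + (LINT s|lborel. indicator {t<..<t + h} s * P (t + h - s) (f s) x)"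
    using t h by (intro Ioo_split_AE duhamel_integrable) auto
  ultimately show ?thesis by simp
qed

abbreviation Lu :: "real \<Rightarrow> 'a \<Rightarrow> real" where
  "Lu t \<equiv> levy_op \<mu> (u t) (V t)"

lemma Lu_measurable: "0 \<le> t \<Longrightarrow> t \<le> T \<Longrightarrow> Lu t \<in> borel_measurable borel"
  by (intro borel_measurable_continuous_onI levy_op_continuous[OF u_class])

lemma Lu_bound: "0 \<le> t \<Longrightarrow> t \<le> T \<Longrightarrow> \<bar>Lu t x\<bar> \<le> 4 * S * jump_const"
  using levy_op_class_bound[OF u_class, of t x] mult_nonneg_nonneg[OF S_nonneg jump_const_nonneg] by simp

lemma Lu_holder: "0 \<le> t \<Longrightarrow> t \<le> T \<Longrightarrow> \<bar>Lu t x - Lu t y\<bar> \<le> 4 * S * jump_const * norm (x - y) powr \<beta>"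
  by (rule levy_op_holder[OF u_class])

lemma increment_formula:
  assumes t: "0 \<le> t" and h: "0 < h" "t + h \<le> T"
  shows "u (t + h) x - u t x = (LINT s|lborel. indicator {0<..<h} s * P s (Lu t) x)
    + (LINT s|lborel. indicator {t<..<t + h} s * P (t + h - s) (f s) x)"
  using duhamel_restart[OF assms, of x] generator_formula(2)[OF h(1) class_jet[OF u_class[of t]], of x] t h by simp

definition time_lip :: real where
  "time_lip = 4 * S * jump_const + F0"

lemma time_lip_nonneg: "0 \<le> time_lip"
  using S_nonneg jump_const_nonneg F0 by (simp add: time_lip_def)

lemma increment_sup:
  assumes t: "0 \<le> t" and h: "0 < h" "t + h \<le> T"
  shows "\<bar>u (t + h) x - u t x\<bar> \<le> h * time_lip"
proof -
  have "\<bar>LINT s|lborel. indicator {0<..<h} s * P s (Lu t) x\<bar> \<le> (h - 0) * (4 * S * jump_const)"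
    using S_nonneg jump_const_nonneg t h
    by (intro integral_indicator_Ioo_bound P_bound Lu_measurable Lu_bound) auto
  moreover have "\<bar>LINT s|lborel. indicator {t<..<t + h} s * P (t + h - s) (f s) x\<bar> \<le> (t + h - t) * F0"
    using t h F0 by (intro integral_indicator_Ioo_bound duhamel_bound) auto
  ultimately show ?thesis
    unfolding increment_formula[OF assms] time_lip_def by (simp add: algebra_simps)
qed

text \<open>Both integrands inherit the Hoelder bound in space, since the semigroup commutes with
  translations and is a contraction.\<close>

lemma increment_holder:
  assumes t: "0 \<le> t" and h: "0 < h" "t + h \<le> T"
  shows "\<bar>(u (t + h) x - u t x) - (u (t + h) y - u t y)\<bar> \<le> h * time_lip * norm (x - y) powr \<beta>"
proof -
  let ?n = "norm (x - y) powr \<beta>"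
  have tT: "t \<le> T" using h by simp
  note j = class_jet[OF u_class[OF t tT]]
  have i1: "integrable lborel (\<lambda>s. indicator {0<..<h} s * P s (Lu t) z)" for z
    by (rule generator_formula(1)[OF h(1) j])
  have i2: "integrable lborel (\<lambda>s. indicator {t<..<t + h} s * P (t + h - s) (f s) z)" for z
    using t h by (intro duhamel_integrable) auto
  have e1: "(LINT s|lborel. indicator {0<..<h} s * P s (Lu t) x) - (LINT s|lborel. indicator {0<..<h} s * P s (Lu t) y)
    = (LINT s|lborel. indicator {0<..<h} s * (P s (Lu t) x - P s (Lu t) y))"
    by (subst Bochner_Integration.integral_diff[OF i1 i1, symmetric]) (simp add: right_diff_distrib)
  have e2: "(LINT s|lborel. indicator {t<..<t + h} s * P (t + h - s) (f s) x) - (LINT s|lborel. indicator {t<..<t + h} s * P (t + h - s) (f s) y)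
    = (LINT s|lborel. indicator {t<..<t + h} s * (P (t + h - s) (f s) x - P (t + h - s) (f s) y))"
    by (subst Bochner_Integration.integral_diff[OF i2 i2, symmetric]) (simp add: right_diff_distrib)
  have "\<bar>LINT s|lborel. indicator {0<..<h} s * (P s (Lu t) x - P s (Lu t) y)\<bar> \<le> (h - 0) * (4 * S * jump_const * ?n)"
    using S_nonneg jump_const_nonneg h
    by (intro integral_indicator_Ioo_bound P_space_holder[OF _ Lu_measurable[OF t tT] Lu_bound[OF t tT] Lu_holder[OF t tT]]) auto
  moreover have "\<bar>LINT s|lborel. indicator {t<..<t + h} s * (P (t + h - s) (f s) x - P (t + h - s) (f s) y)\<bar> \<le> (t + h - t) * (F0 * ?n)"
  proof (rule integral_indicator_Ioo_bound)
    fix s assume "t < s" "s < t + h"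
    then show "\<bar>P (t + h - s) (f s) x - P (t + h - s) (f s) y\<bar> \<le> F0 * ?n"
      using t h by (intro P_space_holder[OF _ f_measurable f_bound f_holder]) auto
  qed (use h F0 in auto)
  ultimately show ?thesis
    unfolding increment_formula[OF assms] time_lip_def using e1 e2 by (simp add: algebra_simps)
qed

definition slice_const :: real where
  "slice_const = 2 * S + time_lip"

lemma slice_const_nonneg: "0 \<le> slice_const"
  using S_nonneg time_lip_nonneg by (simp add: slice_const_def)

text \<open>Differences of time slices are small in \<open>C\<^sup>\<beta>\<close> and bounded in \<open>C\<^sup>\<gamma>\<close>. Interpolation between
  these two facts yields the regularity in time of the space derivatives and of \<open>Lu\<close>.\<close>

lemma slice_difference:
  assumes st: "0 \<le> s" "s \<le> T" "0 \<le> t" "t \<le> T" "s \<noteq> t"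
  defines "r \<equiv> \<bar>s - t\<bar> powr (1 / \<alpha>)"
  shows "holder_class \<gamma> slice_const (\<lambda>x. u s x - u t x) (\<lambda>x. V s x - V t x) (\<lambda>x. W s x - W t x)"
    and "0 < r" and "r powr \<alpha> = \<bar>s - t\<bar>"
    and "\<bar>u s x - u t x\<bar> \<le> slice_const * r powr \<alpha>"
    and "\<bar>(u s x - u t x) - (u s y - u t y)\<bar> \<le> slice_const * r powr \<alpha> * norm (x - y) powr \<beta>"
proof -
  show r: "0 < r" "r powr \<alpha> = \<bar>s - t\<bar>" using st alpha by (auto simp: r_def powr_powr)
  have ES: "time_lip \<le> slice_const" using S_nonneg by (simp add: slice_const_def)
  show "holder_class \<gamma> slice_const (\<lambda>x. u s x - u t x) (\<lambda>x. V s x - V t x) (\<lambda>x. W s x - W t x)"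
    using time_lip_nonneg st by (intro holder_class_mono[OF holder_class_diff[OF u_class u_class]]) (auto simp: slice_const_def)
  have *: "\<bar>u b x - u a x\<bar> \<le> time_lip * (b - a)" "\<bar>(u b x - u a x) - (u b y - u a y)\<bar> \<le> time_lip * (b - a) * norm (x - y) powr \<beta>"
    if "0 \<le> a" "a < b" "b \<le> T" for a b
    using increment_sup[of a "b - a" x] increment_holder[of a "b - a" x y] that by (simp_all add: mult.commute)
  have 1: "\<bar>u s x - u t x\<bar> \<le> time_lip * \<bar>s - t\<bar>"
    using *(1)[of s t] *(1)[of t s] st by (cases "s < t") (auto simp: abs_minus_commute)
  have 2: "\<bar>(u s x - u t x) - (u s y - u t y)\<bar> \<le> time_lip * \<bar>s - t\<bar> * norm (x - y) powr \<beta>"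
  proof (cases "s < t")
    case True
    have "\<bar>(u s x - u t x) - (u s y - u t y)\<bar> = \<bar>(u t x - u s x) - (u t y - u s y)\<bar>" by linarith
    then show ?thesis using *(2)[of s t] True st by simp
  next
    case False
    then show ?thesis using *(2)[of t s] st by simp
  qed
  have "time_lip * \<bar>s - t\<bar> \<le> slice_const * \<bar>s - t\<bar>" using ES by (intro mult_right_mono) auto
  then show "\<bar>u s x - u t x\<bar> \<le> slice_const * r powr \<alpha>"
    using 1 unfolding r(2) by linarith
  have "time_lip * \<bar>s - t\<bar> * norm (x - y) powr \<beta> \<le> slice_const * \<bar>s - t\<bar> * norm (x - y) powr \<beta>"
    using ES by (intro mult_right_mono) auto
  then show "\<bar>(u s x - u t x) - (u s y - u t y)\<bar> \<le> slice_const * r powr \<alpha> * norm (x - y) powr \<beta>"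
    using 2 unfolding r(2) by linarith
qed

lemma slice_regularity:
  assumes st: "0 \<le> s" "s \<le> T" "0 \<le> t" "t \<le> T"
  shows gradient_time: "norm (V s x - V t x) \<le> 5 * slice_const * \<bar>s - t\<bar> powr ((\<gamma> - 1) / \<alpha>)"
    and hessian_time: "2 < \<gamma> \<Longrightarrow> norm (W s x - W t x) \<le> 4 * slice_const * \<bar>s - t\<bar> powr ((\<gamma> - 2) / \<alpha>)"
    and Lu_time: "\<bar>s - t\<bar> < 1 \<Longrightarrow> \<bar>Lu s x - Lu t x\<bar> \<le> 10 * slice_const * jump_const * \<bar>s - t\<bar> powr (\<beta> / \<alpha>)"
proof -
  define r where "r = \<bar>s - t\<bar> powr (1 / \<alpha>)"
  have p: "r powr a = \<bar>s - t\<bar> powr (a / \<alpha>)" for a by (simp add: r_def powr_powr)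
  note d = slice_difference[OF st, folded r_def]
  note i = interpolation[OF d(1) gamma_bounds gamma(2,1) d(2) d(5)]
  show "norm (V s x - V t x) \<le> 5 * slice_const * \<bar>s - t\<bar> powr ((\<gamma> - 1) / \<alpha>)"
    using i(1)[of x] unfolding p by (cases "s = t") auto
  show "norm (W s x - W t x) \<le> 4 * slice_const * \<bar>s - t\<bar> powr ((\<gamma> - 2) / \<alpha>)" if "2 < \<gamma>"
    using i(2)[of x] that unfolding p by (cases "s = t") auto
  show "\<bar>Lu s x - Lu t x\<bar> \<le> 10 * slice_const * jump_const * \<bar>s - t\<bar> powr (\<beta> / \<alpha>)" if "\<bar>s - t\<bar> < 1"
  proof (cases "s = t")
    case False
    have "r < 1" using that alpha powr_less_mono2[of "1 / \<alpha>" "\<bar>s - t\<bar>" 1] by (simp add: r_def)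
    then have "\<bar>levy_op \<mu> (\<lambda>x. u s x - u t x) (\<lambda>x. V s x - V t x) x\<bar> \<le> 10 * slice_const * jump_const * r powr \<beta>"
      using False by (intro levy_op_small[OF d(1) d(2) _ d(5) d(4)]) auto
    then show ?thesis unfolding levy_op_diff[OF u_class[OF st(1,2)] u_class[OF st(3,4)]] p .
  qed simp
qed

text \<open>By the increment formula the forward difference quotients at \<open>t\<close> converge to \<open>Lu t + f t\<close> with a
  rate that is uniform in \<open>t\<close>. A backward quotient at \<open>t\<close> is a forward quotient at the earlier time, so it
  has the same limit because \<open>Lu + f\<close> is continuous in time.\<close>

lemma time_derivative:
  assumes f_time: "\<And>s t x. 0 \<le> s \<Longrightarrow> s \<le> T \<Longrightarrow> 0 \<le> t \<Longrightarrow> t \<le> T \<Longrightarrow> \<bar>s - t\<bar> < 1 \<Longrightarrow> \<bar>f s x - f t x\<bar> \<le> F1 * \<bar>s - t\<bar> powr (\<beta> / \<alpha>)"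
    and t: "0 \<le> t" "t \<le> T"
  shows "((\<lambda>s. u s x) has_real_derivative (Lu t x + f t x)) (at t within {0..T})"
proof -
  define A where "A = 4 * S * jump_const"
  define K where "K = \<bar>F1\<bar> + 10 * slice_const * jump_const"
  have A: "0 \<le> A" using S_nonneg jump_const_nonneg by (simp add: A_def)
  have K: "0 \<le> K" using slice_const_nonneg jump_const_nonneg by (simp add: K_def)
  let ?F = "\<lambda>t. Lu t x + f t x"
  have small: "\<exists>d>0. \<forall>h. 0 < h \<longrightarrow> h < d \<longrightarrow> C * h powr (\<beta> / \<alpha>) < e" if e: "0 < e" for C e
  proof -
    have "((\<lambda>h. C * h powr (\<beta> / \<alpha>)) \<longlongrightarrow> C * 0 powr (\<beta> / \<alpha>)) (at_right 0)"
      using alpha beta by (intro tendsto_intros tendsto_powr' ) (auto simp: eventually_at_right_less intro!: eventually_at_right_less[THEN eventually_mono])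
    then have "((\<lambda>h. C * h powr (\<beta> / \<alpha>)) \<longlongrightarrow> 0) (at_right 0)" by simp
    then have "\<forall>\<^sub>F h in at_right 0. C * h powr (\<beta> / \<alpha>) < e" using e by (rule order_tendstoD)
    then show ?thesis unfolding eventually_at_right[OF zero_less_one] by auto
  qed
  have F_time: "\<bar>?F s - ?F t\<bar> \<le> K * \<bar>s - t\<bar> powr (\<beta> / \<alpha>)" if "0 \<le> s" "s \<le> T" "0 \<le> t" "t \<le> T" "\<bar>s - t\<bar> < 1" for s t
  proof -
    have "F1 * \<bar>s - t\<bar> powr (\<beta> / \<alpha>) \<le> \<bar>F1\<bar> * \<bar>s - t\<bar> powr (\<beta> / \<alpha>)" by (intro mult_right_mono) auto
    then show ?thesis
      using Lu_time[OF that, of x] f_time[OF that, of x] unfolding K_def distrib_right by linarith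
  qed
  have key: "\<exists>d>0. \<forall>t h. 0 \<le> t \<longrightarrow> 0 < h \<longrightarrow> h < d \<longrightarrow> t + h \<le> T \<longrightarrow> \<bar>u (t + h) x - u t x - h * ?F t\<bar> \<le> h * e"
    if e: "0 < e" for e
  proof -
    have "0 < e / (2 * (A + F0 + 1))" using e A F0 by simp
    then obtain d1 where d1: "0 < d1" "\<And>h. 0 < h \<Longrightarrow> h < d1 \<Longrightarrow> spread \<beta> h < e / (2 * (A + F0 + 1))"
      by (rule spread_small) blast
    obtain d2 where d2: "0 < d2" "\<And>h. 0 < h \<Longrightarrow> h < d2 \<Longrightarrow> \<bar>F1\<bar> * h powr (\<beta> / \<alpha>) < e / 2"
      using small[of "e / 2" "\<bar>F1\<bar>"] e by auto
    show ?thesis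
    proof (intro exI[of _ "min 1 (min d1 d2)"] conjI allI impI)
      show "0 < min 1 (min d1 d2)" using d1 d2 by simp
      fix t h assume t: "0 \<le> t" and h: "0 < h" "h < min 1 (min d1 d2)" "t + h \<le> T"
      have tT: "t \<le> T" using h by simp
      note Lm = Lu_measurable[OF t tT] and Lb = Lu_bound[OF t tT, folded A_def] and Lh = Lu_holder[OF t tT, folded A_def]
      \<comment> \<open>The share of the error left to the spread of the kernel: its coefficient below is \<open>A + F0\<close>.\<close>
      define e' where "e' = e / (2 * (A + F0 + 1))"
      have e': "0 < e'" "(A + F0) * e' \<le> e / 2"
      proof -
        show "0 < e'" using e A F0 by (simp add: e'_def)
        then have "(A + F0) * e' \<le> (A + F0 + 1) * e'" by (intro mult_right_mono) auto
        also have "\<dots> = e / 2" using A F0 by (simp add: e'_def field_simps)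
        finally show "(A + F0) * e' \<le> e / 2" .
      qed
      have sp: "spread \<beta> s \<le> e'" if "0 < s" "s < h" for s
        using d1(2)[of s] that h by (simp add: e'_def)
      have i0: "integrable lborel (\<lambda>s. indicator {a<..<b} s * C)" if "a \<le> b" for a b C :: real
        using that by (intro integrable_mult_left) simp
      have i1: "integrable lborel (\<lambda>s. indicator {0<..<h} s * P s (Lu t) x)"
        by (rule generator_formula(1)[OF h(1) class_jet[OF u_class[OF t tT]]])
      have i2: "integrable lborel (\<lambda>s. indicator {t<..<t + h} s * P (t + h - s) (f s) x)"
        using t h by (intro duhamel_integrable) auto
      have c: "(LINT s|lborel. indicator {a<..<a + h} s * C) = h * C" for a C :: real
        using h by simp
      have "(LINT s|lborel. indicator {0<..<h} s * P s (Lu t) x) - h * Lu t x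
          = (LINT s|lborel. indicator {0<..<h} s * (P s (Lu t) x - Lu t x))"
        unfolding right_diff_distrib
        using Bochner_Integration.integral_diff[OF i1 i0[of 0 h "Lu t x"]] c[of 0 "Lu t x"] h by simp
      moreover have "\<bar>LINT s|lborel. indicator {0<..<h} s * (P s (Lu t) x - Lu t x)\<bar> \<le> (h - 0) * (A * e')"
      proof (rule integral_indicator_Ioo_bound)
        fix s assume s: "0 < s" "s < h"
        have "\<bar>P s (Lu t) x - Lu t x\<bar> \<le> A * spread \<beta> s" by (rule P_modulus[OF s(1) Lm Lb Lh])
        also have "\<dots> \<le> A * e'" using sp[OF s] A by (intro mult_left_mono)
        finally show "\<bar>P s (Lu t) x - Lu t x\<bar> \<le> A * e'" .
      qed (use h A e' in auto)
      moreover have "(LINT s|lborel. indicator {t<..<t + h} s * P (t + h - s) (f s) x) - h * f t x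
          = (LINT s|lborel. indicator {t<..<t + h} s * (P (t + h - s) (f s) x - f t x))"
        unfolding right_diff_distrib
        using Bochner_Integration.integral_diff[OF i2 i0[of t "t + h" "f t x"]] c[of t "f t x"] h by simp
      moreover have "\<bar>LINT s|lborel. indicator {t<..<t + h} s * (P (t + h - s) (f s) x - f t x)\<bar> \<le> (t + h - t) * (F0 * e' + e / 2)"
      proof (rule integral_indicator_Ioo_bound)
        fix s assume s: "t < s" "s < t + h"
        have s0: "0 < s" "s \<le> T" "0 < t + h - s" "t + h - s < h" using s t h by auto
        have "\<bar>P (t + h - s) (f s) x - f s x\<bar> \<le> F0 * spread \<beta> (t + h - s)"
          by (rule P_modulus[OF s0(3) f_measurable[OF s0(1,2)] f_bound[OF s0(1,2)] f_holder[OF s0(1,2)]])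
        also have "\<dots> \<le> F0 * e'" using sp[OF s0(3,4)] F0 by (intro mult_left_mono)
        finally have 1: "\<bar>P (t + h - s) (f s) x - f s x\<bar> \<le> F0 * e'" .
        have "\<bar>f s x - f t x\<bar> \<le> F1 * \<bar>s - t\<bar> powr (\<beta> / \<alpha>)" using s s0 t tT h by (intro f_time) auto
        also have "\<dots> \<le> \<bar>F1\<bar> * \<bar>s - t\<bar> powr (\<beta> / \<alpha>)" by (intro mult_right_mono) auto
        also have "\<dots> \<le> e / 2" using d2(2)[of "\<bar>s - t\<bar>"] s h by auto
        finally show "\<bar>P (t + h - s) (f s) x - f t x\<bar> \<le> F0 * e' + e / 2" using 1 by linarith
      qed (use h F0 e' e in auto)
      ultimately have "\<bar>u (t + h) x - u t x - h * ?F t\<bar> \<le> h * (A * e') + h * (F0 * e' + e / 2)"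
        unfolding increment_formula[OF t h(1,3)] by (simp add: distrib_left)
      also have "\<dots> = h * ((A + F0) * e' + e / 2)" by (simp add: algebra_simps)
      also have "\<dots> \<le> h * e" using e' h by (intro mult_left_mono) auto
      finally show "\<bar>u (t + h) x - u t x - h * ?F t\<bar> \<le> h * e" .
    qed
  qed
  show ?thesis
    unfolding has_field_derivative_iff
  proof (rule tendstoI)
    fix e :: real assume e: "0 < e"
    obtain d1 where d1: "0 < d1" "\<And>t h. 0 \<le> t \<Longrightarrow> 0 < h \<Longrightarrow> h < d1 \<Longrightarrow> t + h \<le> T \<Longrightarrow> \<bar>u (t + h) x - u t x - h * ?F t\<bar> \<le> h * (e / 3)"
      using key[of "e / 3"] e by auto
    obtain d2 where d2: "0 < d2" "\<And>h. 0 < h \<Longrightarrow> h < d2 \<Longrightarrow> K * h powr (\<beta> / \<alpha>) < e / 3"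
      using small[of "e / 3" K] e by auto
    have near: "\<bar>(u y x - u t x) / (y - t) - ?F t\<bar> < e" if y: "0 \<le> y" "y \<le> T" "y \<noteq> t" "\<bar>y - t\<bar> < min 1 (min d1 d2)" for y
    proof (cases "t < y")
      case True
      define h where "h = y - t"
      have h: "0 < h" "y = t + h" using True by (auto simp: h_def)
      have "\<bar>u y x - u t x - h * ?F t\<bar> \<le> h * (e / 3)"
        using d1(2)[of t h] h y t by simp
      moreover have "(u y x - u t x) / (y - t) - ?F t = (u y x - u t x - h * ?F t) / h"
        using h by (simp add: field_simps)
      ultimately have "\<bar>(u y x - u t x) / (y - t) - ?F t\<bar> \<le> e / 3"
        using h by (simp add: abs_divide divide_le_eq mult.commute)
      then show ?thesis using e by linarith
    next
      case False
      define h where "h = t - y"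
      have h: "0 < h" "t = y + h" using False y by (auto simp: h_def)
      have "\<bar>u t x - u y x - h * ?F y\<bar> \<le> h * (e / 3)"
        using d1(2)[of y h] h y t by simp
      moreover have "(u y x - u t x) / (y - t) - ?F y = (u t x - u y x - h * ?F y) / h"
        using h by (simp add: field_simps)
      ultimately have 1: "\<bar>(u y x - u t x) / (y - t) - ?F y\<bar> \<le> e / 3"
        using h by (simp add: abs_divide divide_le_eq mult.commute)
      have "\<bar>?F y - ?F t\<bar> \<le> K * \<bar>y - t\<bar> powr (\<beta> / \<alpha>)" using F_time[of y t] y t by simp
      also have "\<dots> < e / 3" using d2(2)[of "\<bar>y - t\<bar>"] y by simp
      finally show ?thesis using 1 e by linarith
    qed
    show "\<forall>\<^sub>F y in at t within {0..T}. dist ((u y x - u t x) / (y - t)) (?F t) < e"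
      unfolding eventually_at
    proof (intro exI[of _ "min 1 (min d1 d2)"] conjI ballI impI)
      show "0 < min 1 (min d1 d2)" using d1 d2 by simp
    qed (use near in \<open>auto simp: dist_real_def\<close>)
  qed
qed

end

section \<open>Norms and derivatives in coordinates\<close>

lemma dirs_0: "dirs 0 = {[]}"
  by (auto simp: dirs_def)

lemma dirs_1: "dirs (Suc 0) = (\<lambda>b. [b]) ` Basis"
  by (auto simp: dirs_def length_Suc_conv)

lemma dirs_2: "dirs 2 = (\<lambda>(a, b). [a, b]) ` (Basis \<times> Basis)"
  by (auto simp: dirs_def length_Suc_conv numeral_2_eq_2)

lemma pair_in_dirs_2: "a \<in> Basis \<Longrightarrow> b \<in> Basis \<Longrightarrow> [a, b] \<in> dirs 2"
  by (simp add: dirs_def)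

lemma sup_norm_le_iff: "0 \<le> K \<Longrightarrow> sup_norm S f \<le> ennreal K \<longleftrightarrow> (\<forall>x\<in>S. norm (f x) \<le> K)"
  by (auto simp: sup_norm_def SUP_le_iff)

lemma holder_seminorm_le_iff:
  assumes "0 \<le> K"
  shows "holder_seminorm \<gamma> S f \<le> ennreal K \<longleftrightarrow> (\<forall>x\<in>S. \<forall>y\<in>S. norm (f x - f y) \<le> K * dist x y powr \<gamma>)"
proof -
  have "norm (f x - f y) / dist x y powr \<gamma> \<le> K \<longleftrightarrow> norm (f x - f y) \<le> K * dist x y powr \<gamma>" if "x \<noteq> y" for x y
    using that by (simp add: divide_le_eq)
  moreover have "norm (f x - f x) \<le> K * dist x x powr \<gamma>" for x by simp
  ultimately have "(\<forall>x\<in>S. \<forall>y\<in>S. x \<noteq> y \<longrightarrow> norm (f x - f y) / dist x y powr \<gamma> \<le> K)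
      \<longleftrightarrow> (\<forall>x\<in>S. \<forall>y\<in>S. norm (f x - f y) \<le> K * dist x y powr \<gamma>)"
    by metis
  then show ?thesis
    using assms unfolding holder_seminorm_def by (auto simp: SUP_le_iff)
qed

lemma Cb_norm_leD:
  assumes "0 \<le> K"
  shows "Cb_norm n S f \<le> ennreal K \<Longrightarrow> Ck_on n S f"
    and "Cb_norm n S f \<le> ennreal K \<Longrightarrow> j \<le> n \<Longrightarrow> bs \<in> dirs j \<Longrightarrow> x \<in> S \<Longrightarrow> \<bar>part_derivs S bs f x\<bar> \<le> K"
proof -
  assume le: "Cb_norm n S f \<le> ennreal K"
  then show "Ck_on n S f" by (auto simp: Cb_norm_def top_unique split: if_splits)
  assume j: "j \<le> n" "bs \<in> dirs j" "x \<in> S"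
  have "sup_norm S (part_derivs S bs f) \<le> (SUP bs\<in>dirs j. sup_norm S (part_derivs S bs f))"
    using j by (intro SUP_upper)
  also have "\<dots> \<le> (\<Sum>j\<le>n. SUP bs\<in>dirs j. sup_norm S (part_derivs S bs f))"
    using j by (intro member_le_sum) auto
  also have "\<dots> \<le> ennreal K" using le by (auto simp: Cb_norm_def top_unique split: if_splits)
  finally show "\<bar>part_derivs S bs f x\<bar> \<le> K" using j assms by (simp add: sup_norm_le_iff)
qed

lemma part_derivs_simps [simp]:
  "part_derivs S [] f = f" "part_derivs S [b] f = part_deriv S b f"
  "part_derivs S [a, b] f = part_deriv S a (part_deriv S b f)"
  by (simp_all add: part_derivs_def)

lemma grad_inner_Basis: "b \<in> Basis \<Longrightarrow> grad f x \<bullet> b = part_deriv UNIV b f x"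
  by (auto simp: Basis_vec_def grad_def inner_axis)

lemma differentiable_has_grad:
  fixes f :: "real^'d \<Rightarrow> real"
  assumes "f differentiable (at x)"
  shows "(f has_derivative (\<lambda>h. grad f x \<bullet> h)) (at x)"
proof -
  have d: "(f has_derivative frechet_derivative f (at x)) (at x)"
    using assms by (simp add: frechet_derivative_works)
  interpret bounded_linear "frechet_derivative f (at x)" using d by (rule has_derivative_bounded_linear)
  have "frechet_derivative f (at x) h = grad f x \<bullet> h" for h
  proof -
    have "frechet_derivative f (at x) h = frechet_derivative f (at x) (\<Sum>b\<in>Basis. (h \<bullet> b) *\<^sub>R b)"
      by (simp only: euclidean_representation)
    also have "\<dots> = (\<Sum>b\<in>Basis. (h \<bullet> b) * part_deriv UNIV b f x)"
      by (simp add: sum scaleR part_deriv_def)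
    also have "\<dots> = grad f x \<bullet> h"
      by (subst euclidean_inner) (simp add: grad_inner_Basis mult.commute)
    finally show ?thesis .
  qed
  then show ?thesis using d by presburger
qed

lemma part_deriv_eq:
  assumes "(f has_derivative F) (at x)"
  shows "part_deriv UNIV b f x = F b"
  using frechet_derivative_at[OF assms] by (simp add: part_deriv_def)

definition hess :: "(real^'d \<Rightarrow> real) \<Rightarrow> real^'d \<Rightarrow> ((real^'d) \<Rightarrow>\<^sub>L (real^'d))" where
  "hess f x = Blinfun (frechet_derivative (grad f) (at x))"

lemma hess_derivative:
  fixes f :: "real^'d \<Rightarrow> real"
  assumes "Ck_on 2 UNIV f"
  shows "(grad f has_derivative blinfun_apply (hess f x)) (at x)"
    and "b \<in> Basis \<Longrightarrow> hess f x a \<bullet> b = part_deriv UNIV a (part_deriv UNIV b f) x"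
proof -
  have eq: "(\<lambda>x. grad f x \<bullet> b) = part_deriv UNIV b f" if "b \<in> Basis" for b
    using that by (simp add: grad_inner_Basis fun_eq_iff)
  have "(\<lambda>x. grad f x \<bullet> b) differentiable (at x)" if "b \<in> Basis" for b
    unfolding eq[OF that] using assms that by (auto simp: numeral_2_eq_2 differentiable_on_def)
  then have "grad f differentiable (at x)"
    by (subst differentiable_componentwise_within) auto
  then have d: "(grad f has_derivative frechet_derivative (grad f) (at x)) (at x)"
    by (simp add: frechet_derivative_works)
  have app: "blinfun_apply (hess f x) = frechet_derivative (grad f) (at x)"
    unfolding hess_def by (rule bounded_linear_Blinfun_apply[OF has_derivative_bounded_linear[OF d]])
  show "(grad f has_derivative blinfun_apply (hess f x)) (at x)" using d unfolding app .
  assume b: "b \<in> Basis"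
  have "((\<lambda>x. grad f x \<bullet> b) has_derivative (\<lambda>h. hess f x h \<bullet> b)) (at x)"
    unfolding app using d by (rule has_derivative_inner_left)
  then show "hess f x a \<bullet> b = part_deriv UNIV a (part_deriv UNIV b f) x"
    unfolding eq[OF b] by (rule part_deriv_eq[symmetric])
qed

lemma norm_le_from_coordinates:
  fixes v :: "real^'d"
  assumes "\<And>b. b \<in> Basis \<Longrightarrow> \<bar>v \<bullet> b\<bar> \<le> K"
  shows "norm v \<le> real CARD('d) * K"
proof -
  have "norm v \<le> (\<Sum>b\<in>Basis. \<bar>v \<bullet> b\<bar>)" by (rule norm_le_l1)
  also have "\<dots> \<le> (\<Sum>b\<in>(Basis :: (real^'d) set). K)" using assms by (intro sum_mono)
  finally show ?thesis by simp
qed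

lemma blinfun_norm_le_from_coordinates:
  fixes F :: "(real^'d) \<Rightarrow>\<^sub>L (real^'d)"
  assumes K: "0 \<le> K" and b: "\<And>a b. a \<in> Basis \<Longrightarrow> b \<in> Basis \<Longrightarrow> \<bar>F a \<bullet> b\<bar> \<le> K"
  shows "norm F \<le> (real CARD('d))\<^sup>2 * K"
proof (rule norm_blinfun_bound)
  show "0 \<le> (real CARD('d))\<^sup>2 * K" using K by simp
  fix h :: "real^'d"
  have "\<bar>F h \<bullet> b\<bar> \<le> real CARD('d) * (norm h * K)" if "b \<in> Basis" for b
  proof -
    have "F h = (\<Sum>a\<in>Basis. (h \<bullet> a) *\<^sub>R F a)"
      by (subst euclidean_representation[of h, symmetric]) (simp only: blinfun.sum_right blinfun.scaleR_right)
    then have "\<bar>F h \<bullet> b\<bar> = \<bar>\<Sum>a\<in>Basis. (h \<bullet> a) * (F a \<bullet> b)\<bar>" by (simp add: inner_sum_left)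
    also have "\<dots> \<le> (\<Sum>a\<in>(Basis :: (real^'d) set). norm h * K)"
      using b[OF _ that] Basis_le_norm[of _ h]
      by (intro order_trans[OF sum_abs] sum_mono) (auto simp: abs_mult intro!: mult_mono)
    finally show ?thesis by simp
  qed
  from norm_le_from_coordinates[OF this] show "norm (F h) \<le> (real CARD('d))\<^sup>2 * K * norm h"
    by (simp add: power2_eq_square mult_ac)
qed

lemma nat_floor_eq: "real n \<le> \<gamma> \<Longrightarrow> \<gamma> < real n + 1 \<Longrightarrow> nat \<lfloor>\<gamma>\<rfloor> = n"
  using floor_unique[of "int n" \<gamma>] by simp

text \<open>Passing from coordinates to Euclidean and operator norms costs a factor of the dimension for each
  derivative, hence at most its square.\<close>

lemma holder_class_from_norm:
  fixes f :: "real^'d \<Rightarrow> real"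
  assumes S: "0 \<le> S" and le: "Cb_holder_norm \<gamma> UNIV f \<le> ennreal S" and \<gamma>: "1 < \<gamma>" "\<gamma> < 3" "\<gamma> \<noteq> 2"
  shows "holder_class \<gamma> ((real CARD('d))\<^sup>2 * S) f (grad f) (hess f)"
proof -
  define n where "n = nat \<lfloor>\<gamma>\<rfloor>"
  have n: "n = (if \<gamma> < 2 then 1 else 2)"
    unfolding n_def using \<gamma> nat_floor_eq[of 1 \<gamma>] nat_floor_eq[of 2 \<gamma>] by auto
  have "Cb_norm n UNIV f \<le> Cb_holder_norm \<gamma> UNIV f"
    unfolding Cb_holder_norm_def n_def Let_def by simp
  then have C: "Cb_norm n UNIV f \<le> ennreal S" using le by (rule order_trans)
  note Ck = Cb_norm_leD(1)[OF S C] and bd = Cb_norm_leD(2)[OF S C]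
  have hol: "\<bar>part_derivs UNIV bs f x - part_derivs UNIV bs f y\<bar> \<le> S * norm (x - y) powr (\<gamma> - real n)"
    if "bs \<in> dirs n" for bs x y
  proof -
    have "holder_seminorm (\<gamma> - real n) UNIV (part_derivs UNIV bs f)
        \<le> (SUP bs\<in>dirs n. holder_seminorm (\<gamma> - real n) UNIV (part_derivs UNIV bs f))"
      using that by (intro SUP_upper)
    also have "\<dots> \<le> Cb_holder_norm \<gamma> UNIV f"
      unfolding Cb_holder_norm_def n_def Let_def by simp
    also note le
    finally show ?thesis using S by (simp add: holder_seminorm_le_iff dist_norm)
  qed
  define d where "d = real CARD('d)"
  have d: "1 \<le> d" unfolding d_def by (simp add: Suc_leI)
  have dd: "d * k \<le> d\<^sup>2 * k" if "0 \<le> k" for k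
    using d that by (intro mult_right_mono) (auto simp: power2_eq_square)
  have d1: "k \<le> d\<^sup>2 * k" if "0 \<le> k" for k
    using d that mult_right_mono[of 1 "d\<^sup>2" k] by (simp add: one_le_power)
  have "holder_class \<gamma> (d\<^sup>2 * S) f (grad f) (hess f)"
    unfolding holder_class_def
  proof (intro conjI allI impI)
    have "f differentiable (at x)" for x
      using Ck n by (cases "\<gamma> < 2") (auto simp: differentiable_on_def numeral_2_eq_2)
    then show "(f has_derivative (\<lambda>h. grad f x \<bullet> h)) (at x)" for x by (rule differentiable_has_grad)
    show "\<bar>f x\<bar> \<le> d\<^sup>2 * S" for x
      using bd[of 0 "[]" x] d1[OF S] by (auto simp: dirs_0)
    have "\<bar>grad f x \<bullet> b\<bar> \<le> S" if "b \<in> Basis" for x b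
      using bd[of "Suc 0" "[b]" x] that n by (auto simp: dirs_1 grad_inner_Basis split: if_splits)
    from norm_le_from_coordinates[OF this] show "norm (grad f x) \<le> d\<^sup>2 * S" for x
      using dd[OF S] unfolding d_def by (meson order_trans)
    show "norm (grad f x - grad f y) \<le> d\<^sup>2 * S * norm (x - y) powr (\<gamma> - 1)" if "\<gamma> < 2" for x y
    proof -
      have "\<bar>(grad f x - grad f y) \<bullet> b\<bar> \<le> S * norm (x - y) powr (\<gamma> - 1)" if "b \<in> Basis" for b
        using hol[of "[b]" x y] that n \<open>\<gamma> < 2\<close> by (auto simp: dirs_1 grad_inner_Basis inner_diff_left)
      from norm_le_from_coordinates[OF this] show ?thesis
        using dd[of "S * norm (x - y) powr (\<gamma> - 1)"] S unfolding d_def by (simp add: mult.assoc)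
    qed
    assume g: "2 < \<gamma>"
    then have n2: "n = 2" using n by simp
    have Ck2: "Ck_on 2 UNIV f" using Ck n2 by simp
    show "(grad f has_derivative blinfun_apply (hess f x)) (at x)" for x
      by (rule hess_derivative(1)[OF Ck2])
    show "norm (hess f x) \<le> d\<^sup>2 * S" for x
      unfolding d_def
    proof (rule blinfun_norm_le_from_coordinates[OF S])
      show "\<bar>hess f x a \<bullet> b\<bar> \<le> S" if "a \<in> Basis" "b \<in> Basis" for a b
        using bd[of 2 "[a, b]" x] pair_in_dirs_2[OF that] that n2 by (simp add: hess_derivative(2)[OF Ck2])
    qed
    show "norm (hess f x - hess f y) \<le> d\<^sup>2 * S * norm (x - y) powr (\<gamma> - 2)" for x y
      unfolding d_def mult.assoc
    proof (rule blinfun_norm_le_from_coordinates)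
      show "\<bar>(hess f x - hess f y) a \<bullet> b\<bar> \<le> S * norm (x - y) powr (\<gamma> - 2)" if "a \<in> Basis" "b \<in> Basis" for a b
        using hol[of "[a, b]" x y] pair_in_dirs_2[OF that] that n2
        by (simp add: hess_derivative(2)[OF Ck2] blinfun.diff_left inner_diff_left)
    qed (use S in simp)
  qed
  then show ?thesis by (simp add: d_def)
qed

lemma holder_norm_Ck:
  fixes f :: "real^'d \<Rightarrow> real"
  assumes "Cb_holder_norm \<gamma> UNIV f < \<infinity>" "2 < \<gamma>" "\<gamma> < 3"
  shows "Ck_on 2 UNIV f"
proof -
  have "nat \<lfloor>\<gamma>\<rfloor> = 2" using assms nat_floor_eq[of 2 \<gamma>] by simp
  then show ?thesis
    using assms(1) by (auto simp: Cb_holder_norm_def Cb_norm_def Let_def split: if_splits)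
qed

lemma part_deriv_interval:
  fixes w :: "real \<Rightarrow> real"
  assumes T: "0 < T" "0 \<le> t" "t \<le> T" and d: "(w has_real_derivative D) (at t within {0..T})"
  shows "part_deriv {0..T} 1 w t = D"
proof -
  have d': "(w has_derivative (*) D) (at t within cbox 0 T)"
    using d by (simp add: has_field_derivative_def)
  then have "w differentiable (at t within cbox 0 T)" by (auto simp: differentiable_def)
  then have "(w has_derivative frechet_derivative w (at t within cbox 0 T)) (at t within cbox 0 T)"
    by (simp add: frechet_derivative_works)
  from frechet_derivative_unique_within_closed_interval[OF _ _ this d'] T
  have "frechet_derivative w (at t within cbox 0 T) = (*) D" by simp
  then show ?thesis by (simp add: part_deriv_def)
qed

section \<open>The space-time norm of a mild solution\<close>

text \<open>By \<open>time_derivative\<close> the time derivative is \<open>F = Lu + f\<close>, and \<open>N\<close> bounds it together with its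
  Hoelder seminorm in space. Hoelder quotients in time over distances of at least one are bounded by
  suprema. The factors \<open>card (dirs k)\<close> come from estimating the Euclidean norm of a tensor by the sum of
  its components.\<close>

lemma spacetime_norm_bound:
  fixes u :: "real \<Rightarrow> real^'d \<Rightarrow> real"
  assumes me: "mild_evolution \<mu> \<nu> \<psi> g \<alpha> \<beta> \<gamma> c T S F0 u (\<lambda>t. grad (u t)) (\<lambda>t. hess (u t)) f"
    and fin: "\<And>t. 0 \<le> t \<Longrightarrow> t \<le> T \<Longrightarrow> Cb_holder_norm \<gamma> UNIV (u t) \<le> ennreal S"
    and f0: "\<And>t x. 0 \<le> t \<Longrightarrow> t \<le> T \<Longrightarrow> \<bar>f t x\<bar> \<le> F0"
    and f1: "\<And>t x y. 0 \<le> t \<Longrightarrow> t \<le> T \<Longrightarrow> \<bar>f t x - f t y\<bar> \<le> F0 * norm (x - y) powr \<beta>"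
    and F1: "0 \<le> F1" and f_time: "\<And>s t x. 0 \<le> s \<Longrightarrow> s \<le> T \<Longrightarrow> 0 \<le> t \<Longrightarrow> t \<le> T \<Longrightarrow> \<bar>s - t\<bar> < 1 \<Longrightarrow>
       \<bar>f s x - f t x\<bar> \<le> F1 * \<bar>s - t\<bar> powr (\<beta> / \<alpha>)"
  defines "N \<equiv> 4 * S * levy_growth.jump_const \<mu> g c + F0"
  shows "spacetime_norm \<alpha> \<beta> T u \<le> ennreal (S + (S + N + (2 * N + 10 * (2 * S + N) * levy_growth.jump_const \<mu> g c + F1)) + N
     + (real (card (dirs 1 :: (real^'d) list set)) + real (card (dirs 2 :: (real^'d) list set))) * (5 * (2 * S + N)))"
proof -
  interpret mild_evolution \<mu> \<nu> \<psi> g \<alpha> \<beta> \<gamma> c T S F0 u "\<lambda>t. grad (u t)" "\<lambda>t. hess (u t)" f by (rule me)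
  have N_eq: "N = mild_evolution.time_lip \<mu> g c S F0" unfolding N_def time_lip_def ..
  let ?j = "levy_growth.jump_const \<mu> g c"
  define F where "F t x = Lu t x + f t x" for t x
  define G where "G = 2 * N + 10 * (2 * S + N) * ?j + F1"
  have E0: "0 \<le> N" unfolding N_eq by (rule time_lip_nonneg)
  have SE: "0 \<le> 2 * S + N" using S_nonneg E0 by simp
  have G0: "0 \<le> G" unfolding G_def using E0 SE jump_const_nonneg F1 by simp
  have slice_const: "slice_const = 2 * S + N" unfolding slice_const_def N_eq ..
  have F_bound: "\<bar>F t x\<bar> \<le> N" if "0 \<le> t" "t \<le> T" for t x
    using Lu_bound[OF that, of x] f0[OF that, of x] unfolding F_def N_def by linarith
  have F_space: "\<bar>F t x - F t y\<bar> \<le> N * norm (x - y) powr \<beta>" if "0 \<le> t" "t \<le> T" for t x y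
    using Lu_holder[OF that, of x y] f1[OF that, of x y] unfolding F_def N_def distrib_right by linarith
  have F_time: "\<bar>F s x - F t x\<bar> \<le> G * \<bar>s - t\<bar> powr (\<beta> / \<alpha>)" if "0 \<le> s" "s \<le> T" "0 \<le> t" "t \<le> T" for s t x
  proof (cases "\<bar>s - t\<bar> < 1")
    case True
    have "\<bar>F s x - F t x\<bar> \<le> (10 * slice_const * ?j + F1) * \<bar>s - t\<bar> powr (\<beta> / \<alpha>)"
      using Lu_time[OF that True, of x] f_time[OF that True, of x] unfolding F_def distrib_right by linarith
    also have "\<dots> \<le> G * \<bar>s - t\<bar> powr (\<beta> / \<alpha>)"
      unfolding G_def slice_const using E0 by (intro mult_right_mono) auto
    finally show ?thesis .
  next
    case False
    have "\<bar>F s x - F t x\<bar> \<le> 2 * N" using F_bound[OF that(1,2), of x] F_bound[OF that(3,4), of x] by linarith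
    also have "\<dots> \<le> G * 1" unfolding G_def using SE jump_const_nonneg F1 by simp
    also have "\<dots> \<le> G * \<bar>s - t\<bar> powr (\<beta> / \<alpha>)"
      using False G0 alpha beta by (intro mult_left_mono ge_one_powr_ge_zero) auto
    finally show ?thesis .
  qed
  have deriv: "((\<lambda>s. u s x) has_real_derivative F t x) (at t within {0..T})" if "0 \<le> t" "t \<le> T" for t x
    unfolding F_def by (rule time_derivative[OF f_time that])
  have td: "part_deriv {0..T} 1 (\<lambda>s. u s x) t = F t x" if "0 \<le> t" "t \<le> T" for t x
    by (rule part_deriv_interval[OF T that deriv[OF that]])
  have A: "(SUP t\<in>{0..T}. Cb_holder_norm (\<alpha> + \<beta>) UNIV (u t)) \<le> ennreal S"
    using fin gamma by (intro SUP_least) auto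
  have B: "Cb_holder_norm ((\<alpha> + \<beta>) / \<alpha>) {0..T} (\<lambda>t. u t x) \<le> ennreal (S + N + G)" for x
  proof -
    have n: "nat \<lfloor>(\<alpha> + \<beta>) / \<alpha>\<rfloor> = 1"
      using alpha beta by (intro nat_floor_eq) (auto simp: field_simps)
    have e: "(\<alpha> + \<beta>) / \<alpha> - real 1 = \<beta> / \<alpha>" using alpha by (simp add: field_simps)
    have dF: "continuous_on {0..T} (\<lambda>t. part_deriv {0..T} 1 (\<lambda>s. u s x) t)"
    proof (rule holder_imp_continuous_on)
      show "0 < \<beta> / \<alpha>" using alpha beta by simp
      show "norm (part_deriv {0..T} 1 (\<lambda>s. u s x) t - part_deriv {0..T} 1 (\<lambda>s. u s x) t') \<le> G * norm (t - t') powr (\<beta> / \<alpha>)"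
        if "t \<in> {0..T}" "t' \<in> {0..T}" for t t'
        using F_time[of t t' x] that td by simp
    qed
    have "(\<lambda>t. u t x) differentiable_on {0..T}"
      unfolding differentiable_on_def real_differentiable_def using deriv by (meson atLeastAtMost_iff)
    with dF have Ck: "Ck_on 1 {0..T} (\<lambda>t. u t x)"
      by (simp add: numeral_eq_Suc)
    have 0: "sup_norm {0..T} (\<lambda>t. u t x) \<le> ennreal S"
      using holder_classD(2)[OF u_class] S_nonneg by (subst sup_norm_le_iff) auto
    have 1: "sup_norm {0..T} (part_deriv {0..T} 1 (\<lambda>t. u t x)) \<le> ennreal N"
      using F_bound td E0 by (subst sup_norm_le_iff) auto
    have "Cb_norm 1 {0..T} (\<lambda>t. u t x) \<le> ennreal S + ennreal N"
      using Ck 0 1 by (simp add: Cb_norm_def dirs_0 dirs_1 add_mono del: Ck_on.simps)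
    moreover have "(SUP bs\<in>dirs 1. holder_seminorm (\<beta> / \<alpha>) {0..T} (part_derivs {0..T} bs (\<lambda>t. u t x))) \<le> ennreal G"
      using F_time td G0 by (simp add: dirs_1 holder_seminorm_le_iff dist_real_def)
    ultimately have "Cb_holder_norm ((\<alpha> + \<beta>) / \<alpha>) {0..T} (\<lambda>t. u t x) \<le> ennreal S + ennreal N + ennreal G"
      unfolding Cb_holder_norm_def Let_def n e by (rule add_mono)
    then show ?thesis using S_nonneg E0 G0 by (simp add: ennreal_plus)
  qed
  have C: "holder_seminorm \<beta> UNIV (time_deriv T u t) \<le> ennreal N" if "t \<in> {0..T}" for t
    using F_space td that E0 by (subst holder_seminorm_le_iff) (auto simp: time_deriv_def dist_norm)
  have D: "tensor_time_seminorm ((\<alpha> + \<beta> - real k) / \<alpha>) T k u x \<le> ennreal (real (card (dirs k :: (real^'d) list set)) * (5 * (2 * S + N)))"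
    if k: "k = 1 \<or> k = 2 \<and> 2 < \<gamma>" for k x
    unfolding tensor_time_seminorm_def
  proof (rule SUP_least, clarify)
    fix s t assume st: "s \<in> {0..T}" "t \<in> {0..T}" "s \<noteq> t"
    let ?m = "dist s t powr ((\<alpha> + \<beta> - real k) / \<alpha>)"
    have each: "\<bar>part_derivs UNIV bs (u s) x - part_derivs UNIV bs (u t) x\<bar> \<le> 5 * (2 * S + N) * ?m" if "bs \<in> dirs k" for bs
    proof (cases "k = 1")
      case True
      with that obtain b where b: "b \<in> Basis" "bs = [b]" by (auto simp: dirs_1)
      have "\<bar>part_derivs UNIV bs (u s) x - part_derivs UNIV bs (u t) x\<bar> = \<bar>(grad (u s) x - grad (u t) x) \<bullet> b\<bar>"
        using b by (simp add: inner_diff_left grad_inner_Basis)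
      also have "\<dots> \<le> norm (grad (u s) x - grad (u t) x)" using b by (intro Basis_le_norm)
      also have "\<dots> \<le> 5 * slice_const * \<bar>s - t\<bar> powr ((\<gamma> - 1) / \<alpha>)"
        using st by (intro gradient_time) auto
      finally show ?thesis using True gamma by (simp add: slice_const dist_real_def)
    next
      case False
      then have k2: "k = 2" and g: "2 < \<gamma>" using k by auto
      with that obtain a b where b: "a \<in> Basis" "b \<in> Basis" "bs = [a, b]" by (auto simp: dirs_2)
      have Ck: "Ck_on 2 UNIV (u t)" if "t \<in> {0..T}" for t
        using fin[of t] that g gamma_bounds by (intro holder_norm_Ck[of \<gamma>]) (auto intro: le_less_trans)
      have "\<bar>part_derivs UNIV bs (u s) x - part_derivs UNIV bs (u t) x\<bar> = \<bar>(hess (u s) x - hess (u t) x) a \<bullet> b\<bar>"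
        using b hess_derivative(2)[OF Ck] st by (simp add: blinfun.diff_left inner_diff_left)
      also have "\<dots> \<le> norm ((hess (u s) x - hess (u t) x) a)" using b by (intro Basis_le_norm)
      also have "\<dots> \<le> norm (hess (u s) x - hess (u t) x) * norm a" by (rule norm_blinfun)
      also have "\<dots> \<le> 4 * slice_const * \<bar>s - t\<bar> powr ((\<gamma> - 2) / \<alpha>)"
        using st b g hessian_time[of s t x] by simp
      also have "\<dots> \<le> 5 * slice_const * \<bar>s - t\<bar> powr ((\<gamma> - 2) / \<alpha>)"
        using slice_const_nonneg by (intro mult_right_mono) auto
      finally show ?thesis using k2 gamma by (simp add: slice_const dist_real_def)
    qed
    have m: "0 < ?m" using st by simp
    have "L2_set (\<lambda>bs. part_derivs UNIV bs (u s) x - part_derivs UNIV bs (u t) x) (dirs k)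
        \<le> (\<Sum>bs\<in>dirs k. \<bar>part_derivs UNIV bs (u s) x - part_derivs UNIV bs (u t) x\<bar>)"
      by (rule L2_set_le_sum_abs)
    also have "\<dots> \<le> (\<Sum>bs\<in>(dirs k :: (real^'d) list set). 5 * (2 * S + N) * ?m)" using each by (intro sum_mono)
    also have "\<dots> = (real (card (dirs k :: (real^'d) list set)) * (5 * (2 * S + N))) * ?m" by simp
    finally show "ennreal (L2_set (\<lambda>bs. part_derivs UNIV bs (u s) x - part_derivs UNIV bs (u t) x) (dirs k) / ?m)
        \<le> ennreal (real (card (dirs k :: (real^'d) list set)) * (5 * (2 * S + N)))"
      using m SE by (subst ennreal_le_iff) (auto simp: divide_le_eq)
  qed
  define q where "q k = real (card (dirs k :: (real^'d) list set)) * (5 * (2 * S + N))" for k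
  have q0: "0 \<le> q k" for k unfolding q_def using SE by simp
  have D': "(\<Sum>k = 1..nat \<lfloor>\<alpha> + \<beta>\<rfloor>. SUP x. tensor_time_seminorm ((\<alpha> + \<beta> - real k) / \<alpha>) T k u x) \<le> ennreal (q 1 + q 2)"
  proof (cases "\<gamma> < 2")
    case True
    have "nat \<lfloor>\<alpha> + \<beta>\<rfloor> = 1" using nat_floor_eq[of 1 \<gamma>] True gamma_bounds gamma by simp
    then have "(\<Sum>k = 1..nat \<lfloor>\<alpha> + \<beta>\<rfloor>. SUP x. tensor_time_seminorm ((\<alpha> + \<beta> - real k) / \<alpha>) T k u x) \<le> ennreal (q 1)"
      using D[of 1] by (auto simp: q_def intro!: SUP_least)
    also have "\<dots> \<le> ennreal (q 1 + q 2)" using q0 by (intro ennreal_leI) simp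
    finally show ?thesis .
  next
    case False
    then have g: "2 < \<gamma>" using gamma by simp
    have "nat \<lfloor>\<alpha> + \<beta>\<rfloor> = 2" using nat_floor_eq[of 2 \<gamma>] g gamma_bounds gamma by simp
    moreover have "{1..2::nat} = {1, 2}" by auto
    ultimately have "(\<Sum>k = 1..nat \<lfloor>\<alpha> + \<beta>\<rfloor>. SUP x. tensor_time_seminorm ((\<alpha> + \<beta> - real k) / \<alpha>) T k u x)
       = (SUP x. tensor_time_seminorm ((\<alpha> + \<beta> - real 1) / \<alpha>) T 1 u x) + (SUP x. tensor_time_seminorm ((\<alpha> + \<beta> - real 2) / \<alpha>) T 2 u x)"
      by simp
    also have "\<dots> \<le> ennreal (q 1) + ennreal (q 2)"
      using D[of 1] D[of 2] g unfolding q_def by (intro add_mono SUP_least) auto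
    also have "\<dots> = ennreal (q 1 + q 2)" using q0 by (simp add: ennreal_plus)
    finally show ?thesis .
  qed
  have "spacetime_norm \<alpha> \<beta> T u \<le> ennreal S + ennreal (S + N + G) + ennreal N + ennreal (q 1 + q 2)"
    unfolding spacetime_norm_def by (intro add_mono A D' SUP_least B C)
  also have "\<dots> = ennreal (S + (S + N + G) + N + (q 1 + q 2))"
    using S_nonneg E0 G0 q0 by (simp add: ennreal_plus[symmetric] del: ennreal_plus)
  finally show ?thesis unfolding G_def q_def by (simp only: distrib_right)
qed

section \<open>From the hypotheses to the abstract setting\<close>

lemma ennreal_weights_scale:
  assumes "0 \<le> m" "0 \<le> l1" "0 \<le> l2"
  shows "ennreal (m * l1) * I1 + ennreal (m * l2) * I2 = ennreal m * (ennreal l1 * I1 + ennreal l2 * I2)"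
  using assms by (simp add: ennreal_mult distrib_left mult.assoc)

lemma nn_integral_ball_split:
  fixes \<mu> :: "'a::euclidean_space measure"
  assumes [measurable_cong]: "sets \<mu> = sets borel" and [measurable]: "a \<in> borel_measurable borel" "b \<in> borel_measurable borel"
    and k: "0 \<le> k1" "0 \<le> k2" and r: "r < 1"
  shows "(\<integral>\<^sup>+y\<in>ball 0 1. ennreal (if norm y < r then k1 * a y else k2 * b y) \<partial>\<mu>)
    = ennreal k1 * (\<integral>\<^sup>+y\<in>ball 0 r. ennreal (a y) \<partial>\<mu>) + ennreal k2 * (\<integral>\<^sup>+y\<in>ball 0 1 - ball 0 r. ennreal (b y) \<partial>\<mu>)"
proof -
  have [measurable]: "ball (0::'a) r \<in> sets borel" "ball (0::'a) 1 - ball 0 r \<in> sets borel" by auto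
  have "(\<integral>\<^sup>+y\<in>ball 0 1. ennreal (if norm y < r then k1 * a y else k2 * b y) \<partial>\<mu>)
    = (\<integral>\<^sup>+y. ennreal k1 * (ennreal (a y) * indicator (ball 0 r) y) + ennreal k2 * (ennreal (b y) * indicator (ball 0 1 - ball 0 r) y) \<partial>\<mu>)"
    using k r by (intro nn_integral_cong) (auto simp: indicator_def ennreal_mult' )
  also have "\<dots> = ennreal k1 * (\<integral>\<^sup>+y\<in>ball 0 r. ennreal (a y) \<partial>\<mu>) + ennreal k2 * (\<integral>\<^sup>+y\<in>ball 0 1 - ball 0 r. ennreal (b y) \<partial>\<mu>)"
    by (subst nn_integral_add) (auto simp: nn_integral_cmult)
  finally show ?thesis .
qed

text \<open>Multiplied by \<open>r\<^sup>\<beta>\<close>, the left-hand side of the growth hypothesis is the integral of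
  \<open>remainder_weight\<close> over the unit ball. For \<open>\<alpha> + \<beta> < 2\<close> the case \<open>r = 1/2\<close> also shows that \<open>|z|\<^sup>\<alpha>\<^sup>+\<^sup>\<beta>\<close>
  is integrable near the origin.\<close>

lemma levy_growth_from_hypotheses:
  fixes A :: "real^'d^'d" and \<mu> :: "(real^'d) measure"
  assumes triplet: "levy_triplet A \<mu>" and kernel: "heat_kernel A \<mu> p" and A: "A = 0"
    and \<alpha>: "1 < \<alpha>" "\<alpha> \<le> 2" and \<beta>: "0 < \<beta>" "\<beta> < 1" and \<gamma>: "\<alpha> + \<beta> \<in> {1<..<2} \<union> {2<..<3}"
    and c: "0 < c" and mu_growth: "\<forall>r\<in>{0<..<1}.
          (\<alpha> + \<beta> \<in> {1<..<2} \<longrightarrow>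
             ennreal (r powr (- \<beta>)) *
               (\<integral>\<^sup>+y\<in>ball 0 r. ennreal (norm y powr (\<alpha> + \<beta>)) \<partial>\<mu>) +
             ennreal (r powr (\<alpha> - 1)) *
               (\<integral>\<^sup>+y\<in>ball 0 1 - ball 0 r. ennreal (norm y) \<partial>\<mu>) \<le> ennreal c) \<and>
          (\<alpha> + \<beta> \<in> {2<..<3} \<longrightarrow>
             ennreal (r powr (\<alpha> - 2)) *
               (\<integral>\<^sup>+y\<in>ball 0 r. ennreal ((norm y)\<^sup>2) \<partial>\<mu>) +
             ennreal (r powr (1 - \<beta>)) *
               (\<integral>\<^sup>+y\<in>ball 0 1 - ball 0 r. ennreal (norm y powr (\<alpha> + \<beta> - 1)) \<partial>\<mu>) \<le> ennreal c)"
  shows "levy_growth \<mu> (\<lambda>t. density lborel (\<lambda>x. ennreal (p t x))) (levy_symbol A \<mu>) (min (\<alpha> + \<beta>) 2) \<alpha> \<beta> (\<alpha> + \<beta>) c"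
proof -
  define \<gamma>' where "\<gamma>' = \<alpha> + \<beta>"
  have sets[measurable_cong]: "sets \<mu> = sets borel" and z: "emeasure \<mu> {0} = 0"
    and levy: "(\<integral>\<^sup>+z. ennreal (min 1 ((norm z)\<^sup>2)) \<partial>\<mu>) < \<infinity>"
    using triplet by (auto simp: levy_triplet_def levy_measure_def)
  have growth: "(\<integral>\<^sup>+y\<in>ball 0 1. ennreal (remainder_weight \<gamma>' r y) \<partial>\<mu>) \<le> ennreal (c * r powr \<beta>)"
    if r: "0 < r" "r < 1" for r
  proof -
    have m: "ennreal (r powr \<beta>) * X \<le> ennreal (c * r powr \<beta>)" if "X \<le> ennreal c" for X
      using mult_left_mono[OF that, of "ennreal (r powr \<beta>)"] c by (simp add: ennreal_mult mult.commute)
    have pw: "r powr \<beta> * r powr b = r powr d" if "\<beta> + b = d" for b d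
      using that by (simp add: powr_add[symmetric])
    show ?thesis
    proof (cases "\<gamma>' < 2")
      case True
      have e: "remainder_weight \<gamma>' r y = (if norm y < r then (r powr \<beta> * r powr (- \<beta>)) * norm y powr \<gamma>' else (r powr \<beta> * r powr (\<alpha> - 1)) * norm y)" for y :: "real^'d"
        using True r pw[of "- \<beta>" 0] pw[of "\<alpha> - 1" "\<gamma>' - 1"] by (simp add: remainder_weight_def \<gamma>'_def)
      have "(\<integral>\<^sup>+y\<in>ball 0 1. ennreal (remainder_weight \<gamma>' r y) \<partial>\<mu>)
          = ennreal (r powr \<beta> * r powr (- \<beta>)) * (\<integral>\<^sup>+y\<in>ball 0 r. ennreal (norm y powr \<gamma>') \<partial>\<mu>) + ennreal (r powr \<beta> * r powr (\<alpha> - 1)) * (\<integral>\<^sup>+y\<in>ball 0 1 - ball 0 r. ennreal (norm y) \<partial>\<mu>)"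
        unfolding e by (rule nn_integral_ball_split[OF sets]) (use r in auto)
      also have "\<dots> = ennreal (r powr \<beta>) * (ennreal (r powr (- \<beta>)) * (\<integral>\<^sup>+y\<in>ball 0 r. ennreal (norm y powr \<gamma>') \<partial>\<mu>) + ennreal (r powr (\<alpha> - 1)) * (\<integral>\<^sup>+y\<in>ball 0 1 - ball 0 r. ennreal (norm y) \<partial>\<mu>))"
        by (rule ennreal_weights_scale) auto
      also have "\<dots> \<le> ennreal (c * r powr \<beta>)"
        by (rule m) (use mu_growth r True \<gamma> in \<open>auto simp: \<gamma>'_def\<close>)
      finally show ?thesis .
    next
      case False
      have e: "remainder_weight \<gamma>' r y = (if norm y < r then (r powr \<beta> * r powr (\<alpha> - 2)) * (norm y)\<^sup>2 else (r powr \<beta> * r powr (1 - \<beta>)) * norm y powr (\<gamma>' - 1))" for y :: "real^'d"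
        using False r pw[of "1 - \<beta>" 1] pw[of "\<alpha> - 2" "\<gamma>' - 2"] by (simp add: remainder_weight_def \<gamma>'_def)
      have "(\<integral>\<^sup>+y\<in>ball 0 1. ennreal (remainder_weight \<gamma>' r y) \<partial>\<mu>)
          = ennreal (r powr \<beta> * r powr (\<alpha> - 2)) * (\<integral>\<^sup>+y\<in>ball 0 r. ennreal ((norm y)\<^sup>2) \<partial>\<mu>) + ennreal (r powr \<beta> * r powr (1 - \<beta>)) * (\<integral>\<^sup>+y\<in>ball 0 1 - ball 0 r. ennreal (norm y powr (\<gamma>' - 1)) \<partial>\<mu>)"
        unfolding e by (rule nn_integral_ball_split[OF sets]) (use r in auto)
      also have "\<dots> = ennreal (r powr \<beta>) * (ennreal (r powr (\<alpha> - 2)) * (\<integral>\<^sup>+y\<in>ball 0 r. ennreal ((norm y)\<^sup>2) \<partial>\<mu>) + ennreal (r powr (1 - \<beta>)) * (\<integral>\<^sup>+y\<in>ball 0 1 - ball 0 r. ennreal (norm y powr (\<gamma>' - 1)) \<partial>\<mu>))"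
        by (rule ennreal_weights_scale) auto
      also have "\<dots> \<le> ennreal (c * r powr \<beta>)"
        by (rule m) (use mu_growth r False \<gamma> in \<open>auto simp: \<gamma>'_def\<close>)
      finally show ?thesis .
    qed
  qed
  have jump: "(\<integral>\<^sup>+z. ennreal (min 1 (norm z powr min \<gamma>' 2)) \<partial>\<mu>) < \<infinity>"
  proof (cases "\<gamma>' < 2")
    case False
    have "norm z powr 2 = (norm z)\<^sup>2" for z :: "real^'d" by (simp add: powr_numeral)
    moreover have "min \<gamma>' 2 = 2" using False by simp
    ultimately show ?thesis using levy by (simp only:)
  next
    case True
    have [measurable]: "(\<lambda>y::real^'d. remainder_weight \<gamma>' (1/2) y) \<in> borel_measurable borel"
      unfolding remainder_weight_def[abs_def] by measurable
    have pt: "ennreal (min 1 (norm z powr \<gamma>')) \<le> ennreal (remainder_weight \<gamma>' (1/2) z) * indicator (ball 0 1) z + 4 * ennreal (min 1 ((norm z)\<^sup>2))" for z :: "real^'d"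
    proof (cases "norm z < 1 / 2")
      case small: True
      then have "ennreal (min 1 (norm z powr \<gamma>')) \<le> ennreal (remainder_weight \<gamma>' (1/2) z) * indicator (ball 0 1) z"
        using True by (auto simp: remainder_weight_def intro!: ennreal_leI)
      then show ?thesis by (rule order_trans) simp
    next
      case False
      then have "(1/2)\<^sup>2 \<le> (norm z)\<^sup>2" by (intro power_mono) auto
      then have "1 \<le> 4 * min 1 ((norm z)\<^sup>2)" by (simp add: power2_eq_square)
      then have "ennreal (min 1 (norm z powr \<gamma>')) \<le> ennreal (4 * min 1 ((norm z)\<^sup>2))" by (intro ennreal_leI) linarith
      also have "\<dots> = 4 * ennreal (min 1 ((norm z)\<^sup>2))" by (simp add: ennreal_mult')
      finally show ?thesis by (rule order_trans) simp
    qed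
    have "(\<integral>\<^sup>+z. ennreal (min 1 (norm z powr \<gamma>')) \<partial>\<mu>)
       \<le> (\<integral>\<^sup>+z. ennreal (remainder_weight \<gamma>' (1/2) z) * indicator (ball 0 1) z + 4 * ennreal (min 1 ((norm z)\<^sup>2)) \<partial>\<mu>)"
      by (intro nn_integral_mono pt)
    also have "\<dots> = (\<integral>\<^sup>+y\<in>ball 0 1. ennreal (remainder_weight \<gamma>' (1/2) y) \<partial>\<mu>) + 4 * (\<integral>\<^sup>+z. ennreal (min 1 ((norm z)\<^sup>2)) \<partial>\<mu>)"
      by (subst nn_integral_add) (auto simp: nn_integral_cmult)
    also have "\<dots> < \<infinity>"
      using growth[of "1/2"] levy by (auto simp: ennreal_mult_less_top intro: le_less_trans)
    finally show ?thesis using True by (simp add: min_def)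
  qed
  have "levy_semigroup \<mu> (\<lambda>t. density lborel (\<lambda>x. ennreal (p t x))) (levy_symbol A \<mu>) (min \<gamma>' 2)"
  proof (rule levy_semigroup.intro)
    show "sets \<mu> = sets borel" "emeasure \<mu> {0} = 0" by (rule sets z)+
    show "(\<integral>\<^sup>+z. ennreal (min 1 (norm z powr min \<gamma>' 2)) \<partial>\<mu>) < \<infinity>" by (rule jump)
    show "1 < min \<gamma>' 2" "min \<gamma>' 2 \<le> 2" using \<alpha> \<beta> by (auto simp: \<gamma>'_def)
    show "levy_symbol A \<mu> \<xi> = (LINT z|\<mu>. 1 - cis (\<xi> \<bullet> z) + \<i> * of_real (\<xi> \<bullet> z) * indicator (ball 0 1) z)" for \<xi>
      by (simp add: levy_symbol_def A cis_conv_exp)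
    show "sets (density lborel (\<lambda>x. ennreal (p t x))) = sets borel" for t by simp
    fix t :: real assume t: "0 < t"
    then show "prob_space (density lborel (\<lambda>x. ennreal (p t x)))" using kernel by (simp add: heat_kernel_def)
    show "(LINT y|density lborel (\<lambda>x. ennreal (p t x)). cis (- (\<xi> \<bullet> y))) = exp (- of_real t * levy_symbol A \<mu> \<xi>)" for \<xi>
      using kernel t by (simp add: heat_kernel_def cis_conv_exp)
  qed
  then show ?thesis
    unfolding \<gamma>'_def[symmetric]
  proof (intro levy_growth.intro levy_growth_axioms.intro)
    show "\<gamma>' \<noteq> 2" using \<gamma> by (auto simp: \<gamma>'_def)
  qed (use \<alpha> \<beta> c growth in \<open>auto simp: \<gamma>'_def\<close>)
qed

lemma semigroup_eq:
  fixes p :: "real \<Rightarrow> real^'d \<Rightarrow> real"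
  assumes p: "p t \<in> borel_measurable borel" "\<And>x. 0 \<le> p t x" and [measurable]: "\<phi> \<in> borel_measurable borel"
  shows "semigroup p t \<phi> x = (LINT y|density lborel (\<lambda>x. ennreal (p t x)). \<phi> (x - y))"
proof -
  note p(1)[measurable]
  have "semigroup p t \<phi> x = (LINT y|lborel. p t (x - y) * \<phi> y)" by (simp add: semigroup_def)
  also have "\<dots> = (LINT w|lborel. p t w * \<phi> (x - w))"
    by (subst lborel_integral_affine[where c="-1" and t=x]) auto
  also have "\<dots> = (LINT y|density lborel (\<lambda>x. ennreal (p t x)). \<phi> (x - y))"
    using p by (subst integral_density) auto
  finally show ?thesis .
qed

text \<open>Here \<open>X\<close> stands for the supremum of the norms of the time slices plus one. Every constant that
  occurs is a multiple of \<open>X\<close>, which makes the final bound linear in \<open>X\<close>: the time slices are of class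
  \<open>C\<^sup>\<gamma>\<close> with constant \<open>k X\<close>, the source is bounded in \<open>C\<^sup>\<beta>\<close> by \<open>a X\<close>, and the solution is Lipschitz in
  time with constant \<open>e X\<close>. The radius \<open>Kr + 1\<close> leaves room for gradients of norm \<open>Kr\<close> in the open ball.\<close>

lemma mild_solution_bound:
  fixes p :: "real \<Rightarrow> real^'d \<Rightarrow> real" and H :: "real \<Rightarrow> real^'d \<Rightarrow> real^'d \<Rightarrow> real"
  assumes T: "0 < T" and lg: "levy_growth \<mu> (\<lambda>t. density lborel (\<lambda>x. ennreal (p t x))) \<psi> g \<alpha> \<beta> \<gamma> c"
    and p: "\<And>t. 0 < t \<Longrightarrow> p t \<in> borel_measurable borel" "\<And>t x. 0 < t \<Longrightarrow> 0 \<le> p t x"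
    and H_cont: "continuous_on ({0..T} \<times> UNIV) (\<lambda>(t, x, q). H t x q)"
    and H0: "0 \<le> H0" "\<And>t x. t \<in> {0..T} \<Longrightarrow> \<bar>H t x 0\<bar> \<le> H0"
    and Kr: "0 \<le> Kr" and L: "0 \<le> L" "\<And>t x q q'. t \<in> {0..T} \<Longrightarrow> q \<in> ball 0 (Kr + 1) \<Longrightarrow> q' \<in> ball 0 (Kr + 1) \<Longrightarrow>
          \<bar>H t x q - H t x q'\<bar> \<le> L * norm (q - q')"
    and M: "0 \<le> M" "\<And>t x x' q. t \<in> {0..T} \<Longrightarrow> q \<in> ball 0 (Kr + 1) \<Longrightarrow> norm (x - x') < 1 \<Longrightarrow>
          \<bar>H t x q - H t x' q\<bar> \<le> M * norm (x - x') powr \<beta>"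
    and N: "0 \<le> N" "\<And>t s x q. t \<in> {0..T} \<Longrightarrow> s \<in> {0..T} \<Longrightarrow> \<bar>s - t\<bar> < 1 \<Longrightarrow> q \<in> ball 0 (Kr + 1) \<Longrightarrow>
          \<bar>H s x q - H t x q\<bar> \<le> N * \<bar>s - t\<bar> powr (\<beta> / \<alpha>)"
    and sol: "mild_solution p H T u\<^sub>0 u" and grad_bound: "\<And>t x. 0 < t \<Longrightarrow> t \<le> T \<Longrightarrow> norm (grad (u t) x) \<le> Kr"
    and X: "1 \<le> X" and norm: "\<And>t. 0 \<le> t \<Longrightarrow> t \<le> T \<Longrightarrow> Cb_holder_norm \<gamma> UNIV (u t) \<le> ennreal X"
  defines "k \<equiv> (real CARD('d))\<^sup>2" and "j \<equiv> levy_growth.jump_const \<mu> g c"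
  defines "a \<equiv> 2 * (H0 + L * (Kr + 1)) + M + 2 * L * k"
  defines "e \<equiv> 4 * k * j + a"
  shows "spacetime_norm \<alpha> \<beta> T u \<le> ennreal ((k + (k + e + (2 * e + 10 * (2 * k + e) * j + (N + 5 * L * (2 * k + e)))) + e
     + (real (card (dirs 1 :: (real^'d) list set)) + real (card (dirs 2 :: (real^'d) list set))) * (5 * (2 * k + e))) * X)"
proof -
  interpret LG: levy_growth \<mu> "\<lambda>t. density lborel (\<lambda>x. ennreal (p t x))" \<psi> g \<alpha> \<beta> \<gamma> c by (rule lg)
  let ?\<nu> = "\<lambda>t. density lborel (\<lambda>x. ennreal (p t x))"
  define V where "V t = grad (u t)" for t
  define f where "f t x = H t x (V t x)" for t x
  have k1: "1 \<le> k" unfolding k_def by (simp add: Suc_leI one_le_power)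
  have j0: "0 \<le> j" unfolding j_def by (rule LG.jump_const_nonneg)
  have a0: "0 \<le> a" unfolding a_def using H0 L M Kr k1 by simp
  have cls: "holder_class \<gamma> (k * X) (u t) (V t) (hess (u t))" if "0 \<le> t" "t \<le> T" for t
    unfolding k_def V_def using X norm[OF that] LG.gamma_bounds LG.gamma by (intro holder_class_from_norm) auto
  have f_bound: "\<bar>f t x\<bar> \<le> a * X" and f_holder: "\<bar>f t x - f t y\<bar> \<le> a * X * norm (x - y) powr \<beta>"
    if t: "0 \<le> t" "t \<le> T" and Vt: "\<And>x. norm (V t x) \<le> Kr" for t x y
  proof -
    have tT: "t \<in> {0..T}" using t by simp
    have Vb: "V t x \<in> ball 0 (Kr + 1)" for x using Vt[of x] by simp
    have b: "\<bar>f t x\<bar> \<le> H0 + L * (Kr + 1)" for x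
    proof -
      have "\<bar>H t x (V t x) - H t x 0\<bar> \<le> L * norm (V t x - 0)" using Kr by (intro L tT Vb) auto
      also have "\<dots> \<le> L * (Kr + 1)" using Vt[of x] L by (intro mult_left_mono) auto
      finally show ?thesis using H0(2)[OF tT, of x] unfolding f_def by linarith
    qed
    have pos: "0 \<le> H0 + L * (Kr + 1)" "0 \<le> 2 * L * k" using H0 L Kr k1 by auto
    have aX: "s \<le> a * X" if "0 \<le> s" "s \<le> a" for s using mult_mono[of s a 1 X] that X a0 by simp
    show "\<bar>f t x\<bar> \<le> a * X"
    proof -
      have "H0 + L * (Kr + 1) \<le> a * X" using pos M unfolding a_def by (intro aX[unfolded a_def]) auto
      then show ?thesis using b[of x] by linarith
    qed
    show "\<bar>f t x - f t y\<bar> \<le> a * X * norm (x - y) powr \<beta>"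
    proof (cases "norm (x - y) < 1")
      case True
      let ?n = "norm (x - y) powr \<beta>"
      have "\<bar>H t x (V t x) - H t y (V t x)\<bar> \<le> M * ?n" by (intro M tT Vb True)
      moreover have "\<bar>H t y (V t x) - H t y (V t y)\<bar> \<le> L * norm (V t x - V t y)" by (intro L tT Vb)
      moreover have "L * norm (V t x - V t y) \<le> L * (2 * (k * X) * ?n)"
        using LG.alpha LG.beta LG.gamma LG.gamma_bounds
        by (intro mult_left_mono L holder_gradient[OF cls[OF t]]) auto
      ultimately have "\<bar>f t x - f t y\<bar> \<le> (M + 2 * L * k * X) * ?n"
        unfolding f_def by (simp add: algebra_simps)
      also have "\<dots> \<le> (a * X) * ?n"
      proof (rule mult_right_mono)
        have "M * 1 \<le> M * X" using X M by (intro mult_left_mono)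
        moreover have "0 \<le> 2 * (H0 + L * (Kr + 1)) * X" using pos X by simp
        ultimately show "M + 2 * L * k * X \<le> a * X" unfolding a_def distrib_right by simp
      qed simp
      finally show ?thesis .
    next
      case False
      have "\<bar>f t x - f t y\<bar> \<le> \<bar>f t x\<bar> + \<bar>f t y\<bar>" by (rule abs_triangle_ineq4)
      also have "\<dots> \<le> (H0 + L * (Kr + 1)) + (H0 + L * (Kr + 1))" by (intro add_mono b)
      also have "\<dots> = 2 * (H0 + L * (Kr + 1))" by simp
      also have "\<dots> \<le> a * X" using pos M unfolding a_def by (intro aX[unfolded a_def]) auto
      also have "a * X \<le> a * X * norm (x - y) powr \<beta>"
        using False LG.beta a0 X mult_left_mono[of 1 "norm (x - y) powr \<beta>" "a * X"] by (simp add: ge_one_powr_ge_zero)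
      finally show ?thesis .
    qed
  qed
  have u_cont: "continuous_on UNIV (u t)" and V_cont: "continuous_on UNIV (V t)" if "0 \<le> t" "t \<le> T" for t
    using jetD(1,2)[OF LG.class_jet[OF cls[OF that]]] by auto
  have f_meas: "f t \<in> borel_measurable borel" if "0 \<le> t" "t \<le> T" for t
  proof (rule borel_measurable_continuous_onI)
    have "continuous_on UNIV (\<lambda>y. (\<lambda>(t, x, q). H t x q) (t, y, V t y))"
      using that by (intro continuous_on_compose2[OF H_cont] continuous_intros V_cont) auto
    then show "continuous_on UNIV (f t)" unfolding f_def[abs_def] by simp
  qed
  have sg: "semigroup p t \<phi> x = LG.P t \<phi> x" if "0 < t" "\<phi> \<in> borel_measurable borel" for t \<phi> x
    unfolding LG.P_def using p that by (intro semigroup_eq) auto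
  have u0: "u 0 = u\<^sub>0" and cont: "cont_Cb1 T u" using sol by (auto simp: mild_solution_def)
  have mild: "u t x = LG.P t (u 0) x + (LINT s|lborel. indicator {0<..<t} s * LG.P (t - s) (f s) x)"
    if t: "0 < t" "t \<le> T" for t x
  proof -
    have "u t x = semigroup p t (u 0) x + (LINT s:{0<..<t}|lborel. semigroup p (t - s) (f s) x)"
      using sol t unfolding mild_solution_def f_def[abs_def] V_def by simp
    also have "semigroup p t (u 0) x = LG.P t (u 0) x"
      using t T by (intro sg borel_measurable_continuous_onI u_cont) auto
    also have "(LINT s:{0<..<t}|lborel. semigroup p (t - s) (f s) x) = (LINT s|lborel. indicator {0<..<t} s * LG.P (t - s) (f s) x)"
      unfolding set_lebesgue_integral_def using t
      by (intro Bochner_Integration.integral_cong) (auto simp: indicator_def intro!: sg f_meas)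
    finally show ?thesis .
  qed
  have Vb: "norm (V t x) \<le> Kr" if "0 < t" "t \<le> T" for t x unfolding V_def by (rule grad_bound[OF that])
  have f_cont: "\<exists>d>0. \<forall>s. 0 < s \<longrightarrow> s \<le> T \<longrightarrow> \<bar>s - t\<bar> < d \<longrightarrow> (\<forall>x. \<bar>f s x - f t x\<bar> \<le> \<epsilon>)"
    if t: "0 < t" "t \<le> T" and \<epsilon>: "0 < \<epsilon>" for t \<epsilon>
  proof -
    define D where "D = real CARD('d)"
    define \<delta> where "\<delta> = \<epsilon> / (2 * (L * D + 1))"
    have LD: "0 \<le> L * D" using L by (simp add: D_def)
    have \<delta>: "0 < \<delta>" using \<epsilon> LD by (simp add: \<delta>_def)
    have "L * (D * \<delta>) \<le> (L * D + 1) * \<delta>" using \<delta> by (simp add: algebra_simps)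
    also have "\<dots> = \<epsilon> / 2" using LD by (simp add: \<delta>_def field_simps)
    finally have L\<delta>: "L * (D * \<delta>) \<le> \<epsilon> / 2" .
    have "((\<lambda>s. Cb_norm 1 UNIV (\<lambda>x. u s x - u t x)) \<longlongrightarrow> 0) (at t within {0<..T})"
      using cont t by (auto simp: cont_Cb1_def)
    then have "\<forall>\<^sub>F s in at t within {0<..T}. Cb_norm 1 UNIV (\<lambda>x. u s x - u t x) < ennreal \<delta>"
      by (rule order_tendstoD) (use \<delta> in simp)
    then obtain d1 where d1: "0 < d1" "\<And>s. s \<in> {0<..T} \<Longrightarrow> s \<noteq> t \<Longrightarrow> dist s t < d1 \<Longrightarrow> Cb_norm 1 UNIV (\<lambda>x. u s x - u t x) < ennreal \<delta>"
      unfolding eventually_at by blast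
    have "((\<lambda>s. N * \<bar>s - t\<bar> powr (\<beta> / \<alpha>)) \<longlongrightarrow> N * \<bar>t - t\<bar> powr (\<beta> / \<alpha>)) (at t)"
      using LG.alpha LG.beta by (intro tendsto_intros tendsto_powr') auto
    then have "\<forall>\<^sub>F s in at t. N * \<bar>s - t\<bar> powr (\<beta> / \<alpha>) < \<epsilon> / 2"
      by (rule order_tendstoD) (use \<epsilon> in simp)
    then obtain d2 where d2: "0 < d2" "\<And>s. s \<noteq> t \<Longrightarrow> dist s t < d2 \<Longrightarrow> N * \<bar>s - t\<bar> powr (\<beta> / \<alpha>) < \<epsilon> / 2"
      unfolding eventually_at by blast
    show ?thesis
    proof (intro exI[of _ "min 1 (min d1 d2)"] conjI allI impI)
      show "0 < min 1 (min d1 d2)" using d1 d2 by simp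
      fix s x assume s: "0 < s" "s \<le> T" "\<bar>s - t\<bar> < min 1 (min d1 d2)"
      show "\<bar>f s x - f t x\<bar> \<le> \<epsilon>"
      proof (cases "s = t")
        case False
        have "\<bar>H s x (V s x) - H t x (V s x)\<bar> \<le> N * \<bar>s - t\<bar> powr (\<beta> / \<alpha>)"
          using s t Vb[OF s(1,2), of x] by (intro N) auto
        also have "\<dots> \<le> \<epsilon> / 2" using d2(2)[of s] False s by (simp add: dist_real_def)
        finally have 1: "\<bar>H s x (V s x) - H t x (V s x)\<bar> \<le> \<epsilon> / 2" .
        have C: "Cb_norm 1 UNIV (\<lambda>x. u s x - u t x) \<le> ennreal \<delta>"
          using d1(2)[of s] s False by (auto simp: dist_real_def intro: less_imp_le)
        have "\<bar>(V s x - V t x) \<bullet> b\<bar> \<le> \<delta>" if b: "b \<in> Basis" for b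
        proof -
          have "((\<lambda>x. u s x - u t x) has_derivative (\<lambda>h. (V s x - V t x) \<bullet> h)) (at x)"
            using holder_classD(1)[OF holder_class_diff[OF cls cls], of s t] s t by simp
          from part_deriv_eq[OF this] Cb_norm_leD(2)[OF less_imp_le[OF \<delta>] C, of 1 "[b]" x] b
          show ?thesis by (auto simp: dirs_1)
        qed
        then have "norm (V s x - V t x) \<le> D * \<delta>" unfolding D_def by (rule norm_le_from_coordinates)
        then have "L * norm (V s x - V t x) \<le> \<epsilon> / 2"
          using mult_left_mono[OF _ L(1)] L\<delta> by (meson order_trans)
        moreover have "\<bar>H t x (V s x) - H t x (V t x)\<bar> \<le> L * norm (V s x - V t x)"
          using Vb[OF s(1,2), of x] Vb[OF t, of x] t by (intro L) auto
        ultimately show ?thesis using 1 unfolding f_def by linarith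
      qed (use \<epsilon> in simp)
    qed
  qed
  have me: "mild_evolution \<mu> ?\<nu> \<psi> g \<alpha> \<beta> \<gamma> c T (k * X) (a * X) u (\<lambda>t. grad (u t)) (\<lambda>t. hess (u t)) f"
  proof (intro mild_evolution.intro lg mild_evolution_axioms.intro)
    show "0 < T" by (rule T)
    show "holder_class \<gamma> (k * X) (u t) (grad (u t)) (hess (u t))" if "0 \<le> t" "t \<le> T" for t
      using cls[OF that] by (simp add: V_def)
    show "0 \<le> a * X" using a0 X by simp
    show "\<bar>f t x\<bar> \<le> a * X" if "0 < t" "t \<le> T" for t x using that by (intro f_bound Vb) auto
    show "\<bar>f t x - f t y\<bar> \<le> a * X * norm (x - y) powr \<beta>" if "0 < t" "t \<le> T" for t x y
      using that by (intro f_holder Vb) auto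
    show "\<exists>d>0. \<forall>s. 0 < s \<longrightarrow> s \<le> T \<longrightarrow> \<bar>s - t\<bar> < d \<longrightarrow> (\<forall>x. \<bar>f s x - f t x\<bar> \<le> \<epsilon>)"
      if "0 < t" "t \<le> T" "0 < \<epsilon>" for t \<epsilon> by (rule f_cont[OF that])
    show "u t x = levy_semigroup.P ?\<nu> t (u 0) x + (LINT s|lborel. indicator {0<..<t} s * levy_semigroup.P ?\<nu> (t - s) (f s) x)"
      if "0 < t" "t \<le> T" for t x by (rule mild[OF that])
  qed
  interpret ME: mild_evolution \<mu> ?\<nu> \<psi> g \<alpha> \<beta> \<gamma> c T "k * X" "a * X" u "\<lambda>t. grad (u t)" "\<lambda>t. hess (u t)" f
    by (rule me)
  have E: "4 * (k * X) * LG.jump_const + a * X = e * X"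
    unfolding e_def j_def by (simp add: algebra_simps)
  have slice_const: "ME.slice_const = (2 * k + e) * X"
    unfolding ME.slice_const_def ME.time_lip_def E by (simp add: algebra_simps)
  \<comment> \<open>At time zero the gradient is the limit of gradients at positive times.\<close>
  have Vb0: "norm (V t x) \<le> Kr" if t: "0 \<le> t" "t \<le> T" for t x
  proof (cases "t = 0")
    case True
    have "((\<lambda>s. Kr + 5 * ME.slice_const * s powr ((\<gamma> - 1) / \<alpha>)) \<longlongrightarrow> Kr + 5 * ME.slice_const * 0 powr ((\<gamma> - 1) / \<alpha>)) (at_right 0)"
      using LG.alpha LG.gamma_bounds
      by (intro tendsto_intros tendsto_powr') (auto intro!: eventually_at_right_less[THEN eventually_mono])
    then have lim: "((\<lambda>s. Kr + 5 * ME.slice_const * s powr ((\<gamma> - 1) / \<alpha>)) \<longlongrightarrow> Kr) (at_right 0)" by simp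
    have "\<forall>\<^sub>F s in at_right 0. norm (V 0 x) \<le> Kr + 5 * ME.slice_const * s powr ((\<gamma> - 1) / \<alpha>)"
      unfolding eventually_at_right[OF T]
    proof (intro exI[of _ T] conjI allI impI T)
      fix s assume s: "0 < s" "s < T"
      have "norm (V 0 x - V s x) \<le> 5 * ME.slice_const * \<bar>0 - s\<bar> powr ((\<gamma> - 1) / \<alpha>)"
        unfolding V_def using s by (intro ME.gradient_time) auto
      then show "norm (V 0 x) \<le> Kr + 5 * ME.slice_const * s powr ((\<gamma> - 1) / \<alpha>)"
        using norm_triangle_sub[of "V 0 x" "V s x"] Vb[of s x] s by simp
    qed
    then have "norm (V 0 x) \<le> Kr" by (intro tendsto_lowerbound[OF lim]) auto
    then show ?thesis using True by simp
  qed (use Vb t in auto)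
  define F1 where "F1 = (N + 5 * L * (2 * k + e)) * X"
  have ke: "0 \<le> 2 * k + e" unfolding e_def using k1 j0 a0 by simp
  have F1: "0 \<le> F1" unfolding F1_def using N L ke X by simp
  have f_time: "\<bar>f s x - f t x\<bar> \<le> F1 * \<bar>s - t\<bar> powr (\<beta> / \<alpha>)"
    if st: "0 \<le> s" "s \<le> T" "0 \<le> t" "t \<le> T" "\<bar>s - t\<bar> < 1" for s t x
  proof -
    let ?n = "\<bar>s - t\<bar> powr (\<beta> / \<alpha>)"
    have "\<bar>H s x (V s x) - H t x (V s x)\<bar> \<le> N * ?n"
      using st Vb0[OF st(1,2), of x] by (intro N) auto
    also have "\<dots> \<le> (N * X) * ?n" using X N by (intro mult_right_mono) (auto simp: mult_le_cancel_left1)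
    finally have 1: "\<bar>H s x (V s x) - H t x (V s x)\<bar> \<le> (N * X) * ?n" .
    have "\<bar>H t x (V s x) - H t x (V t x)\<bar> \<le> L * norm (V s x - V t x)"
      using Vb0[OF st(1,2), of x] Vb0[OF st(3,4), of x] st by (intro L) auto
    also have "\<dots> \<le> L * (5 * ME.slice_const * \<bar>s - t\<bar> powr ((\<gamma> - 1) / \<alpha>))"
      unfolding V_def using st by (intro mult_left_mono L ME.gradient_time) auto
    also have "\<dots> \<le> L * (5 * ME.slice_const * ?n)"
      using st LG.alpha LG.gamma ME.slice_const_nonneg L
      by (intro mult_left_mono powr_le_powr_of_le_one divide_right_mono) auto
    finally show ?thesis using 1 unfolding f_def F1_def slice_const by (simp add: algebra_simps)
  qed
  have "spacetime_norm \<alpha> \<beta> T u \<le> ennreal (k * X + (k * X + (4 * (k * X) * LG.jump_const + a * X)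
      + (2 * (4 * (k * X) * LG.jump_const + a * X) + 10 * (2 * (k * X) + (4 * (k * X) * LG.jump_const + a * X)) * LG.jump_const + F1))
      + (4 * (k * X) * LG.jump_const + a * X)
     + (real (card (dirs 1 :: (real^'d) list set)) + real (card (dirs 2 :: (real^'d) list set))) * (5 * (2 * (k * X) + (4 * (k * X) * LG.jump_const + a * X))))"
  proof (rule spacetime_norm_bound[OF me])
    show "Cb_holder_norm \<gamma> UNIV (u t) \<le> ennreal (k * X)" if "0 \<le> t" "t \<le> T" for t
    proof -
      have "X \<le> k * X" using k1 X by (simp add: mult_le_cancel_right1)
      then show ?thesis using norm[OF that] by (meson ennreal_leI order_trans)
    qed
    show "\<bar>f t x\<bar> \<le> a * X" if "0 \<le> t" "t \<le> T" for t x using that by (intro f_bound Vb0)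
    show "\<bar>f t x - f t y\<bar> \<le> a * X * norm (x - y) powr \<beta>" if "0 \<le> t" "t \<le> T" for t x y
      using that by (intro f_holder Vb0)
  qed (use F1 f_time in auto)
  also have "\<dots> = ennreal ((k + (k + e + (2 * e + 10 * (2 * k + e) * j + (N + 5 * L * (2 * k + e)))) + e
     + (real (card (dirs 1 :: (real^'d) list set)) + real (card (dirs 2 :: (real^'d) list set))) * (5 * (2 * k + e))) * X)"
    unfolding E unfolding F1_def j_def[symmetric] by (intro arg_cong[where f=ennreal]) (simp add: algebra_simps)
  finally show ?thesis .
qed

text \<open>This extends the estimates on \<open>H\<close> from the open to the closed time interval.\<close>

lemma closed_time_bound:
  fixes w :: "real \<Rightarrow> real"
  assumes T: "0 < T" and w: "continuous_on {0..T} w" and b: "\<And>t. t \<in> {0<..<T} \<Longrightarrow> \<bar>w t\<bar> \<le> K" and t: "t \<in> {0..T}"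
  shows "\<bar>w t\<bar> \<le> K"
proof -
  have cl: "closure {0<..<T} = {0..T}" using T by (rule closure_greaterThanLessThan)
  have "norm (w t) \<le> K"
    by (rule continuous_on_closure_norm_le[of "{0<..<T}"]) (use w b t cl in auto)
  then show ?thesis by simp
qed

theorem theorem5p12:
  fixes T \<alpha> \<beta> :: real
    and A :: "real^'d^'d"
    and \<mu> :: "(real^'d) measure"
    and p :: "real \<Rightarrow> real^'d \<Rightarrow> real"
    and H :: "real \<Rightarrow> real^'d \<Rightarrow> real^'d \<Rightarrow> real"
  assumes "T > 0" and "0 < \<beta>" and "\<beta> < 1"
    and "levy_triplet A \<mu>" and "heat_kernel A \<mu> p"
    and kernel_smooth: "\<forall>t>0. \<forall>n. Cb_norm n UNIV (p t) < \<infinity>"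
    and alpha: "1 < \<alpha>" "\<alpha> \<le> 2"
    and kernel_gradient: "\<exists>c\<^sub>0>0. \<forall>t\<in>{0<..T}.
          (\<integral>\<^sup>+y. ennreal (norm (grad (p t) y)) \<partial>lborel) \<le> ennreal (c\<^sub>0 * t powr (- 1 / \<alpha>))"
    and alpha_beta: "\<alpha> + \<beta> \<in> {1<..<2} \<union> {2<..<3}"
    and A_zero: "A = 0"
    and mu_growth: "\<exists>c>0. \<forall>r\<in>{0<..<1}.
          (\<alpha> + \<beta> \<in> {1<..<2} \<longrightarrow>
             ennreal (r powr (- \<beta>)) *
               (\<integral>\<^sup>+y\<in>ball 0 r. ennreal (norm y powr (\<alpha> + \<beta>)) \<partial>\<mu>) +
             ennreal (r powr (\<alpha> - 1)) *
               (\<integral>\<^sup>+y\<in>ball 0 1 - ball 0 r. ennreal (norm y) \<partial>\<mu>) \<le> ennreal c) \<and>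
          (\<alpha> + \<beta> \<in> {2<..<3} \<longrightarrow>
             ennreal (r powr (\<alpha> - 2)) *
               (\<integral>\<^sup>+y\<in>ball 0 r. ennreal ((norm y)\<^sup>2) \<partial>\<mu>) +
             ennreal (r powr (1 - \<beta>)) *
               (\<integral>\<^sup>+y\<in>ball 0 1 - ball 0 r. ennreal (norm y powr (\<alpha> + \<beta> - 1)) \<partial>\<mu>) \<le> ennreal c)"
    and H_cont: "continuous_on ({0..T} \<times> UNIV) (\<lambda>(t, x, q). H t x q)"
    and H_bound: "\<exists>H\<^sub>0>0. \<forall>t\<in>{0<..<T}. \<forall>x. \<bar>H t x 0\<bar> \<le> H\<^sub>0"
    and H_lipschitz: "\<forall>R>0. \<exists>L>0. \<forall>t\<in>{0<..<T}. \<forall>x. \<forall>q\<in>ball 0 R. \<forall>q'\<in>ball 0 R.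
          \<bar>H t x q - H t x q'\<bar> \<le> L * norm (q - q')"
    and H_holder_space: "\<forall>R>0. \<exists>M>0. \<forall>t\<in>{0..T}. \<forall>q\<in>ball 0 R. \<forall>x x'. norm (x - x') < 1 \<longrightarrow>
          \<bar>H t x q - H t x' q\<bar> \<le> M * norm (x - x') powr \<beta>"
    and H_holder_time: "\<forall>R>0. \<exists>K>0. \<forall>t\<^sub>1\<in>{0..T}. \<forall>t\<^sub>2\<in>{0..T}. \<bar>t\<^sub>2 - t\<^sub>1\<bar> < 1 \<longrightarrow>
          (\<forall>x. \<forall>q\<in>ball 0 R. \<bar>H t\<^sub>2 x q - H t\<^sub>1 x q\<bar> \<le> K * \<bar>t\<^sub>2 - t\<^sub>1\<bar> powr (\<beta> / \<alpha>))"
  shows "\<exists>C :: ennreal \<Rightarrow> real. (\<forall>K. C K > 0) \<and>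
    (\<forall>u\<^sub>0 u. Cb_holder_norm (\<alpha> + \<beta>) UNIV u\<^sub>0 < \<infinity> \<longrightarrow>
            bounded_cont_Cb1 T u \<longrightarrow> mild_solution p H T u\<^sub>0 u \<longrightarrow>
       spacetime_norm \<alpha> \<beta> T u
         \<le> ennreal (C (grad_sup_norm T u)) *
             ((SUP t\<in>{0..T}. Cb_holder_norm (\<alpha> + \<beta>) UNIV (u t)) + 1))"
proof -
  obtain c where c: "0 < c" and lg: "levy_growth \<mu> (\<lambda>t. density lborel (\<lambda>x. ennreal (p t x))) (levy_symbol A \<mu>) (min (\<alpha> + \<beta>) 2) \<alpha> \<beta> (\<alpha> + \<beta>) c"
    using mu_growth levy_growth_from_hypotheses[OF assms(4,5) A_zero alpha assms(2,3) alpha_beta] by blast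
  interpret LG: levy_growth \<mu> "\<lambda>t. density lborel (\<lambda>x. ennreal (p t x))" "levy_symbol A \<mu>" "min (\<alpha> + \<beta>) 2" \<alpha> \<beta> "\<alpha> + \<beta>" c
    by (rule lg)
  have H_time: "continuous_on {0..T} (\<lambda>t. H t x q)" for x q
  proof -
    have "continuous_on {0..T} (\<lambda>t. (\<lambda>(t, x, q). H t x q) (t, x, q))"
      by (intro continuous_on_compose2[OF H_cont] continuous_intros) auto
    then show ?thesis by simp
  qed
  obtain H0 where H0: "0 < H0" "\<And>t x. t \<in> {0<..<T} \<Longrightarrow> \<bar>H t x 0\<bar> \<le> H0" using H_bound by blast
  have H0': "\<bar>H t x 0\<bar> \<le> H0" if "t \<in> {0..T}" for t x
    using \<open>T > 0\<close> H_time H0(2) that by (rule closed_time_bound)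
  have "\<exists>C>0. \<forall>u\<^sub>0 u. Cb_holder_norm (\<alpha> + \<beta>) UNIV u\<^sub>0 < \<infinity> \<longrightarrow>
            bounded_cont_Cb1 T u \<longrightarrow> mild_solution p H T u\<^sub>0 u \<longrightarrow> grad_sup_norm T u = K \<longrightarrow>
       spacetime_norm \<alpha> \<beta> T u \<le> ennreal C * ((SUP t\<in>{0..T}. Cb_holder_norm (\<alpha> + \<beta>) UNIV (u t)) + 1)" for K
  proof -
    \<comment> \<open>For infinite \<open>K\<close> this is the default \<open>0\<close>. That case is void, as finite slice norms force \<open>K\<close> to be finite.\<close>
    define Kr where "Kr = enn2real K"
    have Kr: "0 \<le> Kr" by (simp add: Kr_def)
    then have R: "0 < Kr + 1" by simp
    obtain L where L: "0 < L" "\<And>t x q q'. t \<in> {0<..<T} \<Longrightarrow> q \<in> ball 0 (Kr + 1) \<Longrightarrow> q' \<in> ball 0 (Kr + 1) \<Longrightarrow> \<bar>H t x q - H t x q'\<bar> \<le> L * norm (q - q')"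
      using H_lipschitz R by meson
    have L': "\<bar>H t x q - H t x q'\<bar> \<le> L * norm (q - q')"
      if "t \<in> {0..T}" "q \<in> ball 0 (Kr + 1)" "q' \<in> ball 0 (Kr + 1)" for t x q q'
      using \<open>T > 0\<close> continuous_on_diff[OF H_time H_time] L(2)[OF _ that(2,3)] that(1) by (rule closed_time_bound)
    obtain M where M: "0 < M" "\<And>t x x' q. t \<in> {0..T} \<Longrightarrow> q \<in> ball 0 (Kr + 1) \<Longrightarrow> norm (x - x') < 1 \<Longrightarrow>
          \<bar>H t x q - H t x' q\<bar> \<le> M * norm (x - x') powr \<beta>"
      using H_holder_space R by meson
    obtain N where N: "0 < N" "\<And>t s x q. t \<in> {0..T} \<Longrightarrow> s \<in> {0..T} \<Longrightarrow> \<bar>s - t\<bar> < 1 \<Longrightarrow> q \<in> ball 0 (Kr + 1) \<Longrightarrow>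
          \<bar>H s x q - H t x q\<bar> \<le> N * \<bar>s - t\<bar> powr (\<beta> / \<alpha>)"
      using H_holder_time R by meson
    define k where "k = (real CARD('d))\<^sup>2"
    define a where "a = 2 * (H0 + L * (Kr + 1)) + M + 2 * L * k"
    define e where "e = 4 * k * LG.jump_const + a"
    define Z where "Z = k + (k + e + (2 * e + 10 * (2 * k + e) * LG.jump_const + (N + 5 * L * (2 * k + e)))) + e
     + (real (card (dirs 1 :: (real^'d) list set)) + real (card (dirs 2 :: (real^'d) list set))) * (5 * (2 * k + e))"
    have k0: "0 < k" by (simp add: k_def)
    have e0: "0 \<le> e" unfolding e_def a_def using H0(1) L(1) M(1) Kr k0 LG.jump_const_nonneg by simp
    have Z: "0 < Z"
      unfolding Z_def using k0 e0 LG.jump_const_nonneg N(1) L(1)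
      by (intro add_pos_nonneg) auto
    show ?thesis
    proof (intro exI[of _ Z] conjI allI impI Z)
      fix u\<^sub>0 u
      assume u: "mild_solution p H T u\<^sub>0 u" "grad_sup_norm T u = K"
      define Sup where "Sup = (SUP t\<in>{0..T}. Cb_holder_norm (\<alpha> + \<beta>) UNIV (u t))"
      show "spacetime_norm \<alpha> \<beta> T u \<le> ennreal Z * ((SUP t\<in>{0..T}. Cb_holder_norm (\<alpha> + \<beta>) UNIV (u t)) + 1)"
        unfolding Sup_def[symmetric]
      proof (cases "Sup = \<infinity>")
        case True
        then show "spacetime_norm \<alpha> \<beta> T u \<le> ennreal Z * (Sup + 1)" using Z by (simp add: ennreal_mult_eq_top_iff)
      next
        case False
        define X where "X = enn2real Sup + 1"
        have SX: "Sup + 1 = ennreal X"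
          using False by (simp add: X_def less_top ennreal_plus)
        have X1: "1 \<le> X" by (simp add: X_def)
        have norm: "Cb_holder_norm (\<alpha> + \<beta>) UNIV (u t) \<le> ennreal X" if "0 \<le> t" "t \<le> T" for t
        proof -
          have "Cb_holder_norm (\<alpha> + \<beta>) UNIV (u t) \<le> Sup" unfolding Sup_def using that by (intro SUP_upper) auto
          also have "\<dots> \<le> Sup + 1" by simp
          finally show ?thesis unfolding SX .
        qed
        have kX: "0 \<le> k * X" using k0 X1 by simp
        have "sup_norm UNIV (grad (u t)) \<le> ennreal (k * X)" if "t \<in> {0<..T}" for t
          using holder_classD(3)[OF holder_class_from_norm[OF _ norm LG.gamma_bounds LG.gamma(2)]] that X1 kX
          by (subst sup_norm_le_iff) (auto simp: k_def)
        then have "K \<le> ennreal (k * X)" unfolding u(2)[symmetric] grad_sup_norm_def by (rule SUP_least)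
        then have KK: "K = ennreal Kr"
          unfolding Kr_def by (subst ennreal_enn2real) (auto simp: top_unique less_top[symmetric])
        have grad_bound: "norm (grad (u t) x) \<le> Kr" if "0 < t" "t \<le> T" for t x
        proof -
          have "sup_norm UNIV (grad (u t)) \<le> K"
            unfolding u(2)[symmetric] grad_sup_norm_def using that by (intro SUP_upper) auto
          then show ?thesis unfolding KK using Kr by (simp add: sup_norm_le_iff)
        qed
        have p: "p t \<in> borel_measurable borel" "0 \<le> p t x" if "0 < t" for t x
          using \<open>heat_kernel A \<mu> p\<close> that by (auto simp: heat_kernel_def)
        have "spacetime_norm \<alpha> \<beta> T u \<le> ennreal (Z * X)"
          unfolding Z_def e_def a_def k_def
          by (rule mild_solution_bound[OF \<open>T > 0\<close> lg p H_cont less_imp_le[OF H0(1)] H0' Kr less_imp_le[OF L(1)] L'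
                less_imp_le[OF M(1)] M(2) less_imp_le[OF N(1)] N(2) u(1) grad_bound X1 norm])
        also have "\<dots> = ennreal Z * (Sup + 1)" unfolding SX using Z X1 by (simp add: ennreal_mult)
        finally show "spacetime_norm \<alpha> \<beta> T u \<le> ennreal Z * (Sup + 1)" .
      qed
    qed
  qed
  then have "\<forall>K. \<exists>C. C > 0 \<and> (\<forall>u\<^sub>0 u. Cb_holder_norm (\<alpha> + \<beta>) UNIV u\<^sub>0 < \<infinity> \<longrightarrow>
            bounded_cont_Cb1 T u \<longrightarrow> mild_solution p H T u\<^sub>0 u \<longrightarrow> grad_sup_norm T u = K \<longrightarrow>
       spacetime_norm \<alpha> \<beta> T u \<le> ennreal C * ((SUP t\<in>{0..T}. Cb_holder_norm (\<alpha> + \<beta>) UNIV (u t)) + 1))"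
    by blast
  from choice[OF this] show ?thesis by blast
qed

end
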